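(* Suppose $(\boldsymbol u_h,\boldsymbol n_h)\in K_h\times N_h$, and at $(\boldsymbol u_h,\boldsymbol n_h)$ the inf-sup conditions for $b_1$ and $b_2$ are both satisfied. Then there exist a unique $p_h\in V_h$ and a unique $\lambda_h\in V_{h,\lambda_0|\Gamma_1}$ such that $(\boldsymbol u_h,\boldsymbol n_h,p_h,\lambda_h)$ is a solution of the discrete equilibrium equations: with $F_h=I+\nabla\boldsymbol u_h$, $$0=\int_\Omega 2\big(F_h:\nabla\boldsymbol v-(1-a)(F_h^T\boldsymbol n_h,\nabla\boldsymbol v^T\boldsymbol n_h)\big)-p_h\frac{\partial\det}{\partial F}(F_h):\nabla\boldsymbol v-\int_\Omega\boldsymbol f\cdot\boldsymbol v-\int_{\Gamma_2}\boldsymbol g\cdot\boldsymbol v\,da,$$ $$0=\int_\Omega-2(1-a)(F_h^T\boldsymbol n_h,F_h^T\boldsymbol m)+2b(\nabla\boldsymbol m,\nabla\boldsymbol n_h)+2\lambda_h\,\pi_h(\boldsymbol n_h,\boldsymbol m),$$ $$0=\int_\Omega-q(\det F_h-1),\qquad 0=\int_\Omega\mu\,\pi_h\big((\boldsymbol n_h,\boldsymbol n_h)-1\big)$$ for all test functions $(\boldsymbol v,\boldsymbol m,q,\mu)\in\mathbf{W}_{h,0|\Gamma_0}\times\mathbf{V}_{h,0|\Gamma_1}\times V_h\times V_{h,0|\Gamma_1}$.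
   Context: $\Omega\subset\mathbb{R}^2$ is the domain (nondimensionalized reference configuration of a liquid crystal elastomer) with a triangular mesh, and $\Gamma_0,\Gamma_1,\Gamma_2$ are parts of its boundary $\partial\Omega$. $a\in(0,1)$ is a constant, $b$ is the constant (nondimensionalized) coefficient of the Oseen-Frank energy, $\boldsymbol f$ is the body force and $\boldsymbol g$ the traction force on $\Gamma_2$. $(\cdot,\cdot)$ is the Euclidean inner product of vectors (Frobenius inner product of matrices), $A:B=\mathrm{tr}(A^TB)$, $|\cdot|$ is the corresponding norm, and $\frac{\partial\det}{\partial F}$ is the gradient of the determinant (the cofactor matrix). $V_h$ is the space of continuous piecewise linear functions on the mesh and $W_h$ the space of continuous piecewise quadratic functions; $V_{h,g|\Gamma}=\{v\in V_h\cap H^1:v=g\text{ on }\Gamma\}$, $W_{h,g|\Gamma}=\{w\in W_h\cap H^1:w=g\text{ on }\Gamma\}$; boldface denotes the $\mathbb{R}^2$-valued versions; $\pi_h$ is the nodal interpolation operator onto $V_h$ (or $\mathbf{V}_h$), and $\pi_h(\boldsymbol n_h,\boldsymbol m)$ means $\pi_h$ applied to the function $\boldsymbol n_h\cdot\boldsymbol m$. $\lambda_0$ is given boundary data for $\lambda_h$. For given discrete boundary data $\boldsymbol u_{0h}\in\mathbf{W}_h$ and $\boldsymbol n_{0h}\in\mathbf{V}_h$, $$K_h=\Big\{\boldsymbol u_h\in\mathbf{W}_{h,0|\Gamma_0}+\boldsymbol u_{0h}:\ \int_\Omega q_h(\det(I+\nabla\boldsymbol u_h)-1)\,dx=0\ \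 \forall q_h\in V_h\Big\},$$ $$N_h=\Big\{\boldsymbol n_h\in\mathbf{V}_{h,0|\Gamma_1}+\boldsymbol n_{0h}:\ \int_\Omega\mu_h\,\pi_h(|\boldsymbol n_h|^2-1)\,dx=0\ \ \forall\mu_h\in V_{h,0|\Gamma_1}\Big\}.$$ The function $\pi_h(|\boldsymbol n_h|^2-1)$ is taken to lie in $V_{h,0|\Gamma_1}$, so that $\boldsymbol n_h\in N_h$ if and only if $|\boldsymbol n_h|=1$ at all the mesh nodes. The bilinear forms at $(\boldsymbol u_h,\boldsymbol n_h)$ are $$b_1(q,\boldsymbol v)=\int_\Omega-q\,\frac{\partial\det}{\partial F}(I+\nabla\boldsymbol u_h):\nabla\boldsymbol v,\qquad b_2(\mu,\boldsymbol m)=\int_\Omega2\mu\,\pi_h(\boldsymbol n_h,\boldsymbol m).$$ The inf-sup condition for $b_1$ is: there is $\beta_1>0$ with $$\inf_{0\ne q\in V_h}\sup_{0\ne\boldsymbol v\in\mathbf{W}_{h,0|\Gamma_0}}\frac{b_1(q,\boldsymbol v)}{\|q\|_0\|\boldsymbol v\|_1}\ge\beta_1;$$ the inf-sup condition for $b_2$ is: there is $\beta_2>0$ with $$\inf_{0\ne\mu\in V_{h,0|\Gamma_1}}\sup_{0\ne\boldsymbol m\in\mathbf{V}_{h,0|\Gamma_1}}\frac{b_2(\mu,\boldsymbol m)}{\|\mu\|_{-1}\|\boldsymbol m\|_1}\ge\beta_2.$$ Here $\|\cdot\|_0,\|\cdot\|_1$ are the $L^2$ and $H^1$ norms and $\|\cdot\|_{-1}$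 is the norm of the dual of $\{v\in H^1(\Omega):v=0\text{ on }\Gamma_1\}$.
   Formalization: The claim as printed fails (one triangle, no boundary parts, u_h=0, n_h=e_1, f=e_1); the formal theorem also assumes the discrete energy is stationary at (u_h,n_h) along curves in K_h×N_h, which is necessary for the multipliers to exist. *)

theory Defs
  imports "HOL-Analysis.Analysis"
begin

section \<open>Mesh and boundary parts\<close>

text \<open>
  The mesh is conforming: \<^const>\<open>triangulation\<close> makes any two cells meet in a common face.
  The domain is the interior of the union of the closed triangles, so it has no slits.
\<close>

definition triangular_mesh :: "(real^2) set \<Rightarrow> (real^2) set set \<Rightarrow> bool" where
  "triangular_mesh \<Omega> \<T> \<longleftrightarrow>
     triangulation \<T> \<and> \<T> \<noteq> {} \<and> (\<forall>T\<in>\<T>. 2 simplex T) \<and>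
     \<Omega> = interior (\<Union>\<T>) \<and> connected \<Omega>"

definition nodes :: "(real^2) set set \<Rightarrow> (real^2) set" where
  "nodes \<T> = (\<Union>T\<in>\<T>. {x. x extreme_point_of T})"

definition boundary_edges :: "(real^2) set \<Rightarrow> (real^2) set set \<Rightarrow> (real^2) set set" where
  "boundary_edges \<Omega> \<T> = {e. (\<exists>T\<in>\<T>. e facet_of T) \<and> e \<subseteq> frontier \<Omega>}"

definition boundary_part :: "(real^2) set \<Rightarrow> (real^2) set set \<Rightarrow> (real^2) set \<Rightarrow> bool" where
  "boundary_part \<Omega> \<T> \<Gamma> \<longleftrightarrow> (\<exists>E \<subseteq> boundary_edges \<Omega> \<T>. \<Gamma> = \<Union>E)"

text \<open>
  Arc-length integral over a segment.  The double sum runs over the ordered pairs of end points,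
  so each orientation of the segment occurs once (the diagonal terms vanish), whence the factor
  one half.
\<close>

definition edge_integral :: "(real^2) set \<Rightarrow> (real^2 \<Rightarrow> real) \<Rightarrow> real" where
  "edge_integral e \<phi> =
     (\<Sum>A | A extreme_point_of e. \<Sum>B | B extreme_point_of e.
        dist A B * (LINT t:{0..1}|lebesgue. \<phi> (A + t *\<^sub>R (B - A)))) / 2"

definition boundary_integral ::
    "(real^2) set \<Rightarrow> (real^2) set set \<Rightarrow> (real^2) set \<Rightarrow> (real^2 \<Rightarrow> real) \<Rightarrow> real" where
  "boundary_integral \<Omega> \<T> \<Gamma> \<phi> =
     (\<Sum>e | e \<in> boundary_edges \<Omega> \<T> \<and> e \<subseteq> \<Gamma>. edge_integral e \<phi>)"

definition boundary_integrable ::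
    "(real^2) set \<Rightarrow> (real^2) set set \<Rightarrow> (real^2) set \<Rightarrow> (real^2 \<Rightarrow> real^2) \<Rightarrow> bool" where
  "boundary_integrable \<Omega> \<T> \<Gamma> g \<longleftrightarrow>
     (\<forall>A B. closed_segment A B \<in> boundary_edges \<Omega> \<T> \<and> closed_segment A B \<subseteq> \<Gamma> \<longrightarrow>
        set_integrable lebesgue {0..1} (\<lambda>t. g (A + t *\<^sub>R (B - A))))"


section \<open>Finite element spaces\<close>

text \<open>
  Functions on the closed domain are represented by functions on the plane that vanish outside
  it, so that equality of functions (in particular uniqueness, and being nonzero) is equality on
  the closed domain.  Such functions are automatically in \<open>H\<^sup>1\<close>.
\<close>

definition Vh :: "(real^2) set set \<Rightarrow> (real^2 \<Rightarrow> real) set" where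
  "Vh \<T> = {v. continuous_on (\<Union>\<T>) v \<and> (\<forall>x. x \<notin> \<Union>\<T> \<longrightarrow> v x = 0) \<and>
             (\<forall>T\<in>\<T>. \<exists>c d. \<forall>x\<in>T. v x = c + d \<bullet> x)}"

definition Wh :: "(real^2) set set \<Rightarrow> (real^2 \<Rightarrow> real) set" where
  "Wh \<T> = {w. continuous_on (\<Union>\<T>) w \<and> (\<forall>x. x \<notin> \<Union>\<T> \<longrightarrow> w x = 0) \<and>
             (\<forall>T\<in>\<T>. \<exists>c d (A::real^2^2). \<forall>x\<in>T. w x = c + d \<bullet> x + x \<bullet> (A *v x))}"

definition vec_space :: "(real^2 \<Rightarrow> real) set \<Rightarrow> (real^2 \<Rightarrow> real^2) set" where
  "vec_space S = {v. \<forall>i. (\<lambda>x. v x $ i) \<in> S}"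

definition with_bc :: "(real^2 \<Rightarrow> 'b) set \<Rightarrow> (real^2 \<Rightarrow> 'b) \<Rightarrow> (real^2) set \<Rightarrow> (real^2 \<Rightarrow> 'b) set" where
  "with_bc S g \<Gamma> = {v \<in> S. \<forall>x\<in>\<Gamma>. v x = g x}"

definition interp :: "(real^2) set set \<Rightarrow> (real^2 \<Rightarrow> real) \<Rightarrow> (real^2 \<Rightarrow> real)" where
  "interp \<T> \<phi> = (THE v. v \<in> Vh \<T> \<and> (\<forall>x\<in>nodes \<T>. v x = \<phi> x))"


section \<open>Gradients and norms\<close>

text \<open>
  \<open>grad u x $ i $ j\<close> is the derivative of the \<open>i\<close>-th component in direction \<open>j\<close>.  For finite element
  functions it is meaningful in the interior of each triangle, hence almost everywhere.  The inner
  product and norm of the type \<^typ>\<open>real^2^2\<close> are the Frobenius ones.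
\<close>

definition grad :: "(real^2 \<Rightarrow> real^2) \<Rightarrow> real^2 \<Rightarrow> real^2^2" where
  "grad u x = jacobian u (at x)"

definition def_grad :: "(real^2 \<Rightarrow> real^2) \<Rightarrow> real^2 \<Rightarrow> real^2^2" where
  "def_grad u x = mat 1 + grad u x"

definition det_grad :: "real^2^2 \<Rightarrow> real^2^2" where
  "det_grad F = (THE D. GDERIV det F :> D)"

lemma GDERIV_det_2:
  fixes F :: "real^2^2"
  shows "GDERIV det F :> vector [vector [F$2$2, - F$2$1], vector [- F$1$2, F$1$1]]"
proof -
  have "((\<lambda>A::real^2^2. A$1$1 * A$2$2 - A$1$2 * A$2$1) has_derivative
        (\<lambda>h. (F$1$1 * h$2$2 + h$1$1 * F$2$2) - (F$1$2 * h$2$1 + h$1$2 * F$2$1))) (at F)"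
    by (intro has_derivative_diff has_derivative_mult bounded_linear.has_derivative[OF bounded_linear_vec_nth]
        has_derivative_ident)
  moreover have "det = (\<lambda>A::real^2^2. A$1$1 * A$2$2 - A$1$2 * A$2$1)"
    by (simp add: fun_eq_iff det_2)
  ultimately show ?thesis
    by (simp add: gderiv_def inner_vec_def sum_2 vector_2 algebra_simps)
qed

lemma det_grad_cofactor:
  "det_grad F = vector [vector [F$2$2, - F$2$1], vector [- F$1$2, F$1$1]]"
  unfolding det_grad_def
proof (rule the_equality)
  show "GDERIV det F :> vector [vector [F$2$2, - F$2$1], vector [- F$1$2, F$1$1]]"
    by (rule GDERIV_det_2)
next
  fix D assume D: "GDERIV det F :> D"
  have "(\<lambda>h. h \<bullet> D) = (\<lambda>h. h \<bullet> vector [vector [F$2$2, - F$2$1], vector [- F$1$2, F$1$1]])"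
    using D GDERIV_det_2[of F] unfolding gderiv_def by (rule has_derivative_unique)
  then show "D = vector [vector [F$2$2, - F$2$1], vector [- F$1$2, F$1$1]]"
    by (metis (no_types, lifting) vector_eq_ldot)
qed

definition L2_fun :: "(real^2) set \<Rightarrow> (real^2 \<Rightarrow> 'b::euclidean_space) \<Rightarrow> bool" where
  "L2_fun \<Omega> v \<longleftrightarrow> v \<in> borel_measurable (lebesgue_on \<Omega>) \<and>
                  set_integrable lebesgue \<Omega> (\<lambda>x. (norm (v x))\<^sup>2)"

definition L2_norm :: "(real^2) set \<Rightarrow> (real^2 \<Rightarrow> 'b::euclidean_space) \<Rightarrow> real" where
  "L2_norm \<Omega> v = sqrt (LINT x:\<Omega>|lebesgue. (norm (v x))\<^sup>2)"

definition H1_norm :: "(real^2) set \<Rightarrow> (real^2 \<Rightarrow> 'b::euclidean_space) \<Rightarrow>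
    (real^2 \<Rightarrow> 'c::euclidean_space) \<Rightarrow> real" where
  "H1_norm \<Omega> v G = sqrt ((L2_norm \<Omega> v)\<^sup>2 + (L2_norm \<Omega> G)\<^sup>2)"

text \<open>
  A scalar \<open>H\<^sup>1\<close> function is handled together with its weak gradient, which is unique up to null
  sets.  Test functions are continuously differentiable with compact support, and the trace on \<open>\<Gamma>\<close>
  is the limit in \<open>L\<^sup>2(\<Gamma>)\<close> of the restrictions of functions that are continuously differentiable up
  to the boundary and converge in \<open>H\<^sup>1\<close>.
\<close>

definition C1_fun :: "(real^2 \<Rightarrow> real) \<Rightarrow> (real^2 \<Rightarrow> real^2) \<Rightarrow> bool" where
  "C1_fun \<phi> \<phi>' \<longleftrightarrow> (\<forall>x. GDERIV \<phi> x :> \<phi>' x) \<and> continuous_on UNIV \<phi>'"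

definition H1_fun :: "(real^2) set \<Rightarrow> (real^2 \<Rightarrow> real) \<Rightarrow> (real^2 \<Rightarrow> real^2) \<Rightarrow> bool" where
  "H1_fun \<Omega> v G \<longleftrightarrow> L2_fun \<Omega> v \<and> L2_fun \<Omega> G \<and>
     (\<forall>\<phi> \<phi>'. C1_fun \<phi> \<phi>' \<and> compact (closure {x. \<phi> x \<noteq> 0}) \<and> closure {x. \<phi> x \<noteq> 0} \<subseteq> \<Omega> \<longrightarrow>
        (LINT x:\<Omega>|lebesgue. v x *\<^sub>R \<phi>' x) = - (LINT x:\<Omega>|lebesgue. \<phi> x *\<^sub>R G x))"

definition zero_trace :: "(real^2) set \<Rightarrow> (real^2) set set \<Rightarrow> (real^2) set \<Rightarrow>
    (real^2 \<Rightarrow> real) \<Rightarrow> (real^2 \<Rightarrow> real^2) \<Rightarrow> bool" where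
  "zero_trace \<Omega> \<T> \<Gamma> v G \<longleftrightarrow>
     (\<exists>\<phi> \<phi>'. (\<forall>k::nat. C1_fun (\<phi> k) (\<phi>' k)) \<and>
        (\<lambda>k. H1_norm \<Omega> (\<lambda>x. \<phi> k x - v x) (\<lambda>x. \<phi>' k x - G x)) \<longlonglongrightarrow> 0 \<and>
        (\<lambda>k. boundary_integral \<Omega> \<T> \<Gamma> (\<lambda>x. (\<phi> k x)\<^sup>2)) \<longlonglongrightarrow> 0)"

definition dual_norm :: "(real^2) set \<Rightarrow> (real^2) set set \<Rightarrow> (real^2) set \<Rightarrow> (real^2 \<Rightarrow> real) \<Rightarrow> real" where
  "dual_norm \<Omega> \<T> \<Gamma> \<mu> =
     (SUP (v, G) \<in> {(v, G). H1_fun \<Omega> v G \<and> zero_trace \<Omega> \<T> \<Gamma> v G \<and> H1_norm \<Omega> v G \<noteq> 0}.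
        \<bar>LINT x:\<Omega>|lebesgue. \<mu> x * v x\<bar> / H1_norm \<Omega> v G)"


section \<open>Admissible sets\<close>

definition Kh :: "(real^2) set \<Rightarrow> (real^2) set set \<Rightarrow> (real^2) set \<Rightarrow> (real^2 \<Rightarrow> real^2) \<Rightarrow>
    (real^2 \<Rightarrow> real^2) set" where
  "Kh \<Omega> \<T> \<Gamma>0 u0 =
     {u. (\<exists>w \<in> with_bc (vec_space (Wh \<T>)) (\<lambda>_. 0) \<Gamma>0. u = (\<lambda>x. w x + u0 x)) \<and>
         (\<forall>q\<in>Vh \<T>. (LINT x:\<Omega>|lebesgue. q x * (det (def_grad u x) - 1)) = 0)}"

definition Nh :: "(real^2) set \<Rightarrow> (real^2) set set \<Rightarrow> (real^2) set \<Rightarrow> (real^2 \<Rightarrow> real^2) \<Rightarrow>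
    (real^2 \<Rightarrow> real^2) set" where
  "Nh \<Omega> \<T> \<Gamma>1 n0 =
     {n. (\<exists>m \<in> with_bc (vec_space (Vh \<T>)) (\<lambda>_. 0) \<Gamma>1. n = (\<lambda>x. m x + n0 x)) \<and>
         (\<forall>\<mu> \<in> with_bc (Vh \<T>) (\<lambda>_. 0) \<Gamma>1.
            (LINT x:\<Omega>|lebesgue. \<mu> x * interp \<T> (\<lambda>y. (norm (n y))\<^sup>2 - 1) x) = 0)}"


section \<open>Bilinear forms and inf-sup conditions\<close>

definition b1 :: "(real^2) set \<Rightarrow> (real^2 \<Rightarrow> real^2) \<Rightarrow> (real^2 \<Rightarrow> real) \<Rightarrow> (real^2 \<Rightarrow> real^2) \<Rightarrow> real" where
  "b1 \<Omega> u q v = (LINT x:\<Omega>|lebesgue. - q x * (det_grad (def_grad u x) \<bullet> grad v x))"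

definition b2 :: "(real^2) set \<Rightarrow> (real^2) set set \<Rightarrow> (real^2 \<Rightarrow> real^2) \<Rightarrow> (real^2 \<Rightarrow> real) \<Rightarrow>
    (real^2 \<Rightarrow> real^2) \<Rightarrow> real" where
  "b2 \<Omega> \<T> n \<mu> m = (LINT x:\<Omega>|lebesgue. 2 * \<mu> x * interp \<T> (\<lambda>y. n y \<bullet> m y) x)"

text \<open>
  In \<^typ>\<open>ereal\<close> the infimum over the empty set is \<open>\<infinity>\<close> and the supremum over it is \<open>-\<infinity>\<close>, so the
  conditions have the intended meaning also when one of the spaces is trivial.
\<close>

definition inf_sup_b1 :: "(real^2) set \<Rightarrow> (real^2) set set \<Rightarrow> (real^2) set \<Rightarrow>
    (real^2 \<Rightarrow> real^2) \<Rightarrow> bool" where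
  "inf_sup_b1 \<Omega> \<T> \<Gamma>0 u \<longleftrightarrow>
     (\<exists>\<beta>>0. (INF q \<in> Vh \<T> - {\<lambda>_. 0}.
             SUP v \<in> with_bc (vec_space (Wh \<T>)) (\<lambda>_. 0) \<Gamma>0 - {\<lambda>_. 0}.
               ereal (b1 \<Omega> u q v / (L2_norm \<Omega> q * H1_norm \<Omega> v (grad v)))) \<ge> ereal \<beta>)"

definition inf_sup_b2 :: "(real^2) set \<Rightarrow> (real^2) set set \<Rightarrow> (real^2) set \<Rightarrow>
    (real^2 \<Rightarrow> real^2) \<Rightarrow> bool" where
  "inf_sup_b2 \<Omega> \<T> \<Gamma>1 n \<longleftrightarrow>
     (\<exists>\<beta>>0. (INF \<mu> \<in> with_bc (Vh \<T>) (\<lambda>_. 0) \<Gamma>1 - {\<lambda>_. 0}.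
             SUP m \<in> with_bc (vec_space (Vh \<T>)) (\<lambda>_. 0) \<Gamma>1 - {\<lambda>_. 0}.
               ereal (b2 \<Omega> \<T> n \<mu> m / (dual_norm \<Omega> \<T> \<Gamma>1 \<mu> * H1_norm \<Omega> m (grad m)))) \<ge> ereal \<beta>)"


section \<open>Energy and equilibrium equations\<close>

definition energy :: "(real^2) set \<Rightarrow> (real^2) set set \<Rightarrow> (real^2) set \<Rightarrow> real \<Rightarrow> real \<Rightarrow>
    (real^2 \<Rightarrow> real^2) \<Rightarrow> (real^2 \<Rightarrow> real^2) \<Rightarrow>
    (real^2 \<Rightarrow> real^2) \<Rightarrow> (real^2 \<Rightarrow> real^2) \<Rightarrow> real" where
  "energy \<Omega> \<T> \<Gamma>2 a b f g u n =
     (LINT x:\<Omega>|lebesgue. (norm (def_grad u x))\<^sup>2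
        - (1 - a) * (norm (transpose (def_grad u x) *v n x))\<^sup>2
        + b * (norm (grad n x))\<^sup>2)
     - (LINT x:\<Omega>|lebesgue. f x \<bullet> u x)
     - boundary_integral \<Omega> \<T> \<Gamma>2 (\<lambda>x. g x \<bullet> u x)"

text \<open>
  Stationarity of a functional \<open>E\<close> at \<open>(u, n)\<close> on the constraint set \<open>K \<times> N\<close>: its derivative vanishes
  along every curve in the set through \<open>(u, n)\<close>.  The elements of the sets considered here are
  determined by finitely many point values, so differentiability of a curve can be expressed
  pointwise.  Minimisers are stationary; no linearisation of the constraints is involved.
\<close>

definition stationary_on :: "(real^2 \<Rightarrow> real^2) set \<Rightarrow> (real^2 \<Rightarrow> real^2) set \<Rightarrow>
    ((real^2 \<Rightarrow> real^2) \<Rightarrow> (real^2 \<Rightarrow> real^2) \<Rightarrow> real) \<Rightarrow>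
    (real^2 \<Rightarrow> real^2) \<Rightarrow> (real^2 \<Rightarrow> real^2) \<Rightarrow> bool" where
  "stationary_on K N E u n \<longleftrightarrow>
     (\<forall>U V. (\<forall>t::real. U t \<in> K \<and> V t \<in> N) \<and> U 0 = u \<and> V 0 = n \<and>
        (\<forall>x. (\<lambda>t. U t x) differentiable (at 0) \<and> (\<lambda>t. V t x) differentiable (at 0)) \<longrightarrow>
        (\<forall>D. ((\<lambda>t. E (U t) (V t)) has_real_derivative D) (at 0) \<longrightarrow> D = 0))"

lemma minimiser_stationary:
  assumes "\<And>v m. v \<in> K \<Longrightarrow> m \<in> N \<Longrightarrow> E u n \<le> E v m"
  shows "stationary_on K N E u n"
  unfolding stationary_on_def
proof (intro allI impI)
  fix U V D
  assume c: "(\<forall>t::real. U t \<in> K \<and> V t \<in> N) \<and> U 0 = u \<and> V 0 = n \<and>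
        (\<forall>x. (\<lambda>t. U t x) differentiable (at 0) \<and> (\<lambda>t. V t x) differentiable (at 0))"
    and d: "((\<lambda>t. E (U t) (V t)) has_real_derivative D) (at 0)"
  show "D = 0"
    by (rule DERIV_local_min[OF d, of 1]) (use c assms in auto)
qed

definition discrete_equilibrium :: "(real^2) set \<Rightarrow> (real^2) set set \<Rightarrow>
    (real^2) set \<Rightarrow> (real^2) set \<Rightarrow> (real^2) set \<Rightarrow> real \<Rightarrow> real \<Rightarrow>
    (real^2 \<Rightarrow> real^2) \<Rightarrow> (real^2 \<Rightarrow> real^2) \<Rightarrow>
    (real^2 \<Rightarrow> real^2) \<Rightarrow> (real^2 \<Rightarrow> real^2) \<Rightarrow> (real^2 \<Rightarrow> real) \<Rightarrow> (real^2 \<Rightarrow> real) \<Rightarrow> bool" where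
  "discrete_equilibrium \<Omega> \<T> \<Gamma>0 \<Gamma>1 \<Gamma>2 a b f g u n p l \<longleftrightarrow>
     (\<forall>v \<in> with_bc (vec_space (Wh \<T>)) (\<lambda>_. 0) \<Gamma>0.
        0 = (LINT x:\<Omega>|lebesgue.
               2 * (def_grad u x \<bullet> grad v x
                    - (1 - a) * ((transpose (def_grad u x) *v n x) \<bullet> (transpose (grad v x) *v n x)))
               - p x * (det_grad (def_grad u x) \<bullet> grad v x))
            - (LINT x:\<Omega>|lebesgue. f x \<bullet> v x)
            - boundary_integral \<Omega> \<T> \<Gamma>2 (\<lambda>x. g x \<bullet> v x)) \<and>
     (\<forall>m \<in> with_bc (vec_space (Vh \<T>)) (\<lambda>_. 0) \<Gamma>1.
        0 = (LINT x:\<Omega>|lebesgue.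
               - 2 * (1 - a) * ((transpose (def_grad u x) *v n x) \<bullet> (transpose (def_grad u x) *v m x))
               + 2 * b * (grad m x \<bullet> grad n x)
               + 2 * l x * interp \<T> (\<lambda>y. n y \<bullet> m y) x)) \<and>
     (\<forall>q \<in> Vh \<T>. 0 = (LINT x:\<Omega>|lebesgue. - q x * (det (def_grad u x) - 1))) \<and>
     (\<forall>\<mu> \<in> with_bc (Vh \<T>) (\<lambda>_. 0) \<Gamma>1.
        0 = (LINT x:\<Omega>|lebesgue. \<mu> x * interp \<T> (\<lambda>y. n y \<bullet> n y - 1) x))"

end

theory Submission
  imports Defs
begin

text \<open>
  The discrete equilibrium equations are the Lagrange multiplier conditions for the energy under the
  constraints defining \<open>K\<^sub>h\<close> and \<open>N\<^sub>h\<close>.  The energy is stationary along every curve in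
  \<open>K\<^sub>h \<times> N\<^sub>h\<close> through \<open>(u, n)\<close>.  If every \<open>v\<close> annihilated by all \<open>b\<^sub>1(q, \<sqdot>)\<close> is the velocity of
  such a curve, then the linear form taking \<open>v\<close> to the derivative of the energy in direction \<open>v\<close> vanishes on
  \<open>\<Inter>\<^sub>q ker b\<^sub>1(q, \<sqdot>)\<close>, and linear algebra in finitely many forms represents it as \<open>- b\<^sub>1(p, \<sqdot>)\<close>
  for some \<open>p \<in> V\<^sub>h\<close>.  The same argument with \<open>b\<^sub>2\<close> gives \<open>\<lambda>\<close>.

  The inf-sup conditions enter through nondegeneracy: \<open>b(q, \<sqdot>) \<noteq> 0\<close> for \<open>q \<noteq> 0\<close>
  (\<open>ex_nonzero_of_inf_sup\<close>).  It gives uniqueness of the multipliers at once.  It also makes the forms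
  \<open>b\<^sub>1(\<phi>\<^sub>z, \<sqdot>)\<close>, for the nodal basis functions \<open>\<phi>\<^sub>z\<close> (here \<open>hat z\<close>), linearly independent, so that
  they have dual vectors \<open>e\<^sub>z\<close> (\<open>nodal_dual_vectors\<close>).

  Tangent vectors are velocities, for two different reasons.

  For \<open>N\<^sub>h\<close> the constraint says that \<open>n\<close> has unit length at every node, and \<open>b\<^sub>2(\<mu>, m) = 0\<close> for all
  \<open>\<mu>\<close> says that \<open>m \<bottom> n\<close> at every node.  The required curve is nodewise normalisation
  of \<open>n + t m\<close> (\<open>Nh_curve\<close>).

  For \<open>K\<^sub>h\<close> an implicit function argument is needed (\<open>Kh_curve\<close>).  The determinant is quadratic in
  two dimensions, so inserting \<open>U t = u + t v + t\<^sup>2 (\<Sum>\<^sub>z s\<^sub>z e\<^sub>z)\<close> into the constraint tested with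
  \<open>\<phi>\<^sub>z\<close> and dividing by \<open>t\<^sup>2\<close> leaves \<open>s\<^sub>z = A\<^sub>z + t (B s)\<^sub>z + t\<^sup>2 C\<^sub>z(s, s)\<close>, which for small \<open>t\<close> is
  a contraction with uniformly bounded solutions (\<open>quadratic_system_solvable\<close>).  Boundedness of
  \<open>s\<close> gives \<open>U\<close> the velocity \<open>v\<close> at \<open>0\<close> and makes the energy along \<open>U\<close> differentiable there
  (\<open>energy_derivative\<close>).

  For the second multiplier the boundary values \<open>\<lambda>\<^sub>0\<close> are lifted: \<open>\<lambda> = l\<^sub>0 + \<mu>\<close> with a fixed
  \<open>l\<^sub>0\<close> having these boundary values and \<open>\<mu>\<close> vanishing on \<open>\<Gamma>\<^sub>1\<close>.  The form \<open>b\<^sub>2(l\<^sub>0, \<sqdot>)\<close> that is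
  moved to the right-hand side vanishes on tangent vectors, because there \<open>\<pi>\<^sub>h(n \<sqdot> m) = 0\<close>.
\<close>

section \<open>Linear forms and multipliers on function spaces\<close>

definition lin_space :: "('x \<Rightarrow> 'b::real_vector) set \<Rightarrow> bool" where
  "lin_space S \<longleftrightarrow> S \<noteq> {} \<and> (\<forall>v\<in>S. \<forall>w\<in>S. \<forall>c d. (\<lambda>x. c *\<^sub>R v x + d *\<^sub>R w x) \<in> S)"

definition lin_map ::
    "('x \<Rightarrow> 'b::real_vector) set \<Rightarrow> (('x \<Rightarrow> 'b) \<Rightarrow> 'c::real_vector) \<Rightarrow> bool" where
  "lin_map S L \<longleftrightarrow>
     (\<forall>v\<in>S. \<forall>w\<in>S. \<forall>c d. L (\<lambda>x. c *\<^sub>R v x + d *\<^sub>R w x) = c *\<^sub>R L v + d *\<^sub>R L w)"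

lemma lin_spaceD: "lin_space S \<Longrightarrow> v \<in> S \<Longrightarrow> w \<in> S \<Longrightarrow> (\<lambda>x. c *\<^sub>R v x + d *\<^sub>R w x) \<in> S"
  by (auto simp: lin_space_def)

lemma lin_mapD:
  "lin_map S L \<Longrightarrow> v \<in> S \<Longrightarrow> w \<in> S \<Longrightarrow> L (\<lambda>x. c *\<^sub>R v x + d *\<^sub>R w x) = c *\<^sub>R L v + d *\<^sub>R L w"
  by (auto simp: lin_map_def)

lemma lin_space_zero: assumes "lin_space S" shows "(\<lambda>_. 0) \<in> S"
proof -
  obtain v where "v \<in> S" using assms by (auto simp: lin_space_def)
  from lin_spaceD[OF assms this this, of 0 0] show ?thesis by simp
qed

lemma lin_map_zero: "lin_space S \<Longrightarrow> lin_map S L \<Longrightarrow> L (\<lambda>_. 0) = 0"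
  using lin_mapD[of S L "\<lambda>_. 0" "\<lambda>_. 0" 0 0] lin_space_zero by fastforce

lemma lin_space_sum:
  assumes "lin_space S" "finite I" "\<And>i. i \<in> I \<Longrightarrow> w i \<in> S"
  shows "(\<lambda>x. \<Sum>i\<in>I. c i *\<^sub>R w i x) \<in> S"
  using assms(2,3)
proof (induction I)
  case empty
  then show ?case using lin_space_zero[OF assms(1)] by simp
next
  case (insert i I)
  then show ?case using lin_spaceD[OF assms(1), of "w i" "\<lambda>x. \<Sum>i\<in>I. c i *\<^sub>R w i x" "c i" 1] by simp
qed

lemma lin_map_sum:
  assumes "lin_space S" "lin_map S L" "finite I" "\<And>i. i \<in> I \<Longrightarrow> w i \<in> S"
  shows "L (\<lambda>x. \<Sum>i\<in>I. c i *\<^sub>R w i x) = (\<Sum>i\<in>I. c i *\<^sub>R L (w i))"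
  using assms(3,4)
proof (induction I)
  case empty
  then show ?case using lin_map_zero[OF assms(1,2)] by simp
next
  case (insert i I)
  then have *: "(\<lambda>x. \<Sum>i\<in>I. c i *\<^sub>R w i x) \<in> S" using lin_space_sum[OF assms(1)] by blast
  then show ?case
    using insert lin_mapD[OF assms(2), of "w i" "\<lambda>x. \<Sum>i\<in>I. c i *\<^sub>R w i x" "c i" 1] by simp
qed

lemma lin_map_lincomb:
  fixes L M :: "('x \<Rightarrow> 'b::real_vector) \<Rightarrow> real"
  assumes "lin_map S L" "lin_map S M"
  shows "lin_map S (\<lambda>v. c * L v + d * M v)"
  using assms by (auto simp: lin_map_def algebra_simps)

text \<open>
  Induction on the number of forms.  If the new form vanished on all vectors killed by the old forms,
  it would be a combination of them.  Otherwise a vector killed by the old forms but not by the new one,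
  suitably scaled, is dual to the new form and corrects the old dual vectors.
\<close>

lemma dual_vectors:
  fixes L :: "'i \<Rightarrow> ('x \<Rightarrow> 'b::real_vector) \<Rightarrow> real"
  assumes S: "lin_space S" and "finite I" and "\<And>i. i \<in> I \<Longrightarrow> lin_map S (L i)"
    and "\<And>c. \<forall>v\<in>S. (\<Sum>i\<in>I. c i * L i v) = 0 \<Longrightarrow> \<forall>i\<in>I. c i = 0"
  shows "\<exists>e. \<forall>i\<in>I. e i \<in> S \<and> (\<forall>j\<in>I. L j (e i) = (if i = j then 1 else 0))"
  using assms(2-4)
proof (induction I)
  case (insert k I)
  have "\<exists>e. \<forall>i\<in>I. e i \<in> S \<and> (\<forall>j\<in>I. L j (e i) = (if i = j then 1 else 0))"
  proof (rule insert.IH)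
    fix c assume c: "\<forall>v\<in>S. (\<Sum>i\<in>I. c i * L i v) = 0"
    define c' where "c' i = (if i = k then 0 else c i)" for i
    have "(\<Sum>i\<in>insert k I. c' i * L i v) = (\<Sum>i\<in>I. c i * L i v)" for v
      using insert.hyps by (auto simp: c'_def intro!: sum.cong)
    then have "\<forall>i\<in>insert k I. c' i = 0" using c by (intro insert.prems(2)) auto
    then show "\<forall>i\<in>I. c i = 0" using insert.hyps by (auto simp: c'_def split: if_splits)
  qed (use insert.prems in auto)
  then obtain e where e: "\<And>i. i \<in> I \<Longrightarrow> e i \<in> S"
    "\<And>i j. i \<in> I \<Longrightarrow> j \<in> I \<Longrightarrow> L j (e i) = (if i = j then 1 else 0)" by blast
  have Lk: "lin_map S (L k)" and LI: "\<And>i. i \<in> I \<Longrightarrow> lin_map S (L i)"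
    using insert.prems by auto
  \<comment> \<open>Subtracting the interpolant in the span of the old dual vectors kills all old forms.\<close>
  define r where "r v = (\<lambda>x. 1 *\<^sub>R v x + (-1) *\<^sub>R (\<Sum>i\<in>I. L i v *\<^sub>R e i x))" for v
  have sumS: "(\<lambda>x. \<Sum>i\<in>I. c i *\<^sub>R e i x) \<in> S" for c
    by (intro lin_space_sum S insert.hyps e)
  have rS: "r v \<in> S" if "v \<in> S" for v
    unfolding r_def by (intro lin_spaceD[OF S] that sumS)
  have r0: "L j (r v) = 0" if "v \<in> S" "j \<in> I" for v j
  proof -
    have "L j (r v) = L j v - (\<Sum>i\<in>I. L i v * L j (e i))"
      unfolding r_def lin_mapD[OF LI[OF \<open>j \<in> I\<close>] \<open>v \<in> S\<close> sumS]
      by (subst lin_map_sum[OF S LI[OF that(2)] insert.hyps(1)]) (use e in auto)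
    also have "(\<Sum>i\<in>I. L i v * L j (e i)) = (\<Sum>i\<in>I. if i = j then L j v else 0)"
      using e that by (intro sum.cong) auto
    also have "\<dots> = L j v" using that insert.hyps by (simp add: sum.delta)
    finally show ?thesis by simp
  qed
  have "\<exists>v\<in>S. L k (r v) \<noteq> 0"
  proof (rule ccontr)
    assume "\<not> ?thesis"
    then have z: "L k (r v) = 0" if "v \<in> S" for v using that by blast
    define c where "c i = (if i = k then 1 else - L k (e i))" for i
    have "(\<Sum>i\<in>insert k I. c i * L i v) = 0" if "v \<in> S" for v
    proof -
      have "L k (r v) = L k v - (\<Sum>i\<in>I. L i v * L k (e i))"
        unfolding r_def lin_mapD[OF Lk \<open>v \<in> S\<close> sumS]
        by (subst lin_map_sum[OF S Lk insert.hyps(1)]) (use e in auto)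
      moreover have "(\<Sum>i\<in>I. c i * L i v) = - (\<Sum>i\<in>I. L i v * L k (e i))"
        unfolding sum_negf[symmetric] using insert.hyps by (intro sum.cong) (auto simp: c_def)
      ultimately show ?thesis using z[OF that] insert.hyps by (simp add: c_def)
    qed
    then have "\<forall>i\<in>insert k I. c i = 0" by (intro insert.prems(2)) auto
    then show False by (simp add: c_def)
  qed
  then obtain v where v: "v \<in> S" "L k (r v) \<noteq> 0" by blast
  define w where "w = (\<lambda>x. (1 / L k (r v)) *\<^sub>R r v x + 0 *\<^sub>R r v x)"
  have w: "w \<in> S" "L k w = 1" "\<And>j. j \<in> I \<Longrightarrow> L j w = 0"
    unfolding w_def
    by (simp_all only: lin_spaceD[OF S rS[OF v(1)] rS[OF v(1)]] lin_mapD[OF Lk rS[OF v(1)] rS[OF v(1)]]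
        lin_mapD[OF LI rS[OF v(1)] rS[OF v(1)]] r0[OF v(1)]) (use v(2) in simp_all)
  define e' where "e' i = (if i = k then w else (\<lambda>x. 1 *\<^sub>R e i x + (- L k (e i)) *\<^sub>R w x))" for i
  show ?case
  proof (intro exI[of _ e'] ballI conjI)
    fix i j assume ij: "i \<in> insert k I" "j \<in> insert k I"
    show "e' i \<in> S" 
      using ij lin_spaceD[OF S e(1)[of i] w(1), of 1 "- L k (e i)"] w(1)
      by (cases "i = k") (simp_all add: e'_def)
    show "L j (e' i) = (if i = j then 1 else 0)"
    proof (cases "i = k")
      case True
      then show ?thesis using ij w by (auto simp: e'_def)
    next
      case False
      then have i: "i \<in> I" using ij by simp
      have Lj: "lin_map S (L j)" using ij insert.prems by auto
      show ?thesis
        using False i ij w e insert.hyps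
        by (auto simp: e'_def lin_mapD[OF Lj e(1)[OF i] w(1), of 1 "- L k (e i)", simplified])
    qed
  qed
qed simp

text \<open>
  Subtracting from \<open>v\<close> its expansion in the dual vectors lands in the common kernel of the forms,
  where \<open>M\<close> vanishes.
\<close>

lemma multiplier_of_dual_vectors:
  fixes L :: "'i \<Rightarrow> ('x \<Rightarrow> 'b::real_vector) \<Rightarrow> real" and M :: "('x \<Rightarrow> 'b) \<Rightarrow> real"
  assumes S: "lin_space S" and I: "finite I" and L: "\<And>i. i \<in> I \<Longrightarrow> lin_map S (L i)"
    and e: "\<And>i. i \<in> I \<Longrightarrow> e i \<in> S"
    and d: "\<And>i j. i \<in> I \<Longrightarrow> j \<in> I \<Longrightarrow> L j (e i) = (if i = j then 1 else 0)"
    and M: "lin_map S M" and ker: "\<And>v. v \<in> S \<Longrightarrow> (\<And>i. i \<in> I \<Longrightarrow> L i v = 0) \<Longrightarrow> M v = 0"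
    and v: "v \<in> S"
  shows "M v = (\<Sum>i\<in>I. M (e i) * L i v)"
proof -
  define r where "r = (\<lambda>x. 1 *\<^sub>R v x + (-1) *\<^sub>R (\<Sum>i\<in>I. L i v *\<^sub>R e i x))"
  have sumS: "(\<lambda>x. \<Sum>i\<in>I. L i v *\<^sub>R e i x) \<in> S" by (intro lin_space_sum S I e)
  have *: "K r = K v - (\<Sum>i\<in>I. L i v * K (e i))" if K: "lin_map S K" for K :: "('x \<Rightarrow> 'b) \<Rightarrow> real"
    unfolding r_def lin_mapD[OF K v sumS] by (subst lin_map_sum[OF S K I]) (use e in auto)
  have "M r = 0"
  proof (rule ker)
    show "r \<in> S" unfolding r_def by (intro lin_spaceD[OF S] v sumS)
    fix j assume j: "j \<in> I"
    have "(\<Sum>i\<in>I. L i v * L j (e i)) = (\<Sum>i\<in>I. if i = j then L j v else 0)"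
      using d j by (intro sum.cong) auto
    also have "\<dots> = L j v" using j I by (simp add: sum.delta)
    finally show "L j r = 0" using *[OF L[OF j]] by simp
  qed
  then show ?thesis using *[OF M] by (simp add: mult.commute)
qed

text \<open>
  Banach's fixed point theorem on the unit box around \<open>A\<close> in the maximum norm, for vectors indexed by
  an arbitrary finite set.  Such vectors are functions that are compared on the index set alone, so
  the Picard iteration is carried out coordinatewise.
\<close>

lemma finite_contraction_fixpoint:
  fixes A :: "'i \<Rightarrow> real" and \<Phi> :: "('i \<Rightarrow> real) \<Rightarrow> 'i \<Rightarrow> real"
  assumes start: "\<And>i. i \<in> I \<Longrightarrow> \<bar>\<Phi> A i - A i\<bar> \<le> 1/2"
    and contr: "\<And>y y' \<delta> i. i \<in> I \<Longrightarrow> \<forall>j\<in>I. \<bar>y j - A j\<bar> \<le> 1 \<Longrightarrow> \<forall>j\<in>I. \<bar>y' j - A j\<bar> \<le> 1 \<Longrightarrow>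
      0 \<le> \<delta> \<Longrightarrow> \<forall>j\<in>I. \<bar>y j - y' j\<bar> \<le> \<delta> \<Longrightarrow> \<bar>\<Phi> y i - \<Phi> y' i\<bar> \<le> \<delta> / 2"
    and I: "finite I"
  shows "\<exists>s. \<forall>i\<in>I. \<bar>s i - A i\<bar> \<le> 1 \<and> s i = \<Phi> s i"
proof -
  define Y where "Y k = (\<Phi> ^^ k) A" for k
  have Y0: "Y 0 = A" and YS: "Y (Suc k) = \<Phi> (Y k)" for k by (auto simp: Y_def)
  have small: "x \<le> 1 - (1/2)^k \<Longrightarrow> x \<le> 1" for x :: real and k :: nat
    by (smt (verit) zero_le_power divide_nonneg_nonneg)
  have step: "(\<forall>j\<in>I. \<bar>Y k j - A j\<bar> \<le> 1 - (1/2)^k) \<and> (\<forall>j\<in>I. \<bar>Y (Suc k) j - Y k j\<bar> \<le> (1/2)^(Suc k))" for k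
  proof (induction k)
    case 0
    then show ?case using start by (simp add: Y0 YS)
  next
    case (Suc k)
    have 1: "\<bar>Y (Suc k) j - A j\<bar> \<le> 1 - (1/2)^(Suc k)" if "j \<in> I" for j
    proof -
      have "\<bar>Y (Suc k) j - A j\<bar> \<le> \<bar>Y (Suc k) j - Y k j\<bar> + \<bar>Y k j - A j\<bar>" by simp
      also have "\<dots> \<le> (1/2)^(Suc k) + (1 - (1/2)^k)" using Suc that by (intro add_mono) auto
      finally show ?thesis by simp
    qed
    have "\<bar>Y (Suc (Suc k)) j - Y (Suc k) j\<bar> \<le> (1/2)^(Suc k) / 2" if "j \<in> I" for j
    proof -
      have "\<bar>\<Phi> (Y (Suc k)) j - \<Phi> (Y k) j\<bar> \<le> (1/2)^(Suc k) / 2"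
        by (intro contr; use Suc 1 small that in \<open>(simp; fail) | blast\<close>)
      then show ?thesis by (simp add: YS)
    qed
    then show ?case using 1 by simp
  qed
  define s where "s i = lim (\<lambda>k. Y k i)" for i
  have conv: "(\<lambda>k. Y k i) \<longlonglongrightarrow> s i" if "i \<in> I" for i
  proof -
    have "summable (\<lambda>k. Y (Suc k) i - Y k i)"
    proof (rule summable_comparison_test')
      show "summable (\<lambda>k. (1/2::real)^(Suc k))" by (simp add: summable_mult)
      show "norm (Y (Suc k) i - Y k i) \<le> (1/2)^(Suc k)" if "k \<ge> 0" for k
        using step[of k] \<open>i \<in> I\<close> by simp
    qed
    then have "convergent (\<lambda>k. \<Sum>j<k. (Y (Suc j) i - Y j i))" by (simp add: summable_iff_convergent)
    then have "convergent (\<lambda>k. Y k i - Y 0 i)"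
      by (simp only: sum_lessThan_telescope[of "\<lambda>k. Y k i"])
    then have "convergent (\<lambda>k. (Y k i - Y 0 i) + Y 0 i)"
      by (intro convergent_add convergent_const)
    then show ?thesis by (simp add: s_def convergent_LIMSEQ_iff)
  qed
  have sbd: "\<bar>s i - A i\<bar> \<le> 1" if "i \<in> I" for i
  proof (rule Lim_bounded[of "\<lambda>k. \<bar>Y k i - A i\<bar>"])
    show "(\<lambda>k. \<bar>Y k i - A i\<bar>) \<longlonglongrightarrow> \<bar>s i - A i\<bar>" using conv[OF that] by (intro tendsto_intros)
    show "\<forall>k\<ge>0. \<bar>Y k i - A i\<bar> \<le> 1"
      using step small that by blast
  qed
  have "s i = \<Phi> s i" if i: "i \<in> I" for i
  proof (rule LIMSEQ_unique)
    show "(\<lambda>k. Y (Suc k) i) \<longlonglongrightarrow> s i" using conv[OF i] by (rule LIMSEQ_Suc)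
    have "(\<lambda>k. (\<Sum>j\<in>I. \<bar>Y k j - s j\<bar>) / 2) \<longlonglongrightarrow> (\<Sum>j\<in>I. \<bar>s j - s j\<bar>) / 2"
      using conv by (intro tendsto_intros) auto
    then have lim0: "(\<lambda>k. (\<Sum>j\<in>I. \<bar>Y k j - s j\<bar>) / 2) \<longlonglongrightarrow> 0" by simp
    have "\<bar>Y (Suc k) i - \<Phi> s i\<bar> \<le> (\<Sum>j\<in>I. \<bar>Y k j - s j\<bar>) / 2" for k
      unfolding YS
    proof (rule contr[OF i])
      show "\<forall>j\<in>I. \<bar>Y k j - A j\<bar> \<le> 1"
        using step small by blast
      show "\<forall>j\<in>I. \<bar>Y k j - s j\<bar> \<le> (\<Sum>j\<in>I. \<bar>Y k j - s j\<bar>)"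
        using I by (auto intro: member_le_sum[of _ _ "\<lambda>j. \<bar>Y k j - s j\<bar>"])
    qed (use sbd in \<open>auto intro: sum_nonneg\<close>)
    then have "(\<lambda>k. Y (Suc k) i - \<Phi> s i) \<longlonglongrightarrow> 0"
      by (intro Lim_null_comparison[OF _ lim0]) auto
    then show "(\<lambda>k. Y (Suc k) i) \<longlonglongrightarrow> \<Phi> s i" by (simp add: LIM_zero_iff)
  qed
  then show ?thesis using sbd by blast
qed

text \<open>
  For small \<open>t\<close> the right-hand side is a contraction near \<open>A\<close>.  The bound \<open>M\<close> on the solutions is
  the same for all \<open>t\<close>; this uniformity is what makes the resulting curves differentiable at \<open>0\<close>.
\<close>

lemma quadratic_system_solvable:
  fixes A :: "'i \<Rightarrow> real" and B :: "'i \<Rightarrow> 'i \<Rightarrow> real" and C :: "'i \<Rightarrow> 'i \<Rightarrow> 'i \<Rightarrow> real"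
  assumes I: "finite I"
  shows "\<exists>\<epsilon>>0. \<exists>M. \<forall>t. \<bar>t\<bar> < \<epsilon> \<longrightarrow> (\<exists>s. \<forall>i\<in>I. \<bar>s i\<bar> \<le> M \<and>
           s i = A i + t * (\<Sum>j\<in>I. B i j * s j) + t\<^sup>2 * (\<Sum>j\<in>I. \<Sum>k\<in>I. C i j k * (s j * s k)))"
proof -
  define M where "M = (\<Sum>i\<in>I. \<bar>A i\<bar>) + 1"
  have M: "\<bar>A i\<bar> + 1 \<le> M" if "i \<in> I" for i
    unfolding M_def using I that by (auto intro: member_le_sum[of _ _ "\<lambda>j. \<bar>A j\<bar>"])
  have M0: "M \<ge> 1" unfolding M_def by (simp add: sum_nonneg)
  \<comment> \<open>On the box of radius \<open>M\<close> the right-hand side has Lipschitz constant at most \<open>\<bar>t\<bar> * N\<close>.\<close>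
  define N where "N = (\<Sum>i\<in>I. \<Sum>j\<in>I. \<bar>B i j\<bar>) + 2 * M * (\<Sum>i\<in>I. \<Sum>j\<in>I. \<Sum>k\<in>I. \<bar>C i j k\<bar>)"
  have N0: "N \<ge> 0" unfolding N_def using M0 by (intro add_nonneg_nonneg mult_nonneg_nonneg sum_nonneg) auto
  define K where "K = N * M + N + 1"
  have K: "K \<ge> 1" "N * M \<le> K" "N \<le> K" unfolding K_def using N0 M0 by (auto intro: mult_nonneg_nonneg)
  \<comment> \<open>\<open>K\<close> bounds both the Lipschitz factor \<open>N\<close> and the first Picard step \<open>N * M\<close>, so \<open>\<bar>t\<bar> * K \<le> 1/2\<close> suffices.\<close>
  define \<epsilon> where "\<epsilon> = 1 / (2 * K)"
  have \<epsilon>: "\<epsilon> > 0" "\<epsilon> \<le> 1" unfolding \<epsilon>_def using K by (auto simp: field_simps)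
  have main: "\<exists>s. \<forall>i\<in>I. \<bar>s i\<bar> \<le> M \<and>
           s i = A i + t * (\<Sum>j\<in>I. B i j * s j) + t\<^sup>2 * (\<Sum>j\<in>I. \<Sum>k\<in>I. C i j k * (s j * s k))"
    if t: "\<bar>t\<bar> < \<epsilon>" for t
  proof -
    define F where "F y i = t * (\<Sum>j\<in>I. B i j * y j) + t\<^sup>2 * (\<Sum>j\<in>I. \<Sum>k\<in>I. C i j k * (y j * y k))" for y i
    have t1: "\<bar>t\<bar> \<le> 1" using t \<epsilon> by simp
    have t2: "t\<^sup>2 \<le> \<bar>t\<bar>" using t1 by (metis abs_ge_zero mult_left_le power2_abs power2_eq_square)
    have lip: "\<bar>F y i - F y' i\<bar> \<le> \<bar>t\<bar> * (N * \<delta>)"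
      if i: "i \<in> I" and y: "\<forall>j\<in>I. \<bar>y j\<bar> \<le> M" "\<forall>j\<in>I. \<bar>y' j\<bar> \<le> M" and \<delta>: "0 \<le> \<delta>" "\<forall>j\<in>I. \<bar>y j - y' j\<bar> \<le> \<delta>"
      for y y' \<delta> i
    proof -
      have "\<bar>(\<Sum>j\<in>I. B i j * y j) - (\<Sum>j\<in>I. B i j * y' j)\<bar> \<le> (\<Sum>j\<in>I. \<bar>B i j\<bar>) * \<delta>"
        unfolding sum_subtractf[symmetric] sum_distrib_right
        using \<delta> by (intro order_trans[OF sum_abs] sum_mono)
          (auto simp: right_diff_distrib[symmetric] abs_mult intro!: mult_left_mono)
      also have "\<dots> \<le> (\<Sum>i\<in>I. \<Sum>j\<in>I. \<bar>B i j\<bar>) * \<delta>"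
        using I i \<delta> by (intro mult_right_mono member_le_sum[of i I "\<lambda>i. \<Sum>j\<in>I. \<bar>B i j\<bar>"]) (auto intro: sum_nonneg)
      finally have b: "\<bar>(\<Sum>j\<in>I. B i j * y j) - (\<Sum>j\<in>I. B i j * y' j)\<bar> \<le> (\<Sum>i\<in>I. \<Sum>j\<in>I. \<bar>B i j\<bar>) * \<delta>" .
      have q: "\<bar>y j * y k - y' j * y' k\<bar> \<le> 2 * M * \<delta>" if "j \<in> I" "k \<in> I" for j k
      proof -
        have "y j * y k - y' j * y' k = y j * (y k - y' k) + (y j - y' j) * y' k" by (simp add: algebra_simps)
        then have "\<bar>y j * y k - y' j * y' k\<bar> \<le> \<bar>y j\<bar> * \<bar>y k - y' k\<bar> + \<bar>y j - y' j\<bar> * \<bar>y' k\<bar>"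
          by (simp only: abs_mult[symmetric] abs_triangle_ineq)
        also have "\<dots> \<le> M * \<delta> + \<delta> * M"
          using y \<delta> that M0 by (intro add_mono mult_mono) auto
        finally show ?thesis by simp
      qed
      have "\<bar>(\<Sum>j\<in>I. \<Sum>k\<in>I. C i j k * (y j * y k)) - (\<Sum>j\<in>I. \<Sum>k\<in>I. C i j k * (y' j * y' k))\<bar>
          \<le> (\<Sum>j\<in>I. \<Sum>k\<in>I. \<bar>C i j k\<bar> * (2 * M * \<delta>))"
        unfolding sum_subtractf[symmetric]
        using q by (intro order_trans[OF sum_abs] sum_mono)
          (auto simp: right_diff_distrib[symmetric] abs_mult intro!: mult_left_mono)
      also have "\<dots> = 2 * M * (\<Sum>j\<in>I. \<Sum>k\<in>I. \<bar>C i j k\<bar>) * \<delta>"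
        by (simp add: sum_distrib_left sum_distrib_right mult_ac)
      also have "\<dots> \<le> 2 * M * (\<Sum>i\<in>I. \<Sum>j\<in>I. \<Sum>k\<in>I. \<bar>C i j k\<bar>) * \<delta>"
        using I i \<delta> M0
        by (intro mult_right_mono mult_left_mono member_le_sum[of i I "\<lambda>i. \<Sum>j\<in>I. \<Sum>k\<in>I. \<bar>C i j k\<bar>"])
          (auto intro!: sum_nonneg)
      finally have c: "\<bar>(\<Sum>j\<in>I. \<Sum>k\<in>I. C i j k * (y j * y k)) - (\<Sum>j\<in>I. \<Sum>k\<in>I. C i j k * (y' j * y' k))\<bar>
          \<le> 2 * M * (\<Sum>i\<in>I. \<Sum>j\<in>I. \<Sum>k\<in>I. \<bar>C i j k\<bar>) * \<delta>" .
      have eq: "F y i - F y' i = t * ((\<Sum>j\<in>I. B i j * y j) - (\<Sum>j\<in>I. B i j * y' j))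
         + t\<^sup>2 * ((\<Sum>j\<in>I. \<Sum>k\<in>I. C i j k * (y j * y k)) - (\<Sum>j\<in>I. \<Sum>k\<in>I. C i j k * (y' j * y' k)))"
        unfolding F_def by (simp add: algebra_simps)
      have "\<bar>F y i - F y' i\<bar> \<le> \<bar>t\<bar> * \<bar>(\<Sum>j\<in>I. B i j * y j) - (\<Sum>j\<in>I. B i j * y' j)\<bar>
         + t\<^sup>2 * \<bar>(\<Sum>j\<in>I. \<Sum>k\<in>I. C i j k * (y j * y k)) - (\<Sum>j\<in>I. \<Sum>k\<in>I. C i j k * (y' j * y' k))\<bar>"
        unfolding eq by (rule order_trans[OF abs_triangle_ineq]) (simp add: abs_mult)
      also have "\<dots> \<le> \<bar>t\<bar> * ((\<Sum>i\<in>I. \<Sum>j\<in>I. \<bar>B i j\<bar>) * \<delta>)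
         + \<bar>t\<bar> * (2 * M * (\<Sum>i\<in>I. \<Sum>j\<in>I. \<Sum>k\<in>I. \<bar>C i j k\<bar>) * \<delta>)"
        by (rule add_mono[OF mult_left_mono[OF b] mult_mono[OF t2 c]]) (rule abs_ge_zero)+
      also have "\<dots> = \<bar>t\<bar> * (N * \<delta>)" by (simp only: N_def distrib_left distrib_right)
      finally show ?thesis .
    qed
    have bdM: "\<bar>z\<bar> \<le> M" if "\<bar>z - A i\<bar> \<le> 1" "i \<in> I" for z i
      using M[OF that(2)] that(1) by linarith
    have tK: "\<bar>t\<bar> * K \<le> 1/2" using t K by (simp add: \<epsilon>_def field_simps)
    have "\<exists>s. \<forall>i\<in>I. \<bar>s i - A i\<bar> \<le> 1 \<and> s i = A i + F s i"
    proof (rule finite_contraction_fixpoint[OF _ _ I])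
      fix i assume i: "i \<in> I"
      have A: "\<forall>j\<in>I. \<bar>A j\<bar> \<le> M" using bdM[of "A j" j for j] by simp
      have "\<bar>F A i - F (\<lambda>_. 0) i\<bar> \<le> \<bar>t\<bar> * (N * M)"
        by (rule lip[OF i A]) (use A M0 in simp_all)
      also have "\<dots> \<le> \<bar>t\<bar> * K" using K by (intro mult_left_mono) auto
      finally show "\<bar>A i + F A i - A i\<bar> \<le> 1/2" using tK by (simp add: F_def)
    next
      fix y y' \<delta> i
      assume h: "i \<in> I" "\<forall>j\<in>I. \<bar>y j - A j\<bar> \<le> 1" "\<forall>j\<in>I. \<bar>y' j - A j\<bar> \<le> 1" "0 \<le> \<delta>" "\<forall>j\<in>I. \<bar>y j - y' j\<bar> \<le> \<delta>"
      have "\<forall>j\<in>I. \<bar>y j\<bar> \<le> M" "\<forall>j\<in>I. \<bar>y' j\<bar> \<le> M" 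
        using h(2,3) M bdM by blast+
      then have "\<bar>F y i - F y' i\<bar> \<le> \<bar>t\<bar> * (N * \<delta>)" by (intro lip h)
      also have "\<dots> \<le> \<bar>t\<bar> * (K * \<delta>)" using K h by (intro mult_left_mono mult_right_mono) auto
      also have "\<dots> = (\<bar>t\<bar> * K) * \<delta>" by simp
      also have "\<dots> \<le> 1/2 * \<delta>" using tK h by (intro mult_right_mono) auto
      finally show "\<bar>A i + F y i - (A i + F y' i)\<bar> \<le> \<delta> / 2" by simp
    qed
    then obtain s where s: "\<forall>i\<in>I. \<bar>s i - A i\<bar> \<le> 1 \<and> s i = A i + F s i" by blast
    show ?thesis
    proof (intro exI[of _ s] ballI conjI)
      fix i assume i: "i \<in> I"
      show "\<bar>s i\<bar> \<le> M" using s i bdM by blast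
      show "s i = A i + t * (\<Sum>j\<in>I. B i j * s j) + t\<^sup>2 * (\<Sum>j\<in>I. \<Sum>k\<in>I. C i j k * (s j * s k))"
        by (rule trans[OF conjunct2[OF bspec[OF s i]]]) (simp only: F_def add.assoc)
    qed
  qed
  show ?thesis using main \<epsilon> by blast
qed

section \<open>Nodal interpolation on the mesh\<close>

lemma affine_fun_eq_on_convex_hull:
  fixes d d' :: "'a::euclidean_space" and c c' :: real
  assumes "\<And>x. x \<in> S \<Longrightarrow> c + d \<bullet> x = c' + d' \<bullet> x" and "x \<in> convex hull S"
  shows "c + d \<bullet> x = c' + d' \<bullet> x"
proof -
  have "convex {x. (d - d') \<bullet> x = c' - c}" by (rule convex_hyperplane)
  moreover have "S \<subseteq> {x. (d - d') \<bullet> x = c' - c}" using assms(1) by (auto simp: inner_diff_left algebra_simps)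
  ultimately have "convex hull S \<subseteq> {x. (d - d') \<bullet> x = c' - c}" by (rule hull_minimal[rotated])
  with assms(2) show ?thesis by (auto simp: inner_diff_left algebra_simps)
qed

text \<open>
  After a translation moving one point to the origin, affine independence becomes linear independence
  and the interpolant is the extension of a linear form, represented by an inner product.
\<close>

lemma affine_interpolation_affine_independent:
  fixes C :: "'a::euclidean_space set" and \<phi> :: "'a \<Rightarrow> real"
  assumes "\<not> affine_dependent C"
  shows "\<exists>c d. \<forall>x\<in>C. c + d \<bullet> x = \<phi> x"
proof (cases "C = {}")
  case False
  then obtain a where a: "a \<in> C" by blast
  have ind: "independent ((\<lambda>x. - a + x) ` (C - {a}))"
    using assms affine_dependent_iff_dependent2[OF a] by blast
  obtain g :: "'a \<Rightarrow> real" where g: "linear g"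
    "\<forall>y\<in>(\<lambda>x. - a + x) ` (C - {a}). g y = \<phi> (a + y) - \<phi> a"
    using linear_independent_extend[OF ind, of "\<lambda>y. \<phi> (a + y) - \<phi> a"] by blast
  define d where "d = adjoint g 1"
  have d: "d \<bullet> y = g y" for y
    using adjoint_works[OF g(1), of y 1] by (simp add: d_def inner_commute)
  have "(\<phi> a - d \<bullet> a) + d \<bullet> x = \<phi> x" if "x \<in> C" for x
  proof (cases "x = a")
    case False
    then have "g (- a + x) = \<phi> (a + (- a + x)) - \<phi> a" using g(2) that by blast
    then show ?thesis using d[of "- a + x"] by (simp add: inner_diff_right)
  qed simp
  then show ?thesis by blast
qed simp

locale fe_mesh =
  fixes \<Omega> :: "(real^2) set" and \<T> :: "(real^2) set set"
  assumes mesh: "triangular_mesh \<Omega> \<T>"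
begin

definition cells :: "(real^2) set" where "cells = (\<Union>T\<in>\<T>. interior T)"

lemma finite_mesh: "finite \<T>" and two_simplex: "T \<in> \<T> \<Longrightarrow> 2 simplex T"
  and faces: "T \<in> \<T> \<Longrightarrow> T' \<in> \<T> \<Longrightarrow> T \<inter> T' face_of T" and \<Omega>_eq: "\<Omega> = interior (\<Union>\<T>)"
  using mesh by (auto simp: triangular_mesh_def triangulation_def)

lemma compact_cell: "T \<in> \<T> \<Longrightarrow> compact T" and convex_cell: "T \<in> \<T> \<Longrightarrow> convex T"
  using two_simplex compact_simplex convex_simplex by blast+

lemma cell_simplex:
  assumes "T \<in> \<T>"
  obtains C where "finite C" "\<not> affine_dependent C" "T = convex hull C" "{x. x extreme_point_of T} = C"
proof -
  from two_simplex[OF assms] obtain C where C: "finite C" "\<not> affine_dependent C" "T = convex hull C"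
    by (auto simp: simplex)
  with extreme_point_of_convex_hull_affine_independent[OF C(2)] show ?thesis by (intro that[of C]) auto
qed

lemma cell_hull_extreme: "T \<in> \<T> \<Longrightarrow> T = convex hull {x. x extreme_point_of T}"
  by (metis Krein_Milman_Minkowski compact_cell convex_cell)

lemma finite_nodes: "finite (nodes \<T>)"
  unfolding nodes_def using finite_mesh by (auto elim: cell_simplex)

lemma interior_cell_nonempty:
  assumes "T \<in> \<T>" shows "interior T \<noteq> {}"
proof -
  have "aff_dim T = 2" using aff_dim_simplex two_simplex assms by blast
  then have "interior T = rel_interior T" "T \<noteq> {}" by (auto simp: interior_rel_interior_gen)
  then show ?thesis using rel_interior_eq_empty[OF convex_cell[OF assms]] by simp
qed

lemma cell_closure_interior: "T \<in> \<T> \<Longrightarrow> closure (interior T) = T"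
  using convex_closure_interior[OF convex_cell interior_cell_nonempty] compact_cell
  by (simp add: compact_imp_closed)

text \<open>
  On a cell a function of \<open>V\<^sub>h\<close> is affine, and the cell is the convex hull of its vertices.
\<close>

lemma Vh_eqI:
  assumes v: "v \<in> Vh \<T>" "w \<in> Vh \<T>" and eq: "\<And>z. z \<in> nodes \<T> \<Longrightarrow> v z = w z"
  shows "v = w"
proof
  fix x
  show "v x = w x"
  proof (cases "x \<in> \<Union>\<T>")
    case True
    then obtain T where T: "T \<in> \<T>" "x \<in> T" by blast
    obtain c d where cd: "\<forall>x\<in>T. v x = c + d \<bullet> x" using v T unfolding Vh_def by blast
    obtain c' d' where cd': "\<forall>x\<in>T. w x = c' + d' \<bullet> x" using v T unfolding Vh_def by blast
    have "c + d \<bullet> x = c' + d' \<bullet> x"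
    proof (rule affine_fun_eq_on_convex_hull)
      show "x \<in> convex hull {x. x extreme_point_of T}" using cell_hull_extreme T by blast
      fix y assume "y \<in> {x. x extreme_point_of T}"
      then have "y \<in> T" "y \<in> nodes \<T>" using T by (auto simp: nodes_def extreme_point_of_def)
      then show "c + d \<bullet> y = c' + d' \<bullet> y" using eq cd cd' by metis
    qed
    then show ?thesis using cd cd' T by simp
  next
    case False
    then show ?thesis using v by (auto simp: Vh_def)
  qed
qed

text \<open>
  Interpolate affinely on each cell.  Two cells meet in a common face, whose vertices are vertices of
  both cells, and the face is the convex hull of its vertices; hence the local interpolants agree there
  and glue to a continuous function.
\<close>

lemma Vh_interpolant: "\<exists>v\<in>Vh \<T>. \<forall>z\<in>nodes \<T>. v z = \<phi> z"
proof -
  have "\<forall>T\<in>\<T>. \<exists>c d. \<forall>x. x extreme_point_of T \<longrightarrow> c + d \<bullet> x = \<phi> x"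
  proof
    fix T assume "T \<in> \<T>"
    then obtain C where "\<not> affine_dependent C" "{x. x extreme_point_of T} = C" by (elim cell_simplex)
    then show "\<exists>c d. \<forall>x. x extreme_point_of T \<longrightarrow> c + d \<bullet> x = \<phi> x"
      using affine_interpolation_affine_independent[of C \<phi>] by auto
  qed
  then obtain c d where cd: "\<And>T x. T \<in> \<T> \<Longrightarrow> x extreme_point_of T \<Longrightarrow> c T + d T \<bullet> x = \<phi> x" by metis
  have agree: "c T + d T \<bullet> x = c T' + d T' \<bullet> x" if T: "T \<in> \<T>" "T' \<in> \<T>" and x: "x \<in> T \<inter> T'" for T T' x
  proof (rule affine_fun_eq_on_convex_hull)
    have "compact (T \<inter> T')" "convex (T \<inter> T')"
      using T compact_cell convex_cell by (auto intro: compact_Int convex_Int)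
    then show "x \<in> convex hull {x. x extreme_point_of (T \<inter> T')}"
      using Krein_Milman_Minkowski x by blast
    fix y assume "y \<in> {x. x extreme_point_of (T \<inter> T')}"
    then have "y extreme_point_of T" "y extreme_point_of T'"
      using extreme_point_of_face faces T by (metis mem_Collect_eq inf_commute)+
    then show "c T + d T \<bullet> y = c T' + d T' \<bullet> y" using cd T by simp
  qed
  define cell where "cell x = (SOME T. T \<in> \<T> \<and> x \<in> T)" for x
  have cell: "cell x \<in> \<T> \<and> x \<in> cell x" if "x \<in> \<Union>\<T>" for x
    unfolding cell_def by (rule someI_ex) (use that in blast)
  define v where "v x = (if x \<in> \<Union>\<T> then c (cell x) + d (cell x) \<bullet> x else 0)" for x
  have v: "v x = c T + d T \<bullet> x" if "T \<in> \<T>" "x \<in> T" for T x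
  proof -
    have "x \<in> \<Union>\<T>" using that by blast
    then show ?thesis using agree[of "cell x" T x] cell[of x] that unfolding v_def by simp
  qed
  have "continuous_on (\<Union>\<T>) v"
  proof (rule continuous_on_closed_Union[of \<T> "\<lambda>T. T", unfolded image_ident])
    show "finite \<T>" by (rule finite_mesh)
    show "closed T" if "T \<in> \<T>" for T using that compact_cell compact_imp_closed by blast
    show "continuous_on T v" if "T \<in> \<T>" for T
      by (rule continuous_on_eq[of T "\<lambda>x. c T + d T \<bullet> x"]) (use v that in \<open>auto intro!: continuous_intros\<close>)
  qed
  moreover have "v x = 0" if "x \<notin> \<Union>\<T>" for x using that by (auto simp: v_def)
  ultimately have "v \<in> Vh \<T>" using v unfolding Vh_def by blast
  moreover have "v z = \<phi> z" if "z \<in> nodes \<T>" for z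
    using that v cd unfolding nodes_def by (auto simp: extreme_point_of_def)
  ultimately show ?thesis by blast
qed

lemma interp_Vh: "interp \<T> \<phi> \<in> Vh \<T>" and interp_node: "z \<in> nodes \<T> \<Longrightarrow> interp \<T> \<phi> z = \<phi> z"
proof -
  obtain v where v: "v \<in> Vh \<T>" "\<forall>z\<in>nodes \<T>. v z = \<phi> z" using Vh_interpolant by blast
  have "interp \<T> \<phi> = v"
    unfolding interp_def by (rule the_equality) (use v Vh_eqI in auto)
  with v show "interp \<T> \<phi> \<in> Vh \<T>" "z \<in> nodes \<T> \<Longrightarrow> interp \<T> \<phi> z = \<phi> z" by auto
qed

lemma interp_eqI: "v \<in> Vh \<T> \<Longrightarrow> (\<And>z. z \<in> nodes \<T> \<Longrightarrow> \<phi> z = v z) \<Longrightarrow> interp \<T> \<phi> = v"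
  by (rule Vh_eqI) (auto simp: interp_Vh interp_node)

lemma lin_space_Vh: "lin_space (Vh \<T>)"
  unfolding lin_space_def
proof (intro conjI ballI allI)
  show "Vh \<T> \<noteq> {}" using interp_Vh by blast
  fix v w and c d :: real assume vw: "v \<in> Vh \<T>" "w \<in> Vh \<T>"
  show "(\<lambda>x. c *\<^sub>R v x + d *\<^sub>R w x) \<in> Vh \<T>"
    unfolding Vh_def
  proof (intro CollectI conjI ballI)
    show "continuous_on (\<Union>\<T>) (\<lambda>x. c *\<^sub>R v x + d *\<^sub>R w x)" 
      using vw by (auto simp: Vh_def intro!: continuous_intros)
    show "\<forall>x. x \<notin> \<Union>\<T> \<longrightarrow> c *\<^sub>R v x + d *\<^sub>R w x = 0" using vw by (auto simp: Vh_def)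
    fix T assume T: "T \<in> \<T>"
    obtain a b where 1: "\<forall>x\<in>T. v x = a + b \<bullet> x" using vw T unfolding Vh_def by blast
    obtain a' b' where 2: "\<forall>x\<in>T. w x = a' + b' \<bullet> x" using vw T unfolding Vh_def by blast
    have "\<forall>x\<in>T. c *\<^sub>R v x + d *\<^sub>R w x = (c * a + d * a') + (c *\<^sub>R b + d *\<^sub>R b') \<bullet> x"
      using 1 2 by (auto simp: inner_add_left algebra_simps)
    then show "\<exists>e f. \<forall>x\<in>T. c *\<^sub>R v x + d *\<^sub>R w x = e + f \<bullet> x" by blast
  qed
qed

lemma Vh_subset_Wh: "Vh \<T> \<subseteq> Wh \<T>"
proof
  fix v assume v: "v \<in> Vh \<T>"
  have "\<exists>c d (A::real^2^2). \<forall>x\<in>T. v x = c + d \<bullet> x + x \<bullet> (A *v x)" if T: "T \<in> \<T>" for T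
  proof -
    obtain a b where "\<forall>x\<in>T. v x = a + b \<bullet> x" using v T unfolding Vh_def by blast
    then have "\<forall>x\<in>T. v x = a + b \<bullet> x + x \<bullet> ((0::real^2^2) *v x)" by simp
    then show ?thesis by blast
  qed
  then show "v \<in> Wh \<T>" using v unfolding Vh_def Wh_def by simp
qed

lemma lin_space_Wh: "lin_space (Wh \<T>)"
  unfolding lin_space_def
proof (intro conjI ballI allI)
  show "Wh \<T> \<noteq> {}" using interp_Vh Vh_subset_Wh by blast
  fix v w and c d :: real assume vw: "v \<in> Wh \<T>" "w \<in> Wh \<T>"
  show "(\<lambda>x. c *\<^sub>R v x + d *\<^sub>R w x) \<in> Wh \<T>"
    unfolding Wh_def
  proof (intro CollectI conjI ballI)
    show "continuous_on (\<Union>\<T>) (\<lambda>x. c *\<^sub>R v x + d *\<^sub>R w x)" 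
      using vw by (auto simp: Wh_def intro!: continuous_intros)
    show "\<forall>x. x \<notin> \<Union>\<T> \<longrightarrow> c *\<^sub>R v x + d *\<^sub>R w x = 0" using vw by (auto simp: Wh_def)
    fix T assume T: "T \<in> \<T>"
    obtain a b and A :: "real^2^2" where 1: "\<forall>x\<in>T. v x = a + b \<bullet> x + x \<bullet> (A *v x)"
      using vw T unfolding Wh_def by blast
    obtain a' b' and A' :: "real^2^2" where 2: "\<forall>x\<in>T. w x = a' + b' \<bullet> x + x \<bullet> (A' *v x)"
      using vw T unfolding Wh_def by blast
    have "\<forall>x\<in>T. c *\<^sub>R v x + d *\<^sub>R w x
        = (c * a + d * a') + (c *\<^sub>R b + d *\<^sub>R b') \<bullet> x + x \<bullet> ((c *\<^sub>R A + d *\<^sub>R A') *v x)"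
      using 1 2 by (auto simp: inner_add_left inner_add_right matrix_vector_mult_add_rdistrib
          scaleR_matrix_vector_assoc[symmetric] algebra_simps)
    then show "\<exists>e f (B::real^2^2). \<forall>x\<in>T. c *\<^sub>R v x + d *\<^sub>R w x = e + f \<bullet> x + x \<bullet> (B *v x)" by blast
  qed
qed

lemma lin_space_vec: "lin_space S \<Longrightarrow> lin_space (vec_space S)"
  unfolding lin_space_def vec_space_def
  by (auto intro: exI[of _ "\<lambda>x. \<chi> i. s x" for s])

lemma lin_space_with_bc: "lin_space S \<Longrightarrow> lin_space (with_bc S (\<lambda>_. 0) \<Gamma>)"
  using lin_space_zero[of S] by (auto simp: lin_space_def with_bc_def)

text \<open>
  The nodal basis of \<open>V\<^sub>h\<close>.
\<close>

definition hat :: "real^2 \<Rightarrow> real^2 \<Rightarrow> real" where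
  "hat z = interp \<T> (\<lambda>y. if y = z then 1 else 0)"

lemma hat_Vh: "hat z \<in> Vh \<T>" and hat_node: "y \<in> nodes \<T> \<Longrightarrow> hat z y = (if y = z then 1 else 0)"
  by (auto simp: hat_def interp_Vh interp_node)

lemma Vh_nodal_expansion:
  assumes "v \<in> Vh \<T>" shows "v = (\<lambda>x. \<Sum>z\<in>nodes \<T>. v z *\<^sub>R hat z x)"
proof (rule Vh_eqI[OF assms])
  show "(\<lambda>x. \<Sum>z\<in>nodes \<T>. v z *\<^sub>R hat z x) \<in> Vh \<T>"
    by (intro lin_space_sum lin_space_Vh finite_nodes hat_Vh)
  fix y assume y: "y \<in> nodes \<T>"
  have "(\<Sum>z\<in>nodes \<T>. v z *\<^sub>R hat z y) = (\<Sum>z\<in>nodes \<T>. if y = z then v z else 0)"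
    using y by (intro sum.cong) (auto simp: hat_node)
  then show "v y = (\<Sum>z\<in>nodes \<T>. v z *\<^sub>R hat z y)" using y finite_nodes by simp
qed

lemma edge_segment:
  assumes "e \<in> boundary_edges \<Omega> \<T>"
  obtains A B where "e = closed_segment A B" "A \<in> nodes \<T>" "B \<in> nodes \<T>"
    "\<exists>T\<in>\<T>. e \<subseteq> T"
proof -
  obtain T where T: "T \<in> \<T>" "e facet_of T" using assms by (auto simp: boundary_edges_def)
  have f: "e face_of T" "e \<noteq> {}" "aff_dim e = aff_dim T - 1" using T(2) by (auto simp: facet_of_def)
  have "aff_dim T = 2" using aff_dim_simplex two_simplex T by blast
  then have "collinear e" using f by (simp add: collinear_aff_dim)
  moreover have "compact e" "convex e"
    using f face_of_imp_compact face_of_imp_convex compact_cell convex_cell T by blast+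
  ultimately obtain A B where AB: "e = closed_segment A B"
    using compact_convex_collinear_segment f(2) by blast
  have "A extreme_point_of T" "B extreme_point_of T"
    using extreme_point_of_face[OF f(1)] extreme_point_of_segment[of _ A B] AB by auto
  then have "A \<in> nodes \<T>" "B \<in> nodes \<T>" using T by (auto simp: nodes_def)
  then show ?thesis by (intro that[of A B] AB bexI[of _ T] T face_of_imp_subset[OF f(1)])
qed

text \<open>
  The boundary part is a union of whole mesh edges, and on an edge the function is affine between two
  nodes.
\<close>

lemma Vh_zero_on_boundary_part:
  assumes G: "boundary_part \<Omega> \<T> \<Gamma>" and v: "v \<in> Vh \<T>" and z: "\<And>z. z \<in> nodes \<T> \<Longrightarrow> z \<in> \<Gamma> \<Longrightarrow> v z = 0"
    and x: "x \<in> \<Gamma>"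
  shows "v x = 0"
proof -
  obtain E where E: "E \<subseteq> boundary_edges \<Omega> \<T>" "\<Gamma> = \<Union>E" using G by (auto simp: boundary_part_def)
  then obtain e where e: "e \<in> E" "x \<in> e" using x by blast
  then obtain A B where AB: "e = closed_segment A B" "A \<in> nodes \<T>" "B \<in> nodes \<T>" "\<exists>T\<in>\<T>. e \<subseteq> T"
    using edge_segment E by blast
  then obtain T where T: "T \<in> \<T>" "e \<subseteq> T" by blast
  obtain c d where cd: "\<forall>x\<in>T. v x = c + d \<bullet> x" using v T unfolding Vh_def by blast
  have "c + d \<bullet> x = 0 + 0 \<bullet> x"
  proof (rule affine_fun_eq_on_convex_hull)
    show "x \<in> convex hull {A, B}" using e AB by (simp add: segment_convex_hull)
    fix y assume "y \<in> {A, B}"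
    then have "y \<in> nodes \<T>" "y \<in> e" using AB by auto
    then have "v y = 0" using z[of y] e E by blast
    then show "c + d \<bullet> y = 0 + 0 \<bullet> y" using cd T \<open>y \<in> e\<close> by auto
  qed
  then show ?thesis using cd T e by auto
qed

end

section \<open>Gradients and integrals of piecewise smooth functions\<close>

lemma bounded_linear_det_grad: "bounded_linear det_grad"
proof -
  have "linear det_grad"
    by (rule linearI) (auto simp: det_grad_cofactor vec_eq_iff forall_2 vector_2)
  then show ?thesis by (simp add: linear_conv_bounded_linear)
qed

text \<open>
  The determinant in two dimensions is a quadratic form, and its gradient is linear; this is Euler's
  identity for homogeneous functions of degree two.
\<close>

lemma det_eq_half_det_grad: "det F = det_grad F \<bullet> F / 2"
  by (simp add: det_grad_cofactor det_2 inner_vec_def sum_2 vector_2)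

lemma det_add: "det (F + H) = det F + det_grad F \<bullet> H + det H" for F H :: "real^2^2"
  by (simp add: det_grad_cofactor det_2 inner_vec_def sum_2 vector_2 algebra_simps)

lemma bounded_bilinear_transpose_mult:
  "bounded_bilinear (\<lambda>(F::real^2^2) (x::real^2). transpose F *v x)"
proof -
  have "bilinear (\<lambda>(F::real^2^2) (x::real^2). transpose F *v x)"
    unfolding bilinear_def
    by (intro conjI allI linearI)
      (auto simp: vec_eq_iff transpose_def matrix_vector_mult_def sum_2 algebra_simps)
  then show ?thesis by (simp add: bilinear_conv_bounded_bilinear)
qed

text \<open>
  The estimate at \<open>t = 0\<close> forces \<open>\<phi> 0 = \<phi>0\<close>.
\<close>

lemma has_real_derivative_of_quadratic_remainder:
  fixes \<phi> :: "real \<Rightarrow> real"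
  assumes "\<epsilon> > 0" and bd: "\<And>t. \<bar>t\<bar> < \<epsilon> \<Longrightarrow> \<bar>\<phi> t - \<phi>0 - t * D\<bar> \<le> C * t\<^sup>2"
  shows "(\<phi> has_real_derivative D) (at 0)"
proof -
  have 0: "\<phi> 0 = \<phi>0" using bd[of 0] assms(1) by simp
  have "((\<lambda>h. (\<phi> (0 + h) - \<phi> 0) / h - D) \<longlongrightarrow> 0) (at 0)"
  proof (rule Lim_null_comparison)
    show "\<forall>\<^sub>F h in at 0. norm ((\<phi> (0 + h) - \<phi> 0) / h - D) \<le> C * \<bar>h\<bar>"
      unfolding eventually_at
    proof (intro exI[of _ \<epsilon>] conjI ballI impI assms(1))
      fix h :: real assume h: "h \<noteq> 0 \<and> dist h 0 < \<epsilon>"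
      have "(\<phi> (0 + h) - \<phi> 0) / h - D = (\<phi> h - \<phi>0 - h * D) / h" using h by (simp add: 0 field_simps)
      then have "\<bar>(\<phi> (0 + h) - \<phi> 0) / h - D\<bar> = \<bar>\<phi> h - \<phi>0 - h * D\<bar> / \<bar>h\<bar>" by simp
      also have "\<dots> \<le> C * h\<^sup>2 / \<bar>h\<bar>" using bd[of h] h by (intro divide_right_mono) auto
      also have "\<dots> = C * \<bar>h\<bar>" using h by (simp add: power2_eq_square field_simps)
      finally show "norm ((\<phi> (0 + h) - \<phi> 0) / h - D) \<le> C * \<bar>h\<bar>" by simp
    qed
    have "((\<lambda>h. C * \<bar>h\<bar>) \<longlongrightarrow> C * \<bar>0\<bar>) (at (0::real))" by (intro tendsto_intros)
    then show "((\<lambda>h. C * \<bar>h\<bar>) \<longlongrightarrow> 0) (at (0::real))" by simp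
  qed
  then show ?thesis unfolding DERIV_def by (simp only: LIM_zero_iff)
qed

lemma set_integrable_inner_continuous_bounded:
  fixes g v :: "'a::euclidean_space \<Rightarrow> 'b::euclidean_space"
  assumes g: "set_integrable lebesgue S g" and S: "S \<in> sets borel"
    and v: "continuous_on S v" "bounded (v ` S)"
  shows "set_integrable lebesgue S (\<lambda>x. g x \<bullet> v x)"
proof -
  obtain B where B: "\<And>x. x \<in> S \<Longrightarrow> norm (v x) \<le> B" using v(2) by (auto simp: bounded_iff)
  have gi: "integrable lebesgue (\<lambda>x. indicator S x *\<^sub>R g x)" using g by (simp add: set_integrable_def)
  have vm: "(\<lambda>x. indicator S x *\<^sub>R v x) \<in> borel_measurable lebesgue"
    using borel_measurable_continuous_on_indicator[OF S v(1)] by (intro measurable_completion) simp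
  have eq: "indicator S x *\<^sub>R (g x \<bullet> v x) = (indicator S x *\<^sub>R g x) \<bullet> (indicator S x *\<^sub>R v x)" for x
    by (auto simp: indicator_def)
  show ?thesis
    unfolding set_integrable_def
  proof (rule Bochner_Integration.integrable_bound)
    show "integrable lebesgue (\<lambda>x. B *\<^sub>R (indicator S x *\<^sub>R g x))" using gi by (rule integrable_scaleR_right)
    show "(\<lambda>x. indicator S x *\<^sub>R (g x \<bullet> v x)) \<in> borel_measurable lebesgue"
      unfolding eq using gi vm by (intro borel_measurable_inner) auto
    show "AE x in lebesgue. norm (indicator S x *\<^sub>R (g x \<bullet> v x)) \<le> norm (B *\<^sub>R (indicator S x *\<^sub>R g x))"
    proof (intro AE_I2)
      fix x
      show "norm (indicator S x *\<^sub>R (g x \<bullet> v x)) \<le> norm (B *\<^sub>R (indicator S x *\<^sub>R g x))"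
      proof (cases "x \<in> S")
        case True
        have "\<bar>g x \<bullet> v x\<bar> \<le> norm (g x) * norm (v x)" by (rule Cauchy_Schwarz_ineq2)
        also have "\<dots> \<le> norm (g x) * B" using B[OF True] by (intro mult_left_mono) auto
        also have "\<dots> \<le> \<bar>B\<bar> * norm (g x)" by (metis abs_ge_self mult.commute mult_right_mono norm_ge_zero)
        finally show ?thesis using True by simp
      qed simp
    qed
  qed
qed

context fe_mesh
begin

lemma open_cells: "open cells"
  by (auto simp: cells_def)

lemma cells_subset: "cells \<subseteq> \<Omega>"
  unfolding cells_def \<Omega>_eq by (intro UN_least interior_mono) auto

text \<open>
  Gradients of finite element functions exist only inside the cells.  The union \<open>cells\<close> of the open
  cells exhausts the domain up to a null set, so integrands matter only there.
\<close>

lemma negligible_skeleton: "negligible (\<Omega> - cells)"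
proof (rule negligible_subset)
  show "negligible (\<Union>T\<in>\<T>. frontier T)"
    using finite_mesh convex_cell by (intro negligible_Union) (auto intro: negligible_convex_frontier)
  show "\<Omega> - cells \<subseteq> (\<Union>T\<in>\<T>. frontier T)"
  proof
    fix x assume x: "x \<in> \<Omega> - cells"
    then obtain T where T: "T \<in> \<T>" "x \<in> T" using interior_subset unfolding \<Omega>_eq by blast
    then show "x \<in> (\<Union>T\<in>\<T>. frontier T)"
      using x closure_subset[of T] unfolding frontier_def cells_def by blast
  qed
qed

lemma open_\<Omega>: "open \<Omega>" by (simp add: \<Omega>_eq)

lemma compact_Union_mesh: "compact (\<Union>\<T>)"
  using compact_Union[OF finite_mesh] compact_cell by blast

lemma \<Omega>_subset: "\<Omega> \<subseteq> \<Union>\<T>" unfolding \<Omega>_eq by (rule interior_subset)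

lemma lmeasurable_\<Omega>: "\<Omega> \<in> lmeasurable"
  using open_\<Omega> bounded_subset[OF compact_imp_bounded[OF compact_Union_mesh] \<Omega>_subset]
  by (rule lmeasurable_open[rotated])

lemma AE_cells: "AE x\<in>\<Omega> in lebesgue. x \<in> cells"
proof (rule AE_I'[of "\<Omega> - cells"])
  show "\<Omega> - cells \<in> null_sets lebesgue" using negligible_skeleton by (simp add: negligible_iff_null_sets)
qed auto

text \<open>
  The class of integrands: bounded and continuous on the open cells, with no condition elsewhere.
  It contains the finite element functions and their gradients, and it is stable under the operations
  occurring in the energy.
\<close>

definition regular :: "(real^2 \<Rightarrow> 'b::real_normed_vector) \<Rightarrow> bool" where
  "regular h \<longleftrightarrow> continuous_on cells h \<and> bounded (h ` cells)"

lemma regular_const: "regular (\<lambda>_. c)"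
  by (auto simp: regular_def image_constant_conv)

lemma regular_linear: "bounded_linear p \<Longrightarrow> regular h \<Longrightarrow> regular (\<lambda>x. p (h x))"
  using bounded_linear_image[of "h ` cells" p] bounded_linear.continuous_on[of p cells h]
  by (auto simp: regular_def image_image)

lemma regular_bilinear:
  assumes p: "bounded_bilinear p" and h: "regular h" "regular k"
  shows "regular (\<lambda>x. p (h x) (k x))"
proof -
  from p obtain K where K: "K \<ge> 0" "\<And>a b. norm (p a b) \<le> norm a * norm b * K"
    using bounded_bilinear.nonneg_bounded by blast
  obtain B where B: "\<And>x. x \<in> cells \<Longrightarrow> norm (h x) \<le> B" using h by (auto simp: regular_def bounded_iff)
  obtain C where C: "\<And>x. x \<in> cells \<Longrightarrow> norm (k x) \<le> C" using h by (auto simp: regular_def bounded_iff)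
  have "norm (p (h x) (k x)) \<le> B * C * K" if "x \<in> cells" for x
  proof -
    have "0 \<le> B" "0 \<le> C" using B[OF that] C[OF that] norm_ge_zero order_trans by blast+
    then have "norm (h x) * norm (k x) * K \<le> B * C * K"
      using B[OF that] C[OF that] K(1) by (intro mult_mono mult_nonneg_nonneg) auto
    then show ?thesis using K(2) order_trans by blast
  qed
  then have "bounded ((\<lambda>x. p (h x) (k x)) ` cells)" by (auto simp: bounded_iff)
  then show ?thesis using h bounded_bilinear.continuous_on[OF p] by (auto simp: regular_def)
qed

lemma regular_add: "regular h \<Longrightarrow> regular k \<Longrightarrow> regular (\<lambda>x. h x + k x)"
  unfolding regular_def by (auto intro: continuous_on_add bounded_plus_comp)

lemma regular_minus: "regular h \<Longrightarrow> regular (\<lambda>x. - h x)"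
  by (rule regular_linear[OF bounded_linear_minus[OF bounded_linear_ident]])

lemma regular_diff: "regular h \<Longrightarrow> regular k \<Longrightarrow> regular (\<lambda>x. h x - k x)"
  using regular_add[of h "\<lambda>x. - k x"] regular_minus[of k] by simp

lemma regular_cmult: "regular h \<Longrightarrow> regular (\<lambda>x. c * h x)" for h :: "real^2 \<Rightarrow> real"
  by (rule regular_linear[OF bounded_linear_mult_right])

lemmas regular_mult = regular_bilinear[OF bounded_bilinear_mult]
lemmas regular_inner = regular_bilinear[OF bounded_bilinear_inner]
lemmas regular_transpose_mult = regular_bilinear[OF bounded_bilinear_transpose_mult]
lemmas regular_det_grad = regular_linear[OF bounded_linear_det_grad]

lemma regular_det: "regular H \<Longrightarrow> regular (\<lambda>x. det (H x))" for H :: "real^2 \<Rightarrow> real^2^2"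
  unfolding det_eq_half_det_grad divide_inverse
  by (subst mult.commute) (intro regular_cmult regular_inner regular_det_grad)

lemmas regular_intros = regular_const regular_add regular_minus regular_diff regular_cmult
  regular_mult regular_inner regular_transpose_mult regular_det_grad regular_det

lemma regular_integrable:
  fixes h :: "real^2 \<Rightarrow> 'b::euclidean_space"
  assumes h: "regular h" shows "set_integrable lebesgue \<Omega> h"
proof -
  obtain B where B: "\<And>x. x \<in> cells \<Longrightarrow> norm (h x) \<le> B" using h by (auto simp: regular_def bounded_iff)
  have "set_integrable lebesgue cells h"
    unfolding set_integrable_def
  proof (rule integrableI_bounded_set[of \<Omega> _ _ "\<bar>B\<bar>"])
    show "(\<lambda>x. indicator cells x *\<^sub>R h x) \<in> borel_measurable lebesgue"
      using borel_measurable_continuous_on_indicator[of cells h] open_cells h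
      by (auto simp: regular_def intro: measurable_completion)
    show "\<Omega> \<in> sets lebesgue" "emeasure lebesgue \<Omega> < \<infinity>"
      using lmeasurable_\<Omega> by (auto simp: fmeasurable_def)
    show "AE x in lebesgue. x \<in> \<Omega> \<longrightarrow> norm (indicator cells x *\<^sub>R h x) \<le> \<bar>B\<bar>"
      using B by (intro AE_I2) (force simp: indicator_def)
    show "AE x in lebesgue. x \<notin> \<Omega> \<longrightarrow> indicator cells x *\<^sub>R h x = 0"
      using cells_subset by (intro AE_I2) (auto simp: indicator_def)
  qed
  then show ?thesis
  proof (subst absolutely_integrable_spike_set_eq[of \<Omega> cells])
    show "negligible {x \<in> \<Omega> - cells. h x \<noteq> 0}" by (rule negligible_subset[OF negligible_skeleton]) auto
    show "negligible {x \<in> cells - \<Omega>. h x \<noteq> 0}" using cells_subset by (auto intro: negligible_subset[OF negligible_empty])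
  qed
qed

lemma integral_le:
  fixes h k :: "real^2 \<Rightarrow> real"
  assumes "regular h" "regular k" "\<And>x. x \<in> cells \<Longrightarrow> h x \<le> k x"
  shows "(LINT x:\<Omega>|lebesgue. h x) \<le> (LINT x:\<Omega>|lebesgue. k x)"
  using AE_cells assms by (intro set_integral_mono_AE regular_integrable) auto

lemma integral_eq:
  fixes h k :: "real^2 \<Rightarrow> real"
  assumes "regular h" "\<And>x. x \<in> cells \<Longrightarrow> h x = k x"
  shows "(LINT x:\<Omega>|lebesgue. h x) = (LINT x:\<Omega>|lebesgue. k x)"
proof -
  have "regular k" using assms continuous_on_cong[of cells cells h k] image_cong[of cells cells h k]
    by (simp add: regular_def)
  with assms show ?thesis by (intro antisym integral_le) auto
qed

lemma integral_lincomb: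
  fixes h k :: "real^2 \<Rightarrow> real"
  assumes h: "set_integrable lebesgue \<Omega> h" "set_integrable lebesgue \<Omega> k"
  shows "(LINT x:\<Omega>|lebesgue. c * h x + d * k x) = c * (LINT x:\<Omega>|lebesgue. h x) + d * (LINT x:\<Omega>|lebesgue. k x)"
proof -
  have "set_integrable lebesgue \<Omega> (\<lambda>x. c * h x)" "set_integrable lebesgue \<Omega> (\<lambda>x. d * k x)"
    using h by (auto intro: set_integrable_mult_right)
  then show ?thesis by (simp add: set_integral_add)
qed

lemma lin_map_integral:
  fixes h :: "('x \<Rightarrow> 'b::real_vector) \<Rightarrow> real^2 \<Rightarrow> real"
  assumes S: "lin_space S" and h: "\<And>v. v \<in> S \<Longrightarrow> regular (h v)"
    and lin: "\<And>v w c d x. v \<in> S \<Longrightarrow> w \<in> S \<Longrightarrow> x \<in> cells \<Longrightarrow>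
      h (\<lambda>y. c *\<^sub>R v y + d *\<^sub>R w y) x = c * h v x + d * h w x"
  shows "lin_map S (\<lambda>v. LINT x:\<Omega>|lebesgue. h v x)"
  unfolding lin_map_def
proof (intro ballI allI)
  fix v w c d assume vw: "v \<in> S" "w \<in> S"
  have "(LINT x:\<Omega>|lebesgue. h (\<lambda>y. c *\<^sub>R v y + d *\<^sub>R w y) x) = (LINT x:\<Omega>|lebesgue. c * h v x + d * h w x)"
    by (rule integral_eq) (use vw h lin lin_spaceD[OF S] in auto)
  also have "\<dots> = c * (LINT x:\<Omega>|lebesgue. h v x) + d * (LINT x:\<Omega>|lebesgue. h w x)"
    by (intro integral_lincomb regular_integrable h vw)
  finally show "(LINT x:\<Omega>|lebesgue. h (\<lambda>y. c *\<^sub>R v y + d *\<^sub>R w y) x)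
     = c *\<^sub>R (LINT x:\<Omega>|lebesgue. h v x) + d *\<^sub>R (LINT x:\<Omega>|lebesgue. h w x)" by simp
qed

text \<open>
  The quadratic polynomial representing \<open>v\<close> on the cell is differentiable on the whole plane with
  continuous gradient.  Continuity up to the boundary of the cell is what yields bounded gradients.
\<close>

lemma Wh_gradient_on_cell:
  assumes v: "v \<in> vec_space (Wh \<T>)" and T: "T \<in> \<T>"
  obtains G :: "real^2 \<Rightarrow> real^2^2" where "continuous_on UNIV G"
    "\<And>x. x \<in> interior T \<Longrightarrow> (v has_derivative (\<lambda>h. G x *v h)) (at x)"
proof -
  have "\<forall>i. \<exists>c d (A::real^2^2). \<forall>x\<in>T. v x $ i = c + d \<bullet> x + x \<bullet> (A *v x)"
    using v T unfolding vec_space_def Wh_def by blast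
  then obtain c d and A :: "2 \<Rightarrow> real^2^2" where eq: "\<And>i x. x \<in> T \<Longrightarrow> v x $ i = c i + d i \<bullet> x + x \<bullet> (A i *v x)"
    by metis
  define G where "G x = (\<chi> i. d i + A i *v x + transpose (A i) *v x)" for x
  show ?thesis
  proof (rule that)
    show "continuous_on UNIV G" unfolding G_def
      by (intro continuous_intros linear_continuous_on) auto
    fix x assume x: "x \<in> interior T"
    show "(v has_derivative (\<lambda>h. G x *v h)) (at x)"
    proof (subst has_derivative_componentwise_within, intro ballI)
      fix b :: "real^2" assume "b \<in> Basis"
      then obtain i where b: "b = axis i 1" by (auto simp: Basis_vec_def)
      have "((\<lambda>x. c i + d i \<bullet> x + x \<bullet> (A i *v x)) has_derivative
          (\<lambda>h. d i \<bullet> h + (x \<bullet> (A i *v h) + h \<bullet> (A i *v x)))) (at x)"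
        by (auto intro!: derivative_eq_intros bounded_linear.has_derivative[OF matrix_vector_mul_bounded_linear])
      moreover have "d i \<bullet> h + (x \<bullet> (A i *v h) + h \<bullet> (A i *v x)) = (G x *v h) \<bullet> b" for h
      proof -
        have "(G x *v h) \<bullet> b = (G x $ i) \<bullet> h"
          by (simp only: b inner_axis inner_real_def mult_1_right matrix_vector_mul_component)
        then show ?thesis
          by (simp only: G_def vec_lambda_beta inner_add_left transpose_matrix_vector dot_lmul_matrix)
            (simp add: inner_commute)
      qed
      ultimately have "((\<lambda>x. c i + d i \<bullet> x + x \<bullet> (A i *v x)) has_derivative (\<lambda>h. (G x *v h) \<bullet> b)) (at x)"
        by simp
      then show "((\<lambda>x. v x \<bullet> b) has_derivative (\<lambda>h. (G x *v h) \<bullet> b)) (at x)"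
        by (rule has_derivative_transform_within_open[OF _ open_interior x])
           (use eq interior_subset in \<open>force simp: b inner_axis\<close>)
    qed
  qed
qed

lemma grad_has_derivative:
  assumes v: "v \<in> vec_space (Wh \<T>)" and x: "x \<in> cells"
  shows "(v has_derivative (\<lambda>h. grad v x *v h)) (at x)"
proof -
  obtain T where T: "T \<in> \<T>" "x \<in> interior T" using x by (auto simp: cells_def)
  obtain G where G: "(v has_derivative (\<lambda>h. G x *v h)) (at x)" using Wh_gradient_on_cell[OF v T(1)] T(2) by metis
  then have "v differentiable (at x)" by (rule differentiableI)
  then show ?thesis unfolding grad_def using jacobian_works by blast
qed

lemma grad_eqI:
  assumes "(v has_derivative (\<lambda>h. G *v h)) (at x)" shows "grad v x = G"
  unfolding grad_def jacobian_def frechet_derivative_at[OF assms, symmetric] by (simp add: matrix_of_matrix_vector_mul)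

lemma grad_lincomb:
  assumes v: "v \<in> vec_space (Wh \<T>)" "w \<in> vec_space (Wh \<T>)" and x: "x \<in> cells"
  shows "grad (\<lambda>y. c *\<^sub>R v y + d *\<^sub>R w y) x = c *\<^sub>R grad v x + d *\<^sub>R grad w x"
proof (rule grad_eqI)
  show "((\<lambda>y. c *\<^sub>R v y + d *\<^sub>R w y) has_derivative (\<lambda>h. (c *\<^sub>R grad v x + d *\<^sub>R grad w x) *v h)) (at x)"
    using grad_has_derivative[OF v(1) x] grad_has_derivative[OF v(2) x]
    by (auto intro!: derivative_eq_intros simp: matrix_vector_mult_add_rdistrib scaleR_matrix_vector_assoc)
qed

lemma regular_grad:
  assumes v: "v \<in> vec_space (Wh \<T>)" shows "regular (grad v)"
proof -
  have cell: "continuous_on (interior T) (grad v) \<and> bounded (grad v ` interior T)" if T: "T \<in> \<T>" for T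
  proof -
    obtain G where G: "continuous_on UNIV G" "\<And>x. x \<in> interior T \<Longrightarrow> (v has_derivative (\<lambda>h. G x *v h)) (at x)"
      using Wh_gradient_on_cell[OF v T] by metis
    have eq: "\<And>x. x \<in> interior T \<Longrightarrow> grad v x = G x" using G(2) grad_eqI by blast
    have "bounded (G ` T)"
      using compact_imp_bounded[OF compact_continuous_image[OF continuous_on_subset[OF G(1)] compact_cell[OF T]]] by simp
    then have "bounded (G ` interior T)" by (rule bounded_subset) (use interior_subset in blast)
    then show ?thesis
      using eq continuous_on_cong[OF refl eq] continuous_on_subset[OF G(1)] by (simp cong: image_cong)
  qed
  show ?thesis
    unfolding regular_def cells_def image_UN
    using cell finite_mesh by (intro conjI continuous_on_open_UN bounded_UN) auto
qed

lemma continuous_Wh: "v \<in> vec_space (Wh \<T>) \<Longrightarrow> continuous_on (\<Union>\<T>) v"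
  using continuous_on_vec_lambda[of "\<Union>\<T>" "\<lambda>i x. v x $ i"] by (simp add: vec_space_def Wh_def)

lemma bounded_Wh: "v \<in> vec_space (Wh \<T>) \<Longrightarrow> bounded (v ` \<Union>\<T>)"
  using compact_imp_bounded compact_continuous_image continuous_Wh compact_Union_mesh by blast

lemma regular_Wh: "v \<in> vec_space (Wh \<T>) \<Longrightarrow> regular v"
  using continuous_Wh bounded_Wh cells_subset \<Omega>_subset unfolding regular_def
  by (meson bounded_subset continuous_on_subset image_mono subset_trans)

lemma regular_Vh: assumes "q \<in> Vh \<T>" shows "regular q"
proof -
  have q: "continuous_on (\<Union>\<T>) q" using assms by (simp add: Vh_def)
  then have "bounded (q ` \<Union>\<T>)" using compact_imp_bounded compact_continuous_image compact_Union_mesh by blast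
  with q show ?thesis using cells_subset \<Omega>_subset unfolding regular_def
    by (meson bounded_subset continuous_on_subset image_mono subset_trans)
qed

text \<open>
  The set of points of the open cells where \<open>v\<close> is nonzero is open and null, hence empty; every
  cell is the closure of its interior.
\<close>

lemma integral_square_zero:
  assumes v: "v \<in> Vh \<T>" and 0: "(LINT x:\<Omega>|lebesgue. v x * v x) = 0"
  shows "v = (\<lambda>_. 0)"
proof -
  note r = regular_Vh[OF v]
  have "set_integrable lebesgue \<Omega> (\<lambda>x. v x * v x)" by (intro regular_integrable regular_mult r)
  then have "AE x in lebesgue. indicator \<Omega> x *\<^sub>R (v x * v x) = 0"
    using 0 unfolding set_integrable_def set_lebesgue_integral_def
    by (subst (asm) integral_nonneg_eq_0_iff_AE) (auto simp: indicator_def)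
  then have "AE x in lebesgue. x \<notin> {x \<in> cells. v x \<noteq> 0}"
    by eventually_elim (use cells_subset in \<open>auto simp: indicator_def split: if_splits\<close>)
  moreover have op: "open {x \<in> cells. v x \<noteq> 0}"
  proof -
    have "{x \<in> cells. v x \<noteq> 0} = cells \<inter> v -` (- {0})" by auto
    also have "open \<dots>"
      using open_cells r by (intro continuous_open_preimage) (auto simp: regular_def)
    finally show ?thesis .
  qed
  ultimately have "negligible {x \<in> cells. v x \<noteq> 0}"
    unfolding negligible_iff_null_sets by (subst AE_iff_null_sets) auto
  then have z: "v x = 0" if "x \<in> cells" for x
    using op open_not_negligible that by blast
  have "v x = 0" if T: "T \<in> \<T>" "x \<in> T" for T x
  proof (rule continuous_constant_on_closure[of "interior T" v])
    show "continuous_on (closure (interior T)) v"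
      using v T cell_closure_interior by (auto simp: Vh_def intro: continuous_on_subset)
    show "v y = 0" if "y \<in> interior T" for y using that T by (intro z) (auto simp: cells_def)
    show "x \<in> closure (interior T)" using T cell_closure_interior by simp
  qed
  then show ?thesis using v unfolding Vh_def by (intro ext) blast
qed

lemma regular_def_grad: "v \<in> vec_space (Wh \<T>) \<Longrightarrow> regular (def_grad v)"
  unfolding def_grad_def by (intro regular_add regular_const) (simp add: eta_contract_eq regular_grad)

end

section \<open>Derivative of the energy along curves\<close>

lemma lin_map_sum_maps:
  assumes "\<And>i. i \<in> I \<Longrightarrow> lin_map S (L i)"
  shows "lin_map S (\<lambda>v. \<Sum>i\<in>I. L i v)"
  using assms by (simp add: lin_map_def sum.distrib scaleR_sum_right)

lemma lin_map_scaled: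
  fixes L :: "('x \<Rightarrow> 'b::real_vector) \<Rightarrow> real"
  shows "lin_map S L \<Longrightarrow> lin_map S (\<lambda>v. c * L v)"
  by (simp add: lin_map_def algebra_simps)

context fe_mesh
begin

abbreviation "Wvec \<equiv> vec_space (Wh \<T>)"

lemma lin_space_Wvec: "lin_space Wvec"
  by (intro lin_space_vec lin_space_Wh)

lemma lin_map_load:
  assumes f: "set_integrable lebesgue \<Omega> f"
  shows "lin_map Wvec (\<lambda>v. LINT x:\<Omega>|lebesgue. f x \<bullet> v x)"
  unfolding lin_map_def
proof (intro ballI allI)
  fix v w c d assume vw: "v \<in> Wvec" "w \<in> Wvec"
  have int: "set_integrable lebesgue \<Omega> (\<lambda>x. f x \<bullet> v x)" if "v \<in> Wvec" for v
    using f open_\<Omega> continuous_on_subset[OF continuous_Wh[OF that] \<Omega>_subset]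
      bounded_subset[OF bounded_Wh[OF that] image_mono[OF \<Omega>_subset]]
    by (intro set_integrable_inner_continuous_bounded) auto
  show "(LINT x:\<Omega>|lebesgue. f x \<bullet> (c *\<^sub>R v x + d *\<^sub>R w x))
      = c *\<^sub>R (LINT x:\<Omega>|lebesgue. f x \<bullet> v x) + d *\<^sub>R (LINT x:\<Omega>|lebesgue. f x \<bullet> w x)"
    using integral_lincomb[OF int[OF vw(1)] int[OF vw(2)], of c d] by (simp add: inner_add_right)
qed

text \<open>
  On each boundary edge the traction is integrable along a parametrisation whose end points span the
  edge.  In the double sum over end points the diagonal terms carry the factor \<open>dist A A = 0\<close>.
\<close>

lemma lin_map_traction:
  assumes g: "boundary_integrable \<Omega> \<T> \<Gamma> g"
  shows "lin_map Wvec (\<lambda>v. boundary_integral \<Omega> \<T> \<Gamma> (\<lambda>x. g x \<bullet> v x))"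
  unfolding boundary_integral_def
proof (rule lin_map_sum_maps)
  fix e assume e: "e \<in> {e. e \<in> boundary_edges \<Omega> \<T> \<and> e \<subseteq> \<Gamma>}"
  have half: "edge_integral e \<phi> = (1/2) * (\<Sum>A | A extreme_point_of e. \<Sum>B | B extreme_point_of e.
      dist A B * (LINT t:{0..1}|lebesgue. \<phi> (A + t *\<^sub>R (B - A))))" for \<phi>
    by (simp add: edge_integral_def)
  show "lin_map Wvec (\<lambda>v. edge_integral e (\<lambda>x. g x \<bullet> v x))"
    unfolding half
  proof (rule lin_map_scaled, rule lin_map_sum_maps, rule lin_map_sum_maps)
      fix A B assume A: "A \<in> {A. A extreme_point_of e}" and B: "B \<in> {B. B extreme_point_of e}"
      from e have "e \<in> boundary_edges \<Omega> \<T>" by simp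
      then obtain A' B' where e': "e = closed_segment A' B'" and "\<exists>T\<in>\<T>. e \<subseteq> T" by (rule edge_segment)
      then have eT: "e \<subseteq> \<Union>\<T>" by blast
      show "lin_map Wvec (\<lambda>v. dist A B * (LINT t:{0..1}|lebesgue. g (A + t *\<^sub>R (B - A)) \<bullet> v (A + t *\<^sub>R (B - A))))"
      proof (cases "A = B")
        case True
        then show ?thesis by (simp add: lin_map_def)
      next
        case False
        let ?\<gamma> = "\<lambda>t. A + t *\<^sub>R (B - A)"
        have "{A, B} = {A', B'}" using A B False unfolding e' mem_Collect_eq extreme_point_of_segment by auto
        then have AB: "e = closed_segment A B" using e' closed_segment_commute by (auto simp: doubleton_eq_iff)
        then have gi: "set_integrable lebesgue {0..1} (\<lambda>t. g (?\<gamma> t))" using g e by (auto simp: boundary_integrable_def)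
        have "?\<gamma> t \<in> closed_segment A B" if "t \<in> {0..1}" for t
          using that unfolding in_segment by (intro exI[of _ t]) (auto simp: algebra_simps)
        then have im: "?\<gamma> ` {0..1} \<subseteq> \<Union>\<T>" using AB eT by blast
        have int: "set_integrable lebesgue {0..1} (\<lambda>t. g (?\<gamma> t) \<bullet> v (?\<gamma> t))" if v: "v \<in> Wvec" for v
        proof (rule set_integrable_inner_continuous_bounded[OF gi])
          have "continuous_on {0..1} (v \<circ> ?\<gamma>)"
            by (intro continuous_on_compose continuous_intros continuous_on_subset[OF continuous_Wh[OF v] im])
          then show "continuous_on {0..1} (\<lambda>t. v (?\<gamma> t))" by (simp add: o_def)
          have "(\<lambda>t. v (?\<gamma> t)) ` {0..1} \<subseteq> v ` \<Union>\<T>" using im by blast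
          then show "bounded ((\<lambda>t. v (?\<gamma> t)) ` {0..1})" by (rule bounded_subset[OF bounded_Wh[OF v]])
        qed simp
        have "lin_map Wvec (\<lambda>v. LINT t:{0..1}|lebesgue. g (?\<gamma> t) \<bullet> v (?\<gamma> t))"
          unfolding lin_map_def
        proof (intro ballI allI)
          fix v w c d assume vw: "v \<in> Wvec" "w \<in> Wvec"
          have "set_integrable lebesgue {0..1} (\<lambda>t. c * (g (?\<gamma> t) \<bullet> v (?\<gamma> t)))"
            "set_integrable lebesgue {0..1} (\<lambda>t. d * (g (?\<gamma> t) \<bullet> w (?\<gamma> t)))"
            using int vw by (auto intro: set_integrable_mult_right)
          then show "(LINT t:{0..1}|lebesgue. g (?\<gamma> t) \<bullet> (c *\<^sub>R v (?\<gamma> t) + d *\<^sub>R w (?\<gamma> t)))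
             = c *\<^sub>R (LINT t:{0..1}|lebesgue. g (?\<gamma> t) \<bullet> v (?\<gamma> t)) + d *\<^sub>R (LINT t:{0..1}|lebesgue. g (?\<gamma> t) \<bullet> w (?\<gamma> t))"
            by (simp add: inner_add_right set_integral_add)
        qed
        then show ?thesis by (rule lin_map_scaled)
      qed
  qed
qed

text \<open>
  First-order Taylor expansion in \<open>t\<close> at \<open>0\<close>, uniform over the open cells, with value \<open>h\<close>,
  derivative \<open>k\<close> and a remainder of order \<open>t\<^sup>2\<close>.  The uniformity allows integration over the
  domain.
\<close>

definition expansion ::
    "real \<Rightarrow> (real \<Rightarrow> real^2 \<Rightarrow> 'b::real_normed_vector) \<Rightarrow> (real^2 \<Rightarrow> 'b) \<Rightarrow> (real^2 \<Rightarrow> 'b) \<Rightarrow> bool" where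
  "expansion \<epsilon> P h k \<longleftrightarrow> regular h \<and> regular k \<and> (\<forall>t. \<bar>t\<bar> < \<epsilon> \<longrightarrow> regular (P t)) \<and>
     (\<exists>C. \<forall>t x. \<bar>t\<bar> < \<epsilon> \<longrightarrow> x \<in> cells \<longrightarrow> norm (P t x - h x - t *\<^sub>R k x) \<le> C * t\<^sup>2)"

lemma expansion_const: "regular h \<Longrightarrow> expansion \<epsilon> (\<lambda>t. h) h (\<lambda>_. 0)"
  by (auto simp: expansion_def regular_const intro: exI[of _ 0])

lemma expansion_add:
  assumes "expansion \<epsilon> P h k" "expansion \<epsilon> P' h' k'"
  shows "expansion \<epsilon> (\<lambda>t x. P t x + P' t x) (\<lambda>x. h x + h' x) (\<lambda>x. k x + k' x)"
proof -
  obtain C where C: "\<And>t x. \<bar>t\<bar> < \<epsilon> \<Longrightarrow> x \<in> cells \<Longrightarrow> norm (P t x - h x - t *\<^sub>R k x) \<le> C * t\<^sup>2"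
    using assms(1) by (auto simp: expansion_def)
  obtain C' where C': "\<And>t x. \<bar>t\<bar> < \<epsilon> \<Longrightarrow> x \<in> cells \<Longrightarrow> norm (P' t x - h' x - t *\<^sub>R k' x) \<le> C' * t\<^sup>2"
    using assms(2) by (auto simp: expansion_def)
  have "norm (P t x + P' t x - (h x + h' x) - t *\<^sub>R (k x + k' x)) \<le> (C + C') * t\<^sup>2"
    if "\<bar>t\<bar> < \<epsilon>" "x \<in> cells" for t x
  proof -
    have "P t x + P' t x - (h x + h' x) - t *\<^sub>R (k x + k' x)
        = (P t x - h x - t *\<^sub>R k x) + (P' t x - h' x - t *\<^sub>R k' x)" by (simp add: algebra_simps)
    then show ?thesis using norm_triangle_mono[OF C[OF that] C'[OF that]] by (simp add: algebra_simps)
  qed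
  then show ?thesis using assms unfolding expansion_def by (auto intro: regular_add)
qed

lemma expansion_cmult:
  fixes h :: "real^2 \<Rightarrow> real"
  assumes "expansion \<epsilon> P h k"
  shows "expansion \<epsilon> (\<lambda>t x. c * P t x) (\<lambda>x. c * h x) (\<lambda>x. c * k x)"
proof -
  obtain C where C: "\<And>t x. \<bar>t\<bar> < \<epsilon> \<Longrightarrow> x \<in> cells \<Longrightarrow> norm (P t x - h x - t *\<^sub>R k x) \<le> C * t\<^sup>2"
    using assms(1) by (auto simp: expansion_def)
  have "norm (c * P t x - c * h x - t *\<^sub>R (c * k x)) \<le> (\<bar>c\<bar> * C) * t\<^sup>2"
    if "\<bar>t\<bar> < \<epsilon>" "x \<in> cells" for t x
  proof -
    have "c * P t x - c * h x - t *\<^sub>R (c * k x) = c * (P t x - h x - t *\<^sub>R k x)" by (simp add: algebra_simps)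
    then show ?thesis using mult_left_mono[OF C[OF that], of "\<bar>c\<bar>"] by (simp add: abs_mult)
  qed
  then show ?thesis using assms unfolding expansion_def by (auto intro: regular_cmult)
qed

lemma expansion_bounded:
  assumes "expansion \<epsilon> P h k" "\<epsilon> \<le> 1"
  obtains B C where "B \<ge> 0" "C \<ge> 0"
    "\<And>x. x \<in> cells \<Longrightarrow> norm (h x) \<le> B" "\<And>x. x \<in> cells \<Longrightarrow> norm (k x) \<le> B"
    "\<And>t x. \<bar>t\<bar> < \<epsilon> \<Longrightarrow> x \<in> cells \<Longrightarrow> norm (P t x) \<le> B"
    "\<And>t x. \<bar>t\<bar> < \<epsilon> \<Longrightarrow> x \<in> cells \<Longrightarrow> norm (P t x - h x - t *\<^sub>R k x) \<le> C * t\<^sup>2"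
proof -
  obtain C where C: "\<And>t x. \<bar>t\<bar> < \<epsilon> \<Longrightarrow> x \<in> cells \<Longrightarrow> norm (P t x - h x - t *\<^sub>R k x) \<le> C * t\<^sup>2"
    using assms(1) by (auto simp: expansion_def)
  obtain H where H: "\<And>x. x \<in> cells \<Longrightarrow> norm (h x) \<le> H" using assms(1) by (auto simp: expansion_def regular_def bounded_iff)
  obtain K where K: "\<And>x. x \<in> cells \<Longrightarrow> norm (k x) \<le> K" using assms(1) by (auto simp: expansion_def regular_def bounded_iff)
  let ?C = "\<bar>C\<bar>" let ?B = "\<bar>H\<bar> + \<bar>K\<bar> + \<bar>C\<bar>"
  have C1: "norm (P t x - h x - t *\<^sub>R k x) \<le> ?C * t\<^sup>2" if "\<bar>t\<bar> < \<epsilon>" "x \<in> cells" for t x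
    by (rule order_trans[OF C[OF that]]) (simp add: mult_right_mono)
  have PB: "norm (P t x) \<le> ?B" if t: "\<bar>t\<bar> < \<epsilon>" and x: "x \<in> cells" for t x
  proof -
    have t1: "\<bar>t\<bar> \<le> 1" using t assms(2) by simp
    then have t2: "t\<^sup>2 \<le> 1" by (simp add: abs_square_le_1)
    have "P t x = h x + t *\<^sub>R k x + (P t x - h x - t *\<^sub>R k x)" by simp
    then have "norm (P t x) \<le> norm (h x) + norm (t *\<^sub>R k x) + norm (P t x - h x - t *\<^sub>R k x)"
      by (metis norm_triangle_ineq norm_triangle_le add_mono order_refl)
    also have "\<dots> \<le> \<bar>H\<bar> + \<bar>K\<bar> + \<bar>C\<bar>"
    proof (intro add_mono)
      show "norm (h x) \<le> \<bar>H\<bar>" using H[OF x] by simp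
      have "\<bar>t\<bar> * norm (k x) \<le> 1 * \<bar>K\<bar>" using K[OF x] t1 by (intro mult_mono) auto
      then show "norm (t *\<^sub>R k x) \<le> \<bar>K\<bar>" by simp
      show "norm (P t x - h x - t *\<^sub>R k x) \<le> \<bar>C\<bar>"
        by (rule order_trans[OF C1[OF t x]]) (use t2 in \<open>simp add: mult_left_le\<close>)
    qed
    finally show ?thesis .
  qed
  show ?thesis
  proof (rule that[of ?B ?C])
    show "norm (h x) \<le> ?B" "norm (k x) \<le> ?B" if "x \<in> cells" for x
      using H[OF that] K[OF that] by linarith+
  qed (use C1 PB in auto)
qed

text \<open>
  Product rule.  With \<open>P = h + t k + r\<close> and \<open>Q = h' + t k' + r'\<close> the error is
  \<open>p(r, Q) + p(h, r') + t p(k, t k' + r')\<close>, and each summand is of order \<open>t\<^sup>2\<close>.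
\<close>

lemma expansion_bilinear:
  assumes p: "bounded_bilinear p" and P: "expansion \<epsilon> P h k" and Q: "expansion \<epsilon> Q h' k'" and "\<epsilon> \<le> 1"
  shows "expansion \<epsilon> (\<lambda>t x. p (P t x) (Q t x)) (\<lambda>x. p (h x) (h' x)) (\<lambda>x. p (h x) (k' x) + p (k x) (h' x))"
proof -
  interpret bounded_bilinear p by (rule p)
  obtain K where K: "K \<ge> 0" "\<And>a b. norm (p a b) \<le> norm a * norm b * K" using nonneg_bounded by blast
  obtain B C where B: "B \<ge> 0" "C \<ge> 0"
    "\<And>x. x \<in> cells \<Longrightarrow> norm (h x) \<le> B" "\<And>x. x \<in> cells \<Longrightarrow> norm (k x) \<le> B"
    "\<And>t x. \<bar>t\<bar> < \<epsilon> \<Longrightarrow> x \<in> cells \<Longrightarrow> norm (P t x) \<le> B"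
    "\<And>t x. \<bar>t\<bar> < \<epsilon> \<Longrightarrow> x \<in> cells \<Longrightarrow> norm (P t x - h x - t *\<^sub>R k x) \<le> C * t\<^sup>2"
    using expansion_bounded[OF P \<open>\<epsilon> \<le> 1\<close>] by blast
  obtain B' C' where B': "B' \<ge> 0" "C' \<ge> 0"
    "\<And>x. x \<in> cells \<Longrightarrow> norm (h' x) \<le> B'" "\<And>x. x \<in> cells \<Longrightarrow> norm (k' x) \<le> B'"
    "\<And>t x. \<bar>t\<bar> < \<epsilon> \<Longrightarrow> x \<in> cells \<Longrightarrow> norm (Q t x) \<le> B'"
    "\<And>t x. \<bar>t\<bar> < \<epsilon> \<Longrightarrow> x \<in> cells \<Longrightarrow> norm (Q t x - h' x - t *\<^sub>R k' x) \<le> C' * t\<^sup>2"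
    using expansion_bounded[OF Q \<open>\<epsilon> \<le> 1\<close>] by blast
  have "norm (p (P t x) (Q t x) - p (h x) (h' x) - t *\<^sub>R (p (h x) (k' x) + p (k x) (h' x)))
      \<le> (C * B' * K + B * C' * K + B * (B' + C') * K) * t\<^sup>2" if t: "\<bar>t\<bar> < \<epsilon>" and x: "x \<in> cells" for t x
  proof -
    define r where "r = P t x - h x - t *\<^sub>R k x"
    define r' where "r' = Q t x - h' x - t *\<^sub>R k' x"
    have r: "norm r \<le> C * t\<^sup>2" "norm r' \<le> C' * t\<^sup>2" unfolding r_def r'_def using B(6) B'(6) t x by auto
    have Pe: "P t x = h x + t *\<^sub>R k x + r" and Qe: "Q t x = h' x + t *\<^sub>R k' x + r'" by (auto simp: r_def r'_def)
    have t2: "\<bar>t\<bar> * t\<^sup>2 \<le> t\<^sup>2" using t \<open>\<epsilon> \<le> 1\<close> by (intro mult_left_le_one_le) auto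
    have "p (P t x) (Q t x) - p (h x) (h' x) - t *\<^sub>R (p (h x) (k' x) + p (k x) (h' x))
        = p r (Q t x) + p (h x) r' + t *\<^sub>R p (k x) (t *\<^sub>R k' x + r')"
      unfolding Pe by (simp add: Qe add_left add_right scaleR_left scaleR_right algebra_simps)
    also have "norm \<dots> \<le> norm (p r (Q t x)) + norm (p (h x) r') + norm (t *\<^sub>R p (k x) (t *\<^sub>R k' x + r'))"
      by (intro norm_triangle_mono order_refl)
    also have "\<dots> \<le> C * B' * K * t\<^sup>2 + B * C' * K * t\<^sup>2 + B * (B' + C') * K * t\<^sup>2"
    proof (intro add_mono)
      have "norm (p r (Q t x)) \<le> norm r * norm (Q t x) * K" by (rule K)
      also have "\<dots> \<le> (C * t\<^sup>2) * B' * K" using r B'(5)[OF t x] B B' K by (intro mult_mono mult_nonneg_nonneg) auto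
      finally show "norm (p r (Q t x)) \<le> C * B' * K * t\<^sup>2" by (simp add: mult_ac)
      have "norm (p (h x) r') \<le> norm (h x) * norm r' * K" by (rule K)
      also have "\<dots> \<le> B * (C' * t\<^sup>2) * K" using r B(3)[OF x] B B' K by (intro mult_mono mult_nonneg_nonneg) auto
      finally show "norm (p (h x) r') \<le> B * C' * K * t\<^sup>2" by (simp add: mult_ac)
      have "norm (t *\<^sub>R k' x + r') \<le> \<bar>t\<bar> * B' + C' * t\<^sup>2"
        using r B'(4)[OF x] by (intro norm_triangle_mono) (auto intro: mult_left_mono)
      then have "norm (k x) * norm (t *\<^sub>R k' x + r') * K \<le> B * (\<bar>t\<bar> * B' + C' * t\<^sup>2) * K"
        using B(4)[OF x] B B' K by (intro mult_mono mult_nonneg_nonneg) auto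
      then have "norm (p (k x) (t *\<^sub>R k' x + r')) \<le> B * (\<bar>t\<bar> * B' + C' * t\<^sup>2) * K"
        using K(2) order_trans by blast
      then have "norm (t *\<^sub>R p (k x) (t *\<^sub>R k' x + r')) \<le> \<bar>t\<bar> * (B * (\<bar>t\<bar> * B' + C' * t\<^sup>2) * K)"
        by (simp add: mult_left_mono)
      also have "\<dots> = B * K * (\<bar>t\<bar>\<^sup>2 * B' + C' * (\<bar>t\<bar> * t\<^sup>2))" by (simp only: power2_eq_square) (simp add: algebra_simps)
      also have "\<dots> \<le> B * K * (t\<^sup>2 * B' + C' * t\<^sup>2)"
        using t2 B B' K by (intro mult_left_mono add_mono mult_nonneg_nonneg) auto
      finally show "norm (t *\<^sub>R p (k x) (t *\<^sub>R k' x + r')) \<le> B * (B' + C') * K * t\<^sup>2" by (simp add: algebra_simps)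
    qed
    finally show ?thesis by (simp add: algebra_simps)
  qed
  then show ?thesis
    using P Q unfolding expansion_def by (auto intro!: regular_add regular_bilinear[OF p])
qed

lemma expansion_integral:
  fixes h :: "real^2 \<Rightarrow> real"
  assumes P: "expansion \<epsilon> P h k"
  shows "\<exists>C. \<forall>t. \<bar>t\<bar> < \<epsilon> \<longrightarrow> \<bar>(LINT x:\<Omega>|lebesgue. P t x) - (LINT x:\<Omega>|lebesgue. h x) - t * (LINT x:\<Omega>|lebesgue. k x)\<bar> \<le> C * t\<^sup>2"
proof -
  obtain C where C: "\<And>t x. \<bar>t\<bar> < \<epsilon> \<Longrightarrow> x \<in> cells \<Longrightarrow> norm (P t x - h x - t *\<^sub>R k x) \<le> C * t\<^sup>2"
    using P by (auto simp: expansion_def)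
  define m where "m = (LINT x:\<Omega>|lebesgue. (1::real))"
  have "\<bar>(LINT x:\<Omega>|lebesgue. P t x) - (LINT x:\<Omega>|lebesgue. h x) - t * (LINT x:\<Omega>|lebesgue. k x)\<bar> \<le> (C * m) * t\<^sup>2"
    if t: "\<bar>t\<bar> < \<epsilon>" for t
  proof -
    have reg: "regular h" "regular k" "regular (P t)" using P t by (auto simp: expansion_def)
    let ?A = "LINT x:\<Omega>|lebesgue. h x + t * k x"
    have A: "?A = (LINT x:\<Omega>|lebesgue. h x) + t * (LINT x:\<Omega>|lebesgue. k x)"
      using integral_lincomb[OF regular_integrable[OF reg(1)] regular_integrable[OF reg(2)], of 1 t] by simp
    have shift: "(LINT x:\<Omega>|lebesgue. (h x + t * k x) + s) = ?A + s * m" for s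
      using integral_lincomb[OF regular_integrable[OF regular_add[OF reg(1) regular_cmult[OF reg(2), of t]]]
          regular_integrable[OF regular_const[of 1]], of 1 s]
      by (simp add: m_def)
    have bd: "\<bar>P t x - (h x + t * k x)\<bar> \<le> C * t\<^sup>2" if "x \<in> cells" for x using C[OF t that] by (simp add: algebra_simps)
    have "(LINT x:\<Omega>|lebesgue. P t x) \<le> ?A + C * t\<^sup>2 * m"
      unfolding shift[symmetric]
      by (rule integral_le) (use bd in \<open>force intro!: regular_intros reg\<close>)+
    moreover have "?A + (- C * t\<^sup>2) * m \<le> (LINT x:\<Omega>|lebesgue. P t x)"
      unfolding shift[symmetric]
      by (rule integral_le) (use bd in \<open>force intro!: regular_intros reg\<close>)+
    ultimately show ?thesis using A by (simp add: abs_le_iff algebra_simps)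
  qed
  then show ?thesis by blast
qed

text \<open>
  Curves \<open>P t = v + t w + t\<^sup>2 R t\<close> whose remainder \<open>R t\<close> stays in the span of finitely many fixed
  functions with bounded coefficients.  Such a curve has
  velocity \<open>w\<close> at \<open>0\<close>, and bounded coefficients are what the solution of the constraint provides.
\<close>

definition quadratic_curve ::
    "real \<Rightarrow> 'i set \<Rightarrow> ('i \<Rightarrow> real^2 \<Rightarrow> real^2) \<Rightarrow> (real^2 \<Rightarrow> real^2) \<Rightarrow> (real^2 \<Rightarrow> real^2) \<Rightarrow>
      (real \<Rightarrow> real^2 \<Rightarrow> real^2) \<Rightarrow> bool" where
  "quadratic_curve \<epsilon> I e v w P \<longleftrightarrow> v \<in> Wvec \<and> w \<in> Wvec \<and> finite I \<and> (\<forall>i\<in>I. e i \<in> Wvec) \<and>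
     (\<exists>s M. \<forall>t. \<bar>t\<bar> < \<epsilon> \<longrightarrow> (\<forall>i\<in>I. \<bar>s t i\<bar> \<le> M) \<and>
        P t = (\<lambda>x. (v x + t *\<^sub>R w x) + t\<^sup>2 *\<^sub>R (\<Sum>i\<in>I. s t i *\<^sub>R e i x)))"

lemma quadratic_curve_mem:
  assumes "quadratic_curve \<epsilon> I e v w P" "\<bar>t\<bar> < \<epsilon>" shows "P t \<in> Wvec"
proof -
  obtain s where s: "P t = (\<lambda>x. 1 *\<^sub>R (1 *\<^sub>R v x + t *\<^sub>R w x) + t\<^sup>2 *\<^sub>R (\<Sum>i\<in>I. s t i *\<^sub>R e i x))"
    using assms by (auto simp: quadratic_curve_def)
  show ?thesis
    unfolding s using assms(1) unfolding quadratic_curve_def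
    by (intro lin_spaceD[OF lin_space_Wvec] lin_space_sum[OF lin_space_Wvec]) auto
qed

text \<open>
  Linear maps see only the finitely many values on the functions \<open>e i\<close>, so any of them expands along
  the curve with a remainder of order \<open>t\<^sup>2\<close>.
\<close>

lemma quadratic_curve_lin_map:
  assumes P: "quadratic_curve \<epsilon> I e v w P"
  shows "\<exists>s M. \<forall>t. \<bar>t\<bar> < \<epsilon> \<longrightarrow> (\<forall>i\<in>I. \<bar>s t i\<bar> \<le> M) \<and> (\<forall>L::(real^2 \<Rightarrow> real^2) \<Rightarrow> 'c::real_normed_vector.
      lin_map Wvec L \<longrightarrow> L (P t) - L v - t *\<^sub>R L w = t\<^sup>2 *\<^sub>R (\<Sum>i\<in>I. s t i *\<^sub>R L (e i)))"
proof -
  have vw: "v \<in> Wvec" "w \<in> Wvec" and I: "finite I" and e: "\<And>i. i \<in> I \<Longrightarrow> e i \<in> Wvec"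
    using P by (auto simp: quadratic_curve_def)
  obtain s M where s: "\<And>t i. \<bar>t\<bar> < \<epsilon> \<Longrightarrow> i \<in> I \<Longrightarrow> \<bar>s t i\<bar> \<le> M"
    "\<And>t. \<bar>t\<bar> < \<epsilon> \<Longrightarrow> P t = (\<lambda>x. 1 *\<^sub>R (1 *\<^sub>R v x + t *\<^sub>R w x) + t\<^sup>2 *\<^sub>R (\<Sum>i\<in>I. s t i *\<^sub>R e i x))"
  proof -
    obtain s M where "\<forall>t. \<bar>t\<bar> < \<epsilon> \<longrightarrow> (\<forall>i\<in>I. \<bar>s t i\<bar> \<le> M) \<and>
        P t = (\<lambda>x. (v x + t *\<^sub>R w x) + t\<^sup>2 *\<^sub>R (\<Sum>i\<in>I. s t i *\<^sub>R e i x))"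
      using P unfolding quadratic_curve_def by blast
    then show ?thesis by (intro that[of s M]) simp_all
  qed
  have "L (P t) - L v - t *\<^sub>R L w = t\<^sup>2 *\<^sub>R (\<Sum>i\<in>I. s t i *\<^sub>R L (e i))"
    if t: "\<bar>t\<bar> < \<epsilon>" and L: "lin_map Wvec L" for t and L :: "(real^2 \<Rightarrow> real^2) \<Rightarrow> 'c"
  proof -
    have 1: "(\<lambda>x. 1 *\<^sub>R v x + t *\<^sub>R w x) \<in> Wvec" by (intro lin_spaceD[OF lin_space_Wvec] vw)
    have 2: "(\<lambda>x. \<Sum>i\<in>I. s t i *\<^sub>R e i x) \<in> Wvec" by (intro lin_space_sum[OF lin_space_Wvec] I e)
    have "L (P t) = 1 *\<^sub>R (1 *\<^sub>R L v + t *\<^sub>R L w) + t\<^sup>2 *\<^sub>R (\<Sum>i\<in>I. s t i *\<^sub>R L (e i))"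
      unfolding s(2)[OF t] lin_mapD[OF L 1 2] lin_mapD[OF L vw]
      by (subst lin_map_sum[OF lin_space_Wvec L I e]) auto
    then show ?thesis by simp
  qed
  then show ?thesis using s(1) by blast
qed

text \<open>
  Applied to point values and to gradients at points, this gives expansions that are uniform in the
  point; applied to a single load functional, it gives the derivative of the load.
\<close>

lemma quadratic_curve_remainder:
  fixes L :: "'x \<Rightarrow> (real^2 \<Rightarrow> real^2) \<Rightarrow> 'c::real_normed_vector"
  assumes P: "quadratic_curve \<epsilon> I e v w P" and L: "\<And>x. x \<in> X \<Longrightarrow> lin_map Wvec (L x)"
    and bd: "\<And>i. i \<in> I \<Longrightarrow> \<exists>B. \<forall>x\<in>X. norm (L x (e i)) \<le> B"
  shows "\<exists>C. \<forall>t x. \<bar>t\<bar> < \<epsilon> \<longrightarrow> x \<in> X \<longrightarrow> norm (L x (P t) - L x v - t *\<^sub>R L x w) \<le> C * t\<^sup>2"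
proof -
  obtain s M where s: "\<And>t i. \<bar>t\<bar> < \<epsilon> \<Longrightarrow> i \<in> I \<Longrightarrow> \<bar>s t i\<bar> \<le> M"
    "\<And>t L. \<bar>t\<bar> < \<epsilon> \<Longrightarrow> lin_map Wvec L \<Longrightarrow> L (P t) - L v - t *\<^sub>R L w = t\<^sup>2 *\<^sub>R (\<Sum>i\<in>I. s t i *\<^sub>R (L (e i) :: 'c))"
    using quadratic_curve_lin_map[OF P, where 'c='c] by blast
  obtain B where B: "\<And>i x. i \<in> I \<Longrightarrow> x \<in> X \<Longrightarrow> norm (L x (e i)) \<le> B i" using bd by metis
  have "norm (L x (P t) - L x v - t *\<^sub>R L x w) \<le> (\<Sum>i\<in>I. \<bar>M\<bar> * B i) * t\<^sup>2" if t: "\<bar>t\<bar> < \<epsilon>" and x: "x \<in> X" for t x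
  proof -
    have "norm (s t i *\<^sub>R L x (e i)) \<le> \<bar>M\<bar> * B i" if i: "i \<in> I" for i
      using s(1)[OF t i] B[OF i x] by (simp, intro mult_mono) auto
    then have "norm (\<Sum>i\<in>I. s t i *\<^sub>R L x (e i)) \<le> (\<Sum>i\<in>I. \<bar>M\<bar> * B i)" by (rule sum_norm_le)
    then have "t\<^sup>2 * norm (\<Sum>i\<in>I. s t i *\<^sub>R L x (e i)) \<le> t\<^sup>2 * (\<Sum>i\<in>I. \<bar>M\<bar> * B i)"
      by (intro mult_left_mono) auto
    then show ?thesis unfolding s(2)[OF t L[OF x]] by (simp add: mult.commute)
  qed
  then show ?thesis by blast
qed

lemma quadratic_curve_expansion:
  assumes P: "quadratic_curve \<epsilon> I e v w P" shows "expansion \<epsilon> P v w"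
proof -
  have "\<exists>C. \<forall>t x. \<bar>t\<bar> < \<epsilon> \<longrightarrow> x \<in> cells \<longrightarrow> norm (P t x - v x - t *\<^sub>R w x) \<le> C * t\<^sup>2"
  proof (rule quadratic_curve_remainder[OF P])
    show "lin_map Wvec (\<lambda>v. v x)" for x by (simp add: lin_map_def)
    show "\<exists>B. \<forall>x\<in>cells. norm (e i x) \<le> B" if "i \<in> I" for i
      using P regular_Wh[of "e i"] that by (auto simp: quadratic_curve_def regular_def bounded_iff)
  qed
  then show ?thesis using P regular_Wh quadratic_curve_mem[OF P] by (auto simp: expansion_def quadratic_curve_def)
qed

lemma quadratic_curve_grad_expansion:
  assumes P: "quadratic_curve \<epsilon> I e v w P" shows "expansion \<epsilon> (\<lambda>t. grad (P t)) (grad v) (grad w)"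
proof -
  have "\<exists>C. \<forall>t x. \<bar>t\<bar> < \<epsilon> \<longrightarrow> x \<in> cells \<longrightarrow> norm (grad (P t) x - grad v x - t *\<^sub>R grad w x) \<le> C * t\<^sup>2"
  proof (rule quadratic_curve_remainder[OF P])
    show "lin_map Wvec (\<lambda>v. grad v x)" if "x \<in> cells" for x using grad_lincomb that by (simp add: lin_map_def)
    show "\<exists>B. \<forall>x\<in>cells. norm (grad (e i) x) \<le> B" if "i \<in> I" for i
      using P regular_grad[of "e i"] that by (auto simp: quadratic_curve_def regular_def bounded_iff)
  qed
  then show ?thesis using P regular_grad quadratic_curve_mem[OF P] by (auto simp: expansion_def quadratic_curve_def)
qed

lemma quadratic_curve_differentiable:
  assumes P: "quadratic_curve \<epsilon> I e v w P" and "\<epsilon> > 0"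
  shows "(\<lambda>t. P t x) differentiable (at 0)"
proof -
  obtain C where C: "\<And>t i. \<bar>t\<bar> < \<epsilon> \<Longrightarrow> \<bar>P t x $ i - v x $ i - t * w x $ i\<bar> \<le> C * t\<^sup>2"
  proof -
    have "\<exists>C. \<forall>t i. \<bar>t\<bar> < \<epsilon> \<longrightarrow> i \<in> UNIV \<longrightarrow> norm (P t x $ i - v x $ i - t *\<^sub>R w x $ i) \<le> C * t\<^sup>2"
    proof (rule quadratic_curve_remainder[OF P, of UNIV "\<lambda>i v. v x $ i"])
      show "\<exists>B. \<forall>k\<in>UNIV. norm (e i x $ k) \<le> B" for i
        by (rule exI[of _ "norm (e i x)"]) (simp add: component_le_norm_cart)
    qed (simp add: lin_map_def)
    then show ?thesis using that by auto
  qed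
  have "((\<lambda>t. P t x $ i) has_real_derivative w x $ i) (at 0)" for i
    by (rule has_real_derivative_of_quadratic_remainder[OF assms(2)]) (rule C)
  then have "((\<lambda>t. P t x $ i) has_derivative (\<lambda>t. t * w x $ i)) (at 0)" for i
    by (simp add: has_field_derivative_def mult.commute[of _ "w x $ i"])
  then have "((\<lambda>t. P t x) has_derivative (\<lambda>t. t *\<^sub>R w x)) (at 0)"
    by (subst has_derivative_componentwise_within) (auto simp: Basis_vec_def inner_axis)
  then show ?thesis by (rule differentiableI)
qed

end

text \<open>
  The derivative of the energy in the displacement; without the pressure term it is the left-hand side
  of the momentum equation.
\<close>

definition momentum_residual :: "(real^2) set \<Rightarrow> (real^2) set set \<Rightarrow> (real^2) set \<Rightarrow> real \<Rightarrow>
    (real^2 \<Rightarrow> real^2) \<Rightarrow> (real^2 \<Rightarrow> real^2) \<Rightarrow> (real^2 \<Rightarrow> real^2) \<Rightarrow> (real^2 \<Rightarrow> real^2) \<Rightarrow> (real^2 \<Rightarrow> real^2) \<Rightarrow> real" where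
  "momentum_residual \<Omega> \<T> \<Gamma>2 a f g u n v =
     (LINT x:\<Omega>|lebesgue. 2 * (def_grad u x \<bullet> grad v x
        - (1 - a) * ((transpose (def_grad u x) *v n x) \<bullet> (transpose (grad v x) *v n x))))
     - (LINT x:\<Omega>|lebesgue. f x \<bullet> v x)
     - boundary_integral \<Omega> \<T> \<Gamma>2 (\<lambda>x. g x \<bullet> v x)"

text \<open>
  The derivative of the energy in the director.
\<close>

definition director_residual :: "(real^2) set \<Rightarrow> real \<Rightarrow> real \<Rightarrow>
    (real^2 \<Rightarrow> real^2) \<Rightarrow> (real^2 \<Rightarrow> real^2) \<Rightarrow> (real^2 \<Rightarrow> real^2) \<Rightarrow> real" where
  "director_residual \<Omega> a b u n m =
     (LINT x:\<Omega>|lebesgue.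
        - 2 * (1 - a) * ((transpose (def_grad u x) *v n x) \<bullet> (transpose (def_grad u x) *v m x))
        + 2 * b * (grad m x \<bullet> grad n x))"

context fe_mesh
begin

text \<open>
  The energy density is a polynomial in the deformation gradient, the director and its gradient, so it
  expands by the product rule; the load terms are linear.
\<close>

lemma energy_derivative:
  assumes \<epsilon>: "0 < \<epsilon>" "\<epsilon> \<le> 1" and f: "set_integrable lebesgue \<Omega> f" and g: "boundary_integrable \<Omega> \<T> \<Gamma>2 g"
    and U: "quadratic_curve \<epsilon> I e u v U" and V: "quadratic_curve \<epsilon> J e' n m V"
  shows "((\<lambda>t. energy \<Omega> \<T> \<Gamma>2 a b f g (U t) (V t)) has_real_derivative
           momentum_residual \<Omega> \<T> \<Gamma>2 a f g u n v + director_residual \<Omega> a b u n m) (at 0)"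
proof -
  have mem: "u \<in> Wvec" "v \<in> Wvec" "n \<in> Wvec" "m \<in> Wvec" using U V by (auto simp: quadratic_curve_def)
  note inner = expansion_bilinear[OF bounded_bilinear_inner _ _ \<epsilon>(2)]
  note transp = expansion_bilinear[OF bounded_bilinear_transpose_mult _ _ \<epsilon>(2)]
  have F: "expansion \<epsilon> (\<lambda>t. def_grad (U t)) (def_grad u) (grad v)"
    using expansion_add[OF expansion_const[OF regular_const[of "mat 1"]] quadratic_curve_grad_expansion[OF U]]
    by (simp add: def_grad_def[abs_def])
  note N = quadratic_curve_expansion[OF V] and G = quadratic_curve_grad_expansion[OF V]
  note exps = expansion_add[OF expansion_add[OF inner[OF F F]
        expansion_cmult[OF inner[OF transp[OF F N] transp[OF F N]], of "- (1 - a)"]]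
      expansion_cmult[OF inner[OF G G], of b]]
  obtain C where C: "\<And>t. \<bar>t\<bar> < \<epsilon> \<Longrightarrow> \<bar>(LINT x:\<Omega>|lebesgue. def_grad (U t) x \<bullet> def_grad (U t) x
         + - (1 - a) * ((transpose (def_grad (U t) x) *v V t x) \<bullet> (transpose (def_grad (U t) x) *v V t x))
         + b * (grad (V t) x \<bullet> grad (V t) x))
      - (LINT x:\<Omega>|lebesgue. def_grad u x \<bullet> def_grad u x
         + - (1 - a) * ((transpose (def_grad u x) *v n x) \<bullet> (transpose (def_grad u x) *v n x))
         + b * (grad n x \<bullet> grad n x))
      - t * (LINT x:\<Omega>|lebesgue. (def_grad u x \<bullet> grad v x + grad v x \<bullet> def_grad u x)
         + - (1 - a) * ((transpose (def_grad u x) *v n x) \<bullet> (transpose (def_grad u x) *v m x + transpose (grad v x) *v n x)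
             + (transpose (def_grad u x) *v m x + transpose (grad v x) *v n x) \<bullet> (transpose (def_grad u x) *v n x))
         + b * (grad n x \<bullet> grad m x + grad m x \<bullet> grad n x))\<bar> \<le> C * t\<^sup>2"
    using expansion_integral[OF exps] by blast
  let ?D = "(LINT x:\<Omega>|lebesgue. 2 * (def_grad u x \<bullet> grad v x
        - (1 - a) * ((transpose (def_grad u x) *v n x) \<bullet> (transpose (grad v x) *v n x)))) + director_residual \<Omega> a b u n m"
  let ?E = "\<lambda>t. LINT x:\<Omega>|lebesgue. (norm (def_grad (U t) x))\<^sup>2
        - (1 - a) * (norm (transpose (def_grad (U t) x) *v V t x))\<^sup>2 + b * (norm (grad (V t) x))\<^sup>2"
  have D: "(LINT x:\<Omega>|lebesgue. (def_grad u x \<bullet> grad v x + grad v x \<bullet> def_grad u x)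
         + - (1 - a) * ((transpose (def_grad u x) *v n x) \<bullet> (transpose (def_grad u x) *v m x + transpose (grad v x) *v n x)
             + (transpose (def_grad u x) *v m x + transpose (grad v x) *v n x) \<bullet> (transpose (def_grad u x) *v n x))
         + b * (grad n x \<bullet> grad m x + grad m x \<bullet> grad n x)) = ?D"
  proof -
    have "(LINT x:\<Omega>|lebesgue. 1 * (2 * (def_grad u x \<bullet> grad v x
        - (1 - a) * ((transpose (def_grad u x) *v n x) \<bullet> (transpose (grad v x) *v n x))))
        + 1 * (- 2 * (1 - a) * ((transpose (def_grad u x) *v n x) \<bullet> (transpose (def_grad u x) *v m x))
        + 2 * b * (grad m x \<bullet> grad n x))) = 1 * (LINT x:\<Omega>|lebesgue. 2 * (def_grad u x \<bullet> grad v x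
        - (1 - a) * ((transpose (def_grad u x) *v n x) \<bullet> (transpose (grad v x) *v n x)))) + 1 * director_residual \<Omega> a b u n m"
      unfolding director_residual_def
      by (intro integral_lincomb regular_integrable regular_intros regular_def_grad regular_grad regular_Wh mem)
    then show ?thesis
      by (simp add: inner_add_left inner_add_right inner_commute algebra_simps)
  qed
  have dens: "(norm (def_grad (U t) x))\<^sup>2 - (1 - a) * (norm (transpose (def_grad (U t) x) *v V t x))\<^sup>2
        + b * (norm (grad (V t) x))\<^sup>2
      = def_grad (U t) x \<bullet> def_grad (U t) x
         + - (1 - a) * ((transpose (def_grad (U t) x) *v V t x) \<bullet> (transpose (def_grad (U t) x) *v V t x))
         + b * (grad (V t) x \<bullet> grad (V t) x)" for t x
    unfolding power2_norm_eq_inner by (simp only: minus_mult_left[symmetric] diff_conv_add_uminus)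
  have E: "(?E has_real_derivative ?D) (at 0)"
    unfolding dens by (rule has_real_derivative_of_quadratic_remainder[OF \<epsilon>(1)]) (rule C[unfolded D])
  have lin: "((\<lambda>t. L (U t)) has_real_derivative L v) (at 0)" if L: "lin_map Wvec L" for L
  proof -
    have "\<exists>C. \<forall>t x. \<bar>t\<bar> < \<epsilon> \<longrightarrow> x \<in> {()} \<longrightarrow> norm (L (U t) - L u - t *\<^sub>R L v) \<le> C * t\<^sup>2"
      by (rule quadratic_curve_remainder[OF U, of "{()}" "\<lambda>_. L"]) (use L in auto)
    then obtain C where "\<And>t. \<bar>t\<bar> < \<epsilon> \<Longrightarrow> \<bar>L (U t) - L u - t * L v\<bar> \<le> C * t\<^sup>2" by auto
    then show ?thesis by (rule has_real_derivative_of_quadratic_remainder[OF \<epsilon>(1)])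
  qed
  show ?thesis
    unfolding energy_def momentum_residual_def
    using DERIV_diff[OF DERIV_diff[OF E lin[OF lin_map_load[OF f]]] lin[OF lin_map_traction[OF g]]]
    by (simp add: algebra_simps)
qed

end

section \<open>Multipliers with prescribed nodes\<close>

lemma lin_map_subset: "lin_map S L \<Longrightarrow> S' \<subseteq> S \<Longrightarrow> lin_map S' L"
  unfolding lin_map_def by blast

text \<open>
  If \<open>B q\<close> vanished on all of \<open>V\<close>, the supremum would be at most \<open>0\<close>.  This holds for any
  normalisation \<open>N\<close>, also where \<open>N q v = 0\<close>, since division by zero yields \<open>0\<close>.
\<close>

lemma ex_nonzero_of_inf_sup:
  fixes B :: "'q \<Rightarrow> 'v \<Rightarrow> real"
  assumes "\<beta> > 0" and "ereal \<beta> \<le> (INF q\<in>Q. SUP v\<in>V. ereal (B q v / N q v))" and "q \<in> Q"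
  shows "\<exists>v\<in>V. B q v \<noteq> 0"
proof (rule ccontr)
  assume "\<not> ?thesis"
  then have "(SUP v\<in>V. ereal (B q v / N q v)) \<le> 0" by (intro SUP_least) simp
  moreover have "ereal \<beta> \<le> (SUP v\<in>V. ereal (B q v / N q v))"
    using assms(2,3) by (meson INF_lower order_trans)
  ultimately have "ereal \<beta> \<le> 0" by (rule order_trans[rotated])
  then show False using assms(1) by simp
qed

context fe_mesh
begin

abbreviation "Vvec \<equiv> vec_space (Vh \<T>)"

lemma Vvec_subset_Wvec: "Vvec \<subseteq> Wvec"
  using Vh_subset_Wh by (auto simp: vec_space_def)

lemma lin_space_Vvec: "lin_space Vvec"
  by (intro lin_space_vec lin_space_Vh)

text \<open>
  The functions of \<open>V\<^sub>h\<close> with nodal values supported in \<open>Z\<close>.  Both multiplier spaces have this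
  form: \<open>V\<^sub>h\<close> with all nodes, and the functions vanishing on a boundary part with the nodes off
  that part.
\<close>

definition nodal_space :: "(real^2) set \<Rightarrow> (real^2 \<Rightarrow> real) set" where
  "nodal_space Z = {q \<in> Vh \<T>. \<forall>z\<in>nodes \<T> - Z. q z = 0}"

lemma lin_space_nodal: "lin_space (nodal_space Z)"
  using lin_space_zero[OF lin_space_Vh] lin_spaceD[OF lin_space_Vh] by (auto simp: lin_space_def nodal_space_def)

lemma hat_nodal: "z \<in> Z \<Longrightarrow> hat z \<in> nodal_space Z"
  by (auto simp: nodal_space_def hat_Vh hat_node)

lemma nodal_expansion:
  assumes Z: "Z \<subseteq> nodes \<T>" and q: "q \<in> nodal_space Z"
  shows "q = (\<lambda>x. \<Sum>z\<in>Z. q z *\<^sub>R hat z x)"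
proof -
  have "q = (\<lambda>x. \<Sum>z\<in>nodes \<T>. q z *\<^sub>R hat z x)" using q by (intro Vh_nodal_expansion) (simp add: nodal_space_def)
  also have "\<dots> = (\<lambda>x. \<Sum>z\<in>Z. q z *\<^sub>R hat z x)"
    using q Z by (intro ext sum.mono_neutral_right finite_nodes) (auto simp: nodal_space_def)
  finally show ?thesis .
qed

lemma Vh_eq_nodal: "Vh \<T> = nodal_space (nodes \<T>)"
  by (auto simp: nodal_space_def)

lemma Vh_bc_eq_nodal:
  assumes "boundary_part \<Omega> \<T> \<Gamma>"
  shows "with_bc (Vh \<T>) (\<lambda>_. 0) \<Gamma> = nodal_space (nodes \<T> - \<Gamma>)"
  using Vh_zero_on_boundary_part[OF assms] by (auto simp: nodal_space_def with_bc_def)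

text \<open>
  Nondegeneracy makes the forms \<open>B (hat z)\<close> linearly independent: a combination of them is
  \<open>B q\<close> for the function \<open>q\<close> with the coefficients as nodal values.
\<close>

lemma nodal_dual_vectors:
  fixes B :: "(real^2 \<Rightarrow> real) \<Rightarrow> ('x \<Rightarrow> 'b::real_vector) \<Rightarrow> real"
  assumes S: "lin_space S" and Z: "Z \<subseteq> nodes \<T>"
    and B: "\<And>q. q \<in> nodal_space Z \<Longrightarrow> lin_map S (B q)"
    and B': "\<And>v. v \<in> S \<Longrightarrow> lin_map (nodal_space Z) (\<lambda>q. B q v)"
    and nondeg: "\<And>q. q \<in> nodal_space Z \<Longrightarrow> q \<noteq> (\<lambda>_. 0) \<Longrightarrow> \<exists>v\<in>S. B q v \<noteq> 0"
  shows "\<exists>e. \<forall>z\<in>Z. e z \<in> S \<and> (\<forall>y\<in>Z. B (hat y) (e z) = (if z = y then 1 else 0))"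
proof (rule dual_vectors[OF S finite_subset[OF Z finite_nodes]])
  show "lin_map S (B (hat z))" if "z \<in> Z" for z by (intro B hat_nodal that)
  fix c assume c: "\<forall>v\<in>S. (\<Sum>z\<in>Z. c z * B (hat z) v) = 0"
  have fin: "finite Z" using Z finite_nodes finite_subset by blast
  define q where "q = (\<lambda>x. \<Sum>z\<in>Z. c z *\<^sub>R hat z x)"
  have q: "q \<in> nodal_space Z" unfolding q_def by (intro lin_space_sum lin_space_nodal fin hat_nodal)
  have "B q v = 0" if v: "v \<in> S" for v
    using lin_map_sum[OF lin_space_nodal B'[OF v] fin, of hat c] hat_nodal c v by (simp add: q_def)
  then have "q = (\<lambda>_. 0)" using nondeg[OF q] by blast
  then have q0: "q z = 0" for z by simp
  show "\<forall>z\<in>Z. c z = 0"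
  proof
    fix z assume z: "z \<in> Z"
    have "q z = (\<Sum>y\<in>Z. if z = y then c y else 0)"
      unfolding q_def using z Z by (intro sum.cong) (auto simp: hat_node)
    then show "c z = 0" using q0[of z] z fin by simp
  qed
qed

text \<open>
  The closed range theorem in finite dimensions: a form annihilating the kernel of the constraints is
  represented by a multiplier.
\<close>

lemma nodal_multiplier:
  fixes B :: "(real^2 \<Rightarrow> real) \<Rightarrow> ('x \<Rightarrow> 'b::real_vector) \<Rightarrow> real"
  assumes S: "lin_space S" and Z: "Z \<subseteq> nodes \<T>"
    and B: "\<And>q. q \<in> nodal_space Z \<Longrightarrow> lin_map S (B q)"
    and B': "\<And>v. v \<in> S \<Longrightarrow> lin_map (nodal_space Z) (\<lambda>q. B q v)"
    and nondeg: "\<And>q. q \<in> nodal_space Z \<Longrightarrow> q \<noteq> (\<lambda>_. 0) \<Longrightarrow> \<exists>v\<in>S. B q v \<noteq> 0"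
    and M: "lin_map S M" and ker: "\<And>v. v \<in> S \<Longrightarrow> \<forall>q\<in>nodal_space Z. B q v = 0 \<Longrightarrow> M v = 0"
  shows "\<exists>p\<in>nodal_space Z. \<forall>v\<in>S. B p v = M v"
proof -
  have fin: "finite Z" using Z finite_nodes finite_subset by blast
  obtain e where e: "\<And>z. z \<in> Z \<Longrightarrow> e z \<in> S"
    "\<And>z y. z \<in> Z \<Longrightarrow> y \<in> Z \<Longrightarrow> B (hat y) (e z) = (if z = y then 1 else 0)"
    using nodal_dual_vectors[OF S Z B B' nondeg] by blast
  define p where "p = (\<lambda>x. \<Sum>z\<in>Z. M (e z) *\<^sub>R hat z x)"
  have "p \<in> nodal_space Z" unfolding p_def by (intro lin_space_sum lin_space_nodal fin hat_nodal)
  moreover have "B p v = M v" if v: "v \<in> S" for v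
  proof -
    have "B p v = (\<Sum>z\<in>Z. M (e z) * B (hat z) v)"
      unfolding p_def using lin_map_sum[OF lin_space_nodal B'[OF v] fin, of hat] hat_nodal by simp
    also have "\<dots> = M v"
    proof (rule multiplier_of_dual_vectors[OF S fin, symmetric])
      fix v assume v: "v \<in> S" and 0: "\<And>z. z \<in> Z \<Longrightarrow> B (hat z) v = 0"
      have "B q v = 0" if q: "q \<in> nodal_space Z" for q
        by (subst nodal_expansion[OF Z q], subst lin_map_sum[OF lin_space_nodal B'[OF v] fin])
          (use 0 hat_nodal in auto)
      then show "M v = 0" using ker v by blast
    qed (use B hat_nodal e M v in auto)
    finally show ?thesis .
  qed
  ultimately show ?thesis by blast
qed

section \<open>The bilinear forms and the constraint\<close>

lemma lin_map_b1:
  assumes u: "u \<in> Wvec" and q: "q \<in> Vh \<T>" shows "lin_map Wvec (b1 \<Omega> u q)"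
  unfolding b1_def[abs_def]
  by (rule lin_map_integral[OF lin_space_Wvec])
    (intro regular_intros regular_Vh[OF q] regular_def_grad[OF u] regular_grad,
      simp_all add: grad_lincomb inner_add_right algebra_simps)

lemma lin_map_b1_multiplier:
  assumes u: "u \<in> Wvec" and v: "v \<in> Wvec" shows "lin_map (Vh \<T>) (\<lambda>q. b1 \<Omega> u q v)"
  unfolding b1_def[abs_def]
  by (rule lin_map_integral[OF lin_space_Vh])
    (intro regular_intros regular_def_grad[OF u] regular_grad[OF v] regular_Vh, simp_all add: algebra_simps)

lemma Vvec_comp: "v \<in> Vvec \<Longrightarrow> (\<lambda>x. v x $ i) \<in> Vh \<T>"
  by (auto simp: vec_space_def)

lemma interp_lincomb:
  "interp \<T> (\<lambda>y. c * \<phi> y + d * \<psi> y) x = c * interp \<T> \<phi> x + d * interp \<T> \<psi> x"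
proof -
  have "interp \<T> (\<lambda>y. c * \<phi> y + d * \<psi> y) = (\<lambda>x. c *\<^sub>R interp \<T> \<phi> x + d *\<^sub>R interp \<T> \<psi> x)"
    by (rule interp_eqI, intro lin_spaceD[OF lin_space_Vh] interp_Vh) (simp add: interp_node)
  then show ?thesis by simp
qed

lemma lin_map_b2:
  assumes q: "q \<in> Vh \<T>" shows "lin_map Vvec (b2 \<Omega> \<T> n q)"
  unfolding b2_def[abs_def]
  by (rule lin_map_integral[OF lin_space_Vvec])
    (intro regular_intros regular_Vh[OF q] regular_Vh[OF interp_Vh],
      simp_all add: interp_lincomb inner_add_right algebra_simps)

lemma lin_map_b2_multiplier: "lin_map (Vh \<T>) (\<lambda>q. b2 \<Omega> \<T> n q m)"
  unfolding b2_def[abs_def]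
  by (rule lin_map_integral[OF lin_space_Vh])
    (intro regular_intros regular_Vh[OF interp_Vh] regular_Vh, simp_all add: algebra_simps)

lemma lin_map_momentum:
  assumes u: "u \<in> Wvec" and n: "n \<in> Wvec" and f: "set_integrable lebesgue \<Omega> f"
    and g: "boundary_integrable \<Omega> \<T> \<Gamma>2 g"
  shows "lin_map Wvec (momentum_residual \<Omega> \<T> \<Gamma>2 a f g u n)"
proof -
  have tr: "transpose (c *\<^sub>R A + d *\<^sub>R B) *v x = c *\<^sub>R (transpose A *v x) + d *\<^sub>R (transpose B *v x)"
    for c d and A B :: "real^2^2" and x
    by (simp only: bounded_bilinear.add_left[OF bounded_bilinear_transpose_mult]
        bounded_bilinear.scaleR_left[OF bounded_bilinear_transpose_mult])
  have "lin_map Wvec (\<lambda>v. LINT x:\<Omega>|lebesgue. 2 * (def_grad u x \<bullet> grad v x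
        - (1 - a) * ((transpose (def_grad u x) *v n x) \<bullet> (transpose (grad v x) *v n x))))"
    by (rule lin_map_integral[OF lin_space_Wvec])
      (intro regular_intros regular_def_grad[OF u] regular_grad regular_Wh[OF n],
        simp_all add: grad_lincomb tr inner_add_right algebra_simps del: transpose_matrix_vector)
  then show ?thesis
    using lin_map_load[OF f] lin_map_traction[OF g]
    by (simp add: lin_map_def momentum_residual_def algebra_simps)
qed

lemma lin_map_director:
  assumes u: "u \<in> Wvec" and n: "n \<in> Wvec"
  shows "lin_map Wvec (director_residual \<Omega> a b u n)"
  unfolding director_residual_def[abs_def]
  by (rule lin_map_integral[OF lin_space_Wvec])
    (intro regular_intros regular_def_grad[OF u] regular_grad regular_Wh[OF n] regular_Wh n,
      simp_all add: grad_lincomb matrix_vector_right_distrib inner_add_right inner_add_left algebra_simps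
        matrix_vector_mult_scaleR del: transpose_matrix_vector)

lemma momentum_equation:
  assumes "u \<in> Wvec" "n \<in> Wvec" "v \<in> Wvec" "p \<in> Vh \<T>"
  shows "(LINT x:\<Omega>|lebesgue.
               2 * (def_grad u x \<bullet> grad v x
                    - (1 - a) * ((transpose (def_grad u x) *v n x) \<bullet> (transpose (grad v x) *v n x)))
               - p x * (det_grad (def_grad u x) \<bullet> grad v x))
            - (LINT x:\<Omega>|lebesgue. f x \<bullet> v x)
            - boundary_integral \<Omega> \<T> \<Gamma>2 (\<lambda>x. g x \<bullet> v x)
         = momentum_residual \<Omega> \<T> \<Gamma>2 a f g u n v + b1 \<Omega> u p v"
proof -
  have "(LINT x:\<Omega>|lebesgue.
               1 * (2 * (def_grad u x \<bullet> grad v x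
                    - (1 - a) * ((transpose (def_grad u x) *v n x) \<bullet> (transpose (grad v x) *v n x))))
               + 1 * (- p x * (det_grad (def_grad u x) \<bullet> grad v x)))
     = 1 * (LINT x:\<Omega>|lebesgue. 2 * (def_grad u x \<bullet> grad v x
                    - (1 - a) * ((transpose (def_grad u x) *v n x) \<bullet> (transpose (grad v x) *v n x)))) + 1 * b1 \<Omega> u p v"
    unfolding b1_def
    by (intro integral_lincomb regular_integrable regular_intros regular_def_grad regular_grad regular_Wh regular_Vh assms)
  then show ?thesis by (simp add: momentum_residual_def)
qed

lemma director_equation:
  assumes "u \<in> Wvec" "n \<in> Wvec" "m \<in> Wvec" "l \<in> Vh \<T>"
  shows "(LINT x:\<Omega>|lebesgue.
               - 2 * (1 - a) * ((transpose (def_grad u x) *v n x) \<bullet> (transpose (def_grad u x) *v m x))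
               + 2 * b * (grad m x \<bullet> grad n x)
               + 2 * l x * interp \<T> (\<lambda>y. n y \<bullet> m y) x)
         = director_residual \<Omega> a b u n m + b2 \<Omega> \<T> n l m"
proof -
  have "(LINT x:\<Omega>|lebesgue.
               1 * (- 2 * (1 - a) * ((transpose (def_grad u x) *v n x) \<bullet> (transpose (def_grad u x) *v m x))
               + 2 * b * (grad m x \<bullet> grad n x))
               + 1 * (2 * l x * interp \<T> (\<lambda>y. n y \<bullet> m y) x))
     = 1 * director_residual \<Omega> a b u n m + 1 * b2 \<Omega> \<T> n l m"
    unfolding director_residual_def b2_def
    by (intro integral_lincomb regular_integrable regular_intros regular_def_grad regular_grad regular_Wh regular_Vh interp_Vh assms)
  then show ?thesis by simp
qed

text \<open>
  The symmetric bilinear form polarising the second-order term of the constraint: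
  \<open>polar q v v\<close> is the integral of \<open>q det (grad v)\<close>.
\<close>

definition polar :: "(real^2 \<Rightarrow> real) \<Rightarrow> (real^2 \<Rightarrow> real^2) \<Rightarrow> (real^2 \<Rightarrow> real^2) \<Rightarrow> real" where
  "polar q v w = (LINT x:\<Omega>|lebesgue. 1/2 * (q x * (det_grad (grad v x) \<bullet> grad w x)))"

lemma lin_map_polar_right: "q \<in> Vh \<T> \<Longrightarrow> v \<in> Wvec \<Longrightarrow> lin_map Wvec (polar q v)"
  unfolding polar_def[abs_def]
  by (rule lin_map_integral[OF lin_space_Wvec])
    (intro regular_intros regular_grad regular_Vh, simp_all add: grad_lincomb inner_add_right algebra_simps)

lemma lin_map_polar_left: "q \<in> Vh \<T> \<Longrightarrow> w \<in> Wvec \<Longrightarrow> lin_map Wvec (\<lambda>v. polar q v w)"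
  unfolding polar_def[abs_def]
  by (rule lin_map_integral[OF lin_space_Wvec])
    (intro regular_intros regular_grad regular_Vh,
      simp_all add: grad_lincomb inner_add_left algebra_simps
        linear_add[OF bounded_linear.linear[OF bounded_linear_det_grad]]
        linear_cmul[OF bounded_linear.linear[OF bounded_linear_det_grad]])

text \<open>
  The Taylor expansion of the quadratic constraint is exact: \<open>- b\<^sub>1\<close> is its derivative.
\<close>

lemma constraint_expansion:
  assumes u: "u \<in> Wvec" and w: "w \<in> Wvec" and q: "q \<in> Vh \<T>"
  shows "(LINT x:\<Omega>|lebesgue. q x * (det (def_grad (\<lambda>y. u y + w y) x) - 1))
    = (LINT x:\<Omega>|lebesgue. q x * (det (def_grad u x) - 1)) - b1 \<Omega> u q w + polar q w w"
proof -
  note reg = regular_intros regular_def_grad[OF u] regular_grad[OF w] regular_Vh[OF q]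
  have "(LINT x:\<Omega>|lebesgue. 1 * (q x * (det (def_grad u x) - 1)) + (-1) * (- q x * (det_grad (def_grad u x) \<bullet> grad w x)))
      = 1 * (LINT x:\<Omega>|lebesgue. q x * (det (def_grad u x) - 1)) + (-1) * b1 \<Omega> u q w"
    unfolding b1_def by (intro integral_lincomb regular_integrable reg)
  moreover have "(LINT x:\<Omega>|lebesgue. 1 * (1 * (q x * (det (def_grad u x) - 1)) + (-1) * (- q x * (det_grad (def_grad u x) \<bullet> grad w x)))
        + 1 * (1/2 * (q x * (det_grad (grad w x) \<bullet> grad w x))))
      = 1 * (LINT x:\<Omega>|lebesgue. 1 * (q x * (det (def_grad u x) - 1)) + (-1) * (- q x * (det_grad (def_grad u x) \<bullet> grad w x)))
        + 1 * polar q w w"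
    unfolding polar_def by (intro integral_lincomb regular_integrable reg)
  moreover have "(LINT x:\<Omega>|lebesgue. 1 * (1 * (q x * (det (def_grad u x) - 1)) + (-1) * (- q x * (det_grad (def_grad u x) \<bullet> grad w x)))
        + 1 * (1/2 * (q x * (det_grad (grad w x) \<bullet> grad w x))))
     = (LINT x:\<Omega>|lebesgue. q x * (det (def_grad (\<lambda>y. u y + w y) x) - 1))"
  proof (rule integral_eq)
    fix x assume x: "x \<in> cells"
    have "def_grad (\<lambda>y. u y + w y) x = def_grad u x + grad w x"
      using grad_lincomb[OF u w x, of 1 1] by (simp add: def_grad_def)
    then have "det (def_grad (\<lambda>y. u y + w y) x) = det (def_grad u x) + det_grad (def_grad u x) \<bullet> grad w x
       + det_grad (grad w x) \<bullet> grad w x / 2"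
      using det_add[of "def_grad u x" "grad w x"] det_eq_half_det_grad[of "grad w x"] by simp
    then show "1 * (1 * (q x * (det (def_grad u x) - 1)) + (-1) * (- q x * (det_grad (def_grad u x) \<bullet> grad w x)))
        + 1 * (1/2 * (q x * (det_grad (grad w x) \<bullet> grad w x))) = q x * (det (def_grad (\<lambda>y. u y + w y) x) - 1)"
      by (simp only:) (simp add: algebra_simps)
  qed (intro reg)
  ultimately show ?thesis by simp
qed

section \<open>Curves in the constraint sets\<close>

lemma Kh_subset: "u0 \<in> Wvec \<Longrightarrow> u \<in> Kh \<Omega> \<T> \<Gamma>0 u0 \<Longrightarrow> u \<in> Wvec"
  using lin_spaceD[OF lin_space_Wvec, of _ u0 1 1] by (auto simp: Kh_def with_bc_def)

lemma Nh_subset: "n0 \<in> Vvec \<Longrightarrow> n \<in> Nh \<Omega> \<T> \<Gamma>1 n0 \<Longrightarrow> n \<in> Vvec"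
  using lin_spaceD[OF lin_space_Vvec, of _ n0 1 1] by (auto simp: Nh_def with_bc_def)

lemma quadratic_curve_const: "v \<in> Wvec \<Longrightarrow> quadratic_curve \<epsilon> {} e v (\<lambda>_. 0) (\<lambda>_. v)"
  using lin_space_zero[OF lin_space_Wvec] by (simp add: quadratic_curve_def)

text \<open>
  The tangent vector \<open>v\<close> is corrected at order \<open>t\<^sup>2\<close> along the dual vectors \<open>e z\<close> of the forms
  \<open>b\<^sub>1(hat z, \<sqdot>)\<close>.  Testing the constraint with \<open>hat z\<close> then gives
  \<open>- t\<^sup>2 s\<^sub>z + polar (hat z) (Y t) (Y t) = 0\<close> for \<open>Y t = t v + t\<^sup>2 (\<Sum>\<^sub>z s\<^sub>z e\<^sub>z)\<close>.
\<close>

lemma Kh_curve: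
  assumes u0: "u0 \<in> Wvec" and u: "u \<in> Kh \<Omega> \<T> \<Gamma>0 u0"
    and nondeg: "\<And>q. q \<in> Vh \<T> \<Longrightarrow> q \<noteq> (\<lambda>_. 0) \<Longrightarrow> \<exists>v\<in>with_bc Wvec (\<lambda>_. 0) \<Gamma>0. b1 \<Omega> u q v \<noteq> 0"
    and v: "v \<in> with_bc Wvec (\<lambda>_. 0) \<Gamma>0" and ker: "\<And>q. q \<in> Vh \<T> \<Longrightarrow> b1 \<Omega> u q v = 0"
  shows "\<exists>\<epsilon> e U. 0 < \<epsilon> \<and> \<epsilon> \<le> 1 \<and> quadratic_curve \<epsilon> (nodes \<T>) e u v U \<and> U 0 = u \<and> (\<forall>t. U t \<in> Kh \<Omega> \<T> \<Gamma>0 u0)"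
proof -
  let ?Z = "nodes \<T>" and ?S = "with_bc Wvec (\<lambda>_. 0) \<Gamma>0"
  have S: "lin_space ?S" by (intro lin_space_with_bc lin_space_Wvec)
  have SW: "?S \<subseteq> Wvec" by (auto simp: with_bc_def)
  have uW: "u \<in> Wvec" using Kh_subset[OF u0 u] .
  have "\<exists>e. \<forall>z\<in>?Z. e z \<in> ?S \<and> (\<forall>y\<in>?Z. b1 \<Omega> u (hat y) (e z) = (if z = y then 1 else 0))"
    using SW by (intro nodal_dual_vectors S order_refl)
      (auto simp: Vh_eq_nodal[symmetric] intro!: lin_map_subset[OF lin_map_b1[OF uW]] lin_map_b1_multiplier[OF uW] nondeg)
  then obtain e where e: "\<And>z. z \<in> ?Z \<Longrightarrow> e z \<in> ?S"
    "\<And>z y. z \<in> ?Z \<Longrightarrow> y \<in> ?Z \<Longrightarrow> b1 \<Omega> u (hat y) (e z) = (if z = y then 1 else 0)" by blast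
  have eW: "\<And>z. z \<in> ?Z \<Longrightarrow> e z \<in> Wvec" using e SW by blast
  \<comment> \<open>The coefficients of \<open>polar (hat z) (Y t) (Y t) / t\<^sup>2\<close> as a polynomial in \<open>t\<close> and \<open>s\<close>.\<close>
  define A where "A z = polar (hat z) v v" for z
  define B where "B z y = polar (hat z) v (e y) + polar (hat z) (e y) v" for z y
  define C where "C z y k = polar (hat z) (e y) (e k)" for z y k
  obtain \<epsilon>0 M where \<epsilon>0: "\<epsilon>0 > 0" and sys: "\<And>t. \<bar>t\<bar> < \<epsilon>0 \<Longrightarrow> \<exists>s. \<forall>z\<in>?Z. \<bar>s z\<bar> \<le> M \<and>
      s z = A z + t * (\<Sum>y\<in>?Z. B z y * s y) + t\<^sup>2 * (\<Sum>y\<in>?Z. \<Sum>k\<in>?Z. C z y k * (s y * s k))"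
    using quadratic_system_solvable[OF finite_nodes, of A B C] by blast
  define \<epsilon> where "\<epsilon> = min \<epsilon>0 1"
  have "\<forall>t. \<exists>s. \<bar>t\<bar> < \<epsilon> \<longrightarrow> (\<forall>z\<in>?Z. \<bar>s z\<bar> \<le> M \<and>
      s z = A z + t * (\<Sum>y\<in>?Z. B z y * s y) + t\<^sup>2 * (\<Sum>y\<in>?Z. \<Sum>k\<in>?Z. C z y k * (s y * s k)))"
    using sys by (auto simp: \<epsilon>_def)
  from choice[OF this] obtain s where "\<forall>t. \<bar>t\<bar> < \<epsilon> \<longrightarrow> (\<forall>z\<in>?Z. \<bar>s t z\<bar> \<le> M \<and>
      s t z = A z + t * (\<Sum>y\<in>?Z. B z y * s t y) + t\<^sup>2 * (\<Sum>y\<in>?Z. \<Sum>k\<in>?Z. C z y k * (s t y * s t k)))" ..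
  then have s: "\<And>t z. \<bar>t\<bar> < \<epsilon> \<Longrightarrow> z \<in> ?Z \<Longrightarrow> \<bar>s t z\<bar> \<le> M"
    "\<And>t z. \<bar>t\<bar> < \<epsilon> \<Longrightarrow> z \<in> ?Z \<Longrightarrow>
       s t z = A z + t * (\<Sum>y\<in>?Z. B z y * s t y) + t\<^sup>2 * (\<Sum>y\<in>?Z. \<Sum>k\<in>?Z. C z y k * (s t y * s t k))"
    by blast+
  define R where "R t = (\<lambda>x. \<Sum>z\<in>?Z. s t z *\<^sub>R e z x)" for t
  define Y where "Y t = (\<lambda>x. t *\<^sub>R v x + t\<^sup>2 *\<^sub>R R t x)" for t
  have RS: "R t \<in> ?S" for t unfolding R_def by (intro lin_space_sum S finite_nodes e)
  have YS: "Y t \<in> ?S" for t unfolding Y_def by (intro lin_spaceD[OF S] v RS)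
  have vW: "v \<in> Wvec" and RW: "\<And>t. R t \<in> Wvec" and YW: "\<And>t. Y t \<in> Wvec" using v RS YS SW by blast+
  \<comment> \<open>A curve must be admissible for all real \<open>t\<close>; away from \<open>0\<close> it may jump back to \<open>u\<close>.\<close>
  define U where "U t = (if \<bar>t\<bar> < \<epsilon> then (\<lambda>x. u x + Y t x) else u)" for t
  have sumR: "L (R t) = (\<Sum>z\<in>?Z. s t z * L (e z))" if "lin_map Wvec L" for L :: "(real^2 \<Rightarrow> real^2) \<Rightarrow> real" and t
    unfolding R_def using lin_map_sum[OF lin_space_Wvec that finite_nodes, of e] eW by simp
  have sumY: "L (Y t) = t * L v + t\<^sup>2 * L (R t)" if "lin_map Wvec L" for L :: "(real^2 \<Rightarrow> real^2) \<Rightarrow> real" and t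
    unfolding Y_def lin_mapD[OF that vW RW] by simp
  have hat0: "(LINT x:\<Omega>|lebesgue. hat z x * (det (def_grad (\<lambda>y. u y + Y t y) x) - 1)) = 0"
    if t: "\<bar>t\<bar> < \<epsilon>" and z: "z \<in> ?Z" for t z
  proof -
    note right = lin_map_polar_right[OF hat_Vh] and left = lin_map_polar_left[OF hat_Vh]
    have b: "b1 \<Omega> u (hat z) (Y t) = t\<^sup>2 * s t z"
    proof -
      note L = lin_map_b1[OF uW hat_Vh[of z]]
      have "(\<Sum>y\<in>?Z. s t y * b1 \<Omega> u (hat z) (e y)) = (\<Sum>y\<in>?Z. if y = z then s t y else 0)"
        using e(2) z by (intro sum.cong) auto
      then show ?thesis using sumY[OF L, of t] sumR[OF L, of t] ker[OF hat_Vh] z finite_nodes by simp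
    qed
    have vR: "polar (hat z) v (R t) = (\<Sum>y\<in>?Z. s t y * polar (hat z) v (e y))"
      by (rule sumR[OF right[OF vW]])
    have Rv: "polar (hat z) (R t) v = (\<Sum>y\<in>?Z. s t y * polar (hat z) (e y) v)"
      by (rule sumR[OF left[OF vW]])
    have RR: "polar (hat z) (R t) (R t) = (\<Sum>y\<in>?Z. s t y * (\<Sum>k\<in>?Z. s t k * polar (hat z) (e y) (e k)))"
      unfolding sumR[OF left[OF RW[of t]]] by (intro sum.cong refl arg_cong2[of _ _ _ _ "(*)"] sumR right eW)
    have "polar (hat z) (Y t) (Y t) = t * polar (hat z) v (Y t) + t\<^sup>2 * polar (hat z) (R t) (Y t)"
      by (rule sumY[OF left[OF YW]])
    also have "\<dots> = t * (t * polar (hat z) v v + t\<^sup>2 * polar (hat z) v (R t))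
        + t\<^sup>2 * (t * polar (hat z) (R t) v + t\<^sup>2 * polar (hat z) (R t) (R t))"
      by (simp only: sumY[OF right[OF vW]] sumY[OF right[OF RW]])
    also have "\<dots> = t\<^sup>2 * (A z + t * (polar (hat z) v (R t) + polar (hat z) (R t) v) + t\<^sup>2 * polar (hat z) (R t) (R t))"
      by (simp add: A_def power2_eq_square algebra_simps)
    also have "polar (hat z) v (R t) + polar (hat z) (R t) v = (\<Sum>y\<in>?Z. B z y * s t y)"
      unfolding vR Rv sum.distrib[symmetric] by (intro sum.cong) (auto simp: B_def algebra_simps)
    also have "polar (hat z) (R t) (R t) = (\<Sum>y\<in>?Z. \<Sum>k\<in>?Z. C z y k * (s t y * s t k))"
      unfolding RR sum_distrib_left by (intro sum.cong) (auto simp: C_def algebra_simps)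
    finally have "polar (hat z) (Y t) (Y t) = t\<^sup>2 * s t z" using s(2)[OF t z] by simp
    moreover have "(LINT x:\<Omega>|lebesgue. hat z x * (det (def_grad u x) - 1)) = 0" using u hat_Vh by (auto simp: Kh_def)
    ultimately show ?thesis using constraint_expansion[OF uW YW hat_Vh] b by simp
  qed
  have UK: "U t \<in> Kh \<Omega> \<T> \<Gamma>0 u0" for t
  proof (cases "\<bar>t\<bar> < \<epsilon>")
    case True
    have UW: "(\<lambda>y. u y + Y t y) \<in> Wvec" using lin_spaceD[OF lin_space_Wvec uW YW, of 1 1] by simp
    have lin: "lin_map (Vh \<T>) (\<lambda>q. LINT x:\<Omega>|lebesgue. q x * (det (def_grad (\<lambda>y. u y + Y t y) x) - 1))"
      by (rule lin_map_integral[OF lin_space_Vh])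
        (intro regular_intros regular_def_grad[OF UW] regular_Vh, simp_all add: algebra_simps)
    have "(LINT x:\<Omega>|lebesgue. q x * (det (def_grad (\<lambda>y. u y + Y t y) x) - 1)) = 0" if q: "q \<in> Vh \<T>" for q
    proof -
      let ?P = "\<lambda>q. LINT x:\<Omega>|lebesgue. q x * (det (def_grad (\<lambda>y. u y + Y t y) x) - 1)"
      have "?P q = ?P (\<lambda>x. \<Sum>z\<in>?Z. q z *\<^sub>R hat z x)"
        by (rule arg_cong[OF Vh_nodal_expansion[OF q]])
      also have "\<dots> = (\<Sum>z\<in>?Z. q z *\<^sub>R ?P (hat z))"
        by (rule lin_map_sum[OF lin_space_Vh lin finite_nodes hat_Vh])
      finally show ?thesis using hat0[OF True] by simp
    qed
    moreover obtain w where w: "w \<in> ?S" "u = (\<lambda>x. w x + u0 x)" using u by (auto simp: Kh_def)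
    have "(\<lambda>x. 1 *\<^sub>R w x + 1 *\<^sub>R Y t x) \<in> ?S" by (intro lin_spaceD[OF S] w YS)
    then have "\<exists>w\<in>?S. (\<lambda>y. u y + Y t y) = (\<lambda>x. w x + u0 x)"
      by (intro bexI[of _ "\<lambda>x. 1 *\<^sub>R w x + 1 *\<^sub>R Y t x"]) (auto simp: w(2))
    ultimately show ?thesis using True by (simp add: U_def Kh_def)
  qed (simp add: U_def u)
  have "quadratic_curve \<epsilon> ?Z e u v U"
    unfolding quadratic_curve_def
  proof (intro conjI ballI uW vW finite_nodes eW exI[of _ s] exI[of _ M] allI impI)
    fix t assume t: "\<bar>t\<bar> < \<epsilon>"
    show "\<bar>s t z\<bar> \<le> M" if "z \<in> ?Z" for z using s t that by blast
    show "U t = (\<lambda>x. u x + t *\<^sub>R v x + t\<^sup>2 *\<^sub>R (\<Sum>i\<in>?Z. s t i *\<^sub>R e i x))"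
      using t by (simp add: U_def Y_def R_def add.assoc)
  qed
  moreover have "U 0 = u" by (simp add: U_def Y_def)
  moreover have "0 < \<epsilon>" "\<epsilon> \<le> 1" using \<epsilon>0 by (auto simp: \<epsilon>_def)
  ultimately show ?thesis using UK by blast
qed

text \<open>
  The interpolant of \<open>|n|\<^sup>2 - 1\<close> is itself an admissible test function for the constraint.
\<close>

lemma Nh_unit:
  assumes n: "n \<in> Nh \<Omega> \<T> \<Gamma>1 n0" and tr: "interp \<T> (\<lambda>x. (norm (n x))\<^sup>2 - 1) \<in> with_bc (Vh \<T>) (\<lambda>_. 0) \<Gamma>1"
    and z: "z \<in> nodes \<T>"
  shows "norm (n z) = 1"
proof -
  let ?\<mu> = "interp \<T> (\<lambda>x. (norm (n x))\<^sup>2 - 1)"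
  have "(LINT x:\<Omega>|lebesgue. ?\<mu> x * ?\<mu> x) = 0" using n tr by (simp add: Nh_def)
  then have "?\<mu> = (\<lambda>_. 0)" by (intro integral_square_zero interp_Vh)
  then have "(norm (n z))\<^sup>2 = 1" using interp_node[OF z, of "\<lambda>x. (norm (n x))\<^sup>2 - 1"] by simp
  then show ?thesis using norm_ge_zero[of "n z"] by (auto simp: power2_eq_1_iff)
qed

end

text \<open>
  Pythagoras: \<open>|n + t m|\<^sup>2 = 1 + t\<^sup>2 |m|\<^sup>2\<close>.
\<close>

lemma norm_scaled_unit_plus_orthogonal:
  fixes n m :: "'a::real_inner"
  assumes "norm n = 1" "n \<bullet> m = 0"
  shows "norm ((1 / sqrt (1 + t\<^sup>2 * (norm m)\<^sup>2)) *\<^sub>R (n + t *\<^sub>R m)) = 1"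
proof -
  have "(norm (n + t *\<^sub>R m))\<^sup>2 = 1 + t\<^sup>2 * (norm m)\<^sup>2"
    using assms unfolding power2_norm_eq_inner norm_eq_1
    by (simp add: inner_add_left inner_add_right inner_commute power2_eq_square)
  then have "norm (n + t *\<^sub>R m) = sqrt (1 + t\<^sup>2 * (norm m)\<^sup>2)" by (metis norm_ge_zero real_sqrt_unique)
  moreover have "1 + t\<^sup>2 * (norm m)\<^sup>2 > 0" by (intro add_pos_nonneg mult_nonneg_nonneg) auto
  ultimately show ?thesis by simp
qed

text \<open>
  Normalising changes \<open>n + t m\<close> only at order \<open>t\<^sup>2\<close>, with a bound uniform in \<open>t\<close>.
\<close>

lemma inverse_sqrt_remainder:
  fixes t c :: real
  assumes "c \<ge> 0"
  shows "\<exists>k. 1 / sqrt (1 + t\<^sup>2 * c) = 1 + t\<^sup>2 * k \<and> \<bar>k\<bar> \<le> c"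
proof (cases "t = 0")
  case True
  then show ?thesis using assms by (intro exI[of _ 0]) simp
next
  case False
  define q where "q = t\<^sup>2 * c"
  define r where "r = sqrt (1 + q)"
  have q: "q \<ge> 0" using assms by (simp add: q_def)
  have r1: "r \<ge> 1" using q by (simp add: r_def)
  have r2: "r \<le> 1 + q" unfolding r_def using q by (intro real_le_lsqrt) (simp_all add: power2_sum)
  have "1 / r - 1 = - ((r - 1) / r)" using r1 by (simp add: field_simps)
  then have "\<bar>1 / r - 1\<bar> = (r - 1) / r" using r1 by (simp only: abs_minus_cancel) simp
  also have "\<dots> \<le> (r - 1) / 1" using r1 by (intro divide_left_mono) auto
  also have "\<dots> \<le> t\<^sup>2 * c" using r2 by (simp add: q_def)
  finally have "\<bar>1 / r - 1\<bar> / t\<^sup>2 \<le> c" using False by (simp add: field_simps)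
  then show ?thesis using False
    by (intro exI[of _ "(1 / r - 1) / t\<^sup>2"]) (simp add: r_def q_def)
qed

context fe_mesh
begin

text \<open>
  At each node \<open>n + t m\<close> is rescaled to unit length.  This keeps the values on \<open>\<Gamma>1\<close>, because
  \<open>m\<close> vanishes there.
\<close>

lemma Nh_curve:
  assumes G: "boundary_part \<Omega> \<T> \<Gamma>1" and n0: "n0 \<in> Vvec" and n: "n \<in> Nh \<Omega> \<T> \<Gamma>1 n0"
    and unit: "\<And>z. z \<in> nodes \<T> \<Longrightarrow> norm (n z) = 1"
    and m: "m \<in> with_bc Vvec (\<lambda>_. 0) \<Gamma>1" and orth: "\<And>z. z \<in> nodes \<T> \<Longrightarrow> n z \<bullet> m z = 0"
  shows "\<exists>e V. quadratic_curve 1 (nodes \<T> \<times> (UNIV::bool set)) e n m V \<and> V 0 = n \<and> (\<forall>t. V t \<in> Nh \<Omega> \<T> \<Gamma>1 n0)"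
proof -
  let ?Z = "nodes \<T>" and ?S = "with_bc Vvec (\<lambda>_. 0) \<Gamma>1"
  have S: "lin_space ?S" by (intro lin_space_with_bc lin_space_Vvec)
  have nV: "n \<in> Vvec" using Nh_subset[OF n0 n] .
  have mV: "m \<in> Vvec" using m by (simp add: with_bc_def)
  have "\<forall>t z. \<exists>k. 1 / sqrt (1 + t\<^sup>2 * (norm (m z))\<^sup>2) = 1 + t\<^sup>2 * k \<and> \<bar>k\<bar> \<le> (norm (m z))\<^sup>2"
    using inverse_sqrt_remainder by simp
  then obtain k where k: "\<And>t z. 1 / sqrt (1 + t\<^sup>2 * (norm (m z))\<^sup>2) = 1 + t\<^sup>2 * k t z"
    "\<And>t z. \<bar>k t z\<bar> \<le> (norm (m z))\<^sup>2" by metis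
  \<comment> \<open>The correction at a node is \<open>t\<^sup>2 k (n + t m)\<close>; its two directions \<open>n z\<close> and \<open>m z\<close> are told
    apart by the Boolean index.\<close>
  define e where "e = (\<lambda>(z, b) x. hat z x *\<^sub>R (if b then m z else n z))"
  define s where "s t = (\<lambda>(z, b). if b then t * k t z else k t z)" for t
  define R where "R t = (\<lambda>x. \<Sum>i\<in>?Z \<times> (UNIV::bool set). s t i *\<^sub>R e i x)" for t
  define V where "V t = (\<lambda>x. n x + t *\<^sub>R m x + t\<^sup>2 *\<^sub>R R t x)" for t
  have eV: "e i \<in> Vvec" for i
  proof -
    obtain z b where i: "i = (z, b)" by (cases i)
    have "(\<lambda>x. ((if b then m z else n z) $ j) *\<^sub>R hat z x + 0 *\<^sub>R hat z x) \<in> Vh \<T>" for j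
      by (intro lin_spaceD[OF lin_space_Vh] hat_Vh)
    then show ?thesis by (simp add: i e_def vec_space_def mult.commute)
  qed
  have RV: "R t \<in> Vvec" for t unfolding R_def by (intro lin_space_sum lin_space_Vvec eV) (auto intro: finite_nodes)
  have Rz: "R t z = k t z *\<^sub>R (n z + t *\<^sub>R m z)" if z: "z \<in> ?Z" for t z
  proof -
    have "R t z = (\<Sum>y\<in>?Z. \<Sum>b\<in>UNIV. s t (y, b) *\<^sub>R e (y, b) z)"
      unfolding R_def by (simp add: sum.cartesian_product split_def)
    also have "\<dots> = (\<Sum>y\<in>?Z. if y = z then k t z *\<^sub>R (n z + t *\<^sub>R m z) else 0)"
      using z by (intro sum.cong refl) (auto simp: UNIV_bool s_def e_def hat_node algebra_simps)
    finally show ?thesis using z finite_nodes by simp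
  qed
  have "R t x = 0" if x: "x \<in> \<Gamma>1" for t x
  proof -
    have "R t x $ j = 0" for j
    proof (rule Vh_zero_on_boundary_part[OF G Vvec_comp[OF RV] _ x])
      fix z assume "z \<in> ?Z" "z \<in> \<Gamma>1"
      moreover from this have "k t z = 0" using k(2)[of t z] m by (auto simp: with_bc_def)
      ultimately show "R t z $ j = 0" using Rz by simp
    qed
    then show ?thesis by (simp add: vec_eq_iff)
  qed
  then have RS: "R t \<in> ?S" for t using RV by (simp add: with_bc_def)
  have VN: "V t \<in> Nh \<Omega> \<T> \<Gamma>1 n0" for t
  proof -
    obtain w where w: "w \<in> ?S" "n = (\<lambda>x. w x + n0 x)" using n by (auto simp: Nh_def)
    have "(\<lambda>x. 1 *\<^sub>R w x + 1 *\<^sub>R (t *\<^sub>R m x + t\<^sup>2 *\<^sub>R R t x)) \<in> ?S" by (intro lin_spaceD[OF S] w m RS)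
    then have 1: "\<exists>w\<in>?S. V t = (\<lambda>x. w x + n0 x)"
      by (intro bexI[of _ "\<lambda>x. 1 *\<^sub>R w x + 1 *\<^sub>R (t *\<^sub>R m x + t\<^sup>2 *\<^sub>R R t x)"]) (auto simp: V_def w(2))
    have "norm (V t z) = 1" if z: "z \<in> ?Z" for z
    proof -
      have "V t z = (1 + t\<^sup>2 * k t z) *\<^sub>R (n z + t *\<^sub>R m z)" unfolding V_def Rz[OF z] by (simp add: algebra_simps)
      then show ?thesis unfolding k(1)[symmetric] using norm_scaled_unit_plus_orthogonal unit orth z by metis
    qed
    then have "interp \<T> (\<lambda>y. (norm (V t y))\<^sup>2 - 1) = (\<lambda>_. 0)"
      by (intro interp_eqI lin_space_zero lin_space_Vh) simp
    then show ?thesis using 1 by (simp add: Nh_def)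
  qed
  have "quadratic_curve 1 (?Z \<times> (UNIV::bool set)) e n m V"
    unfolding quadratic_curve_def
  proof (intro conjI ballI exI[of _ s] exI[of _ "\<Sum>z\<in>?Z. (norm (m z))\<^sup>2"] allI impI)
    show "n \<in> Wvec" "m \<in> Wvec" "e i \<in> Wvec" for i using nV mV eV Vvec_subset_Wvec by blast+
    show "finite (?Z \<times> (UNIV::bool set))" using finite_nodes by simp
    fix t :: real assume t: "\<bar>t\<bar> < 1"
    show "\<bar>s t i\<bar> \<le> (\<Sum>z\<in>?Z. (norm (m z))\<^sup>2)" if mem: "i \<in> ?Z \<times> (UNIV::bool set)" for i
    proof -
      obtain z b where i: "i = (z, b)" "z \<in> ?Z" using mem by (cases i) auto
      have "\<bar>t\<bar> * \<bar>k t z\<bar> \<le> \<bar>k t z\<bar>" using t by (intro mult_left_le_one_le) auto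
      then have "\<bar>s t i\<bar> \<le> \<bar>k t z\<bar>" by (simp add: i s_def abs_mult)
      also have "\<dots> \<le> (norm (m z))\<^sup>2" by (rule k)
      also have "\<dots> \<le> (\<Sum>z\<in>?Z. (norm (m z))\<^sup>2)" using i finite_nodes by (intro member_le_sum) auto
      finally show ?thesis .
    qed
    show "V t = (\<lambda>x. n x + t *\<^sub>R m x + t\<^sup>2 *\<^sub>R (\<Sum>i\<in>?Z \<times> UNIV. s t i *\<^sub>R e i x))"
      by (simp add: V_def R_def)
  qed
  moreover have "V 0 = n" by (simp add: V_def)
  ultimately show ?thesis using VN by blast
qed

section \<open>Multipliers of stationary states\<close>

lemma b1_nondegenerate:
  assumes "inf_sup_b1 \<Omega> \<T> \<Gamma>0 u" "q \<in> Vh \<T>" "q \<noteq> (\<lambda>_. 0)"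
  shows "\<exists>v\<in>with_bc Wvec (\<lambda>_. 0) \<Gamma>0. b1 \<Omega> u q v \<noteq> 0"
proof -
  have "\<exists>v\<in>with_bc Wvec (\<lambda>_. 0) \<Gamma>0 - {\<lambda>_. 0}. b1 \<Omega> u q v \<noteq> 0"
    using assms unfolding inf_sup_b1_def
    by (elim exE conjE, intro ex_nonzero_of_inf_sup[where B = "b1 \<Omega> u" and
        N = "\<lambda>q v. L2_norm \<Omega> q * H1_norm \<Omega> v (grad v)" and Q = "Vh \<T> - {\<lambda>_. 0}"]) auto
  then show ?thesis by blast
qed

lemma b2_nondegenerate:
  assumes "inf_sup_b2 \<Omega> \<T> \<Gamma>1 n" "\<mu> \<in> with_bc (Vh \<T>) (\<lambda>_. 0) \<Gamma>1" "\<mu> \<noteq> (\<lambda>_. 0)"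
  shows "\<exists>m\<in>with_bc Vvec (\<lambda>_. 0) \<Gamma>1. b2 \<Omega> \<T> n \<mu> m \<noteq> 0"
proof -
  have "\<exists>m\<in>with_bc Vvec (\<lambda>_. 0) \<Gamma>1 - {\<lambda>_. 0}. b2 \<Omega> \<T> n \<mu> m \<noteq> 0"
    using assms unfolding inf_sup_b2_def
    by (elim exE conjE, intro ex_nonzero_of_inf_sup[where B = "b2 \<Omega> \<T> n" and
        N = "\<lambda>\<mu> m. dual_norm \<Omega> \<T> \<Gamma>1 \<mu> * H1_norm \<Omega> m (grad m)" and
        Q = "with_bc (Vh \<T>) (\<lambda>_. 0) \<Gamma>1 - {\<lambda>_. 0}"]) auto
  then show ?thesis by blast
qed

text \<open>
  Since \<open>m\<close> vanishes on \<open>\<Gamma>1\<close>, the interpolant of \<open>n \<sqdot> m\<close> is an admissible multiplier, and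
  testing with it gives twice its squared \<open>L\<^sup>2\<close> norm.
\<close>

lemma b2_kernel:
  assumes G: "boundary_part \<Omega> \<T> \<Gamma>1" and m: "m \<in> with_bc Vvec (\<lambda>_. 0) \<Gamma>1"
    and ker: "\<forall>\<mu>\<in>with_bc (Vh \<T>) (\<lambda>_. 0) \<Gamma>1. b2 \<Omega> \<T> n \<mu> m = 0"
  shows "interp \<T> (\<lambda>y. n y \<bullet> m y) = (\<lambda>_. 0)"
proof -
  let ?q = "interp \<T> (\<lambda>y. n y \<bullet> m y)"
  have "?q \<in> with_bc (Vh \<T>) (\<lambda>_. 0) \<Gamma>1"
    unfolding Vh_bc_eq_nodal[OF G] nodal_space_def using m by (auto simp: interp_Vh interp_node with_bc_def)
  then have "b2 \<Omega> \<T> n ?q m = 0" using ker by blast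
  then have "(LINT x:\<Omega>|lebesgue. 2 * (?q x * ?q x)) = 0" by (simp add: b2_def mult.assoc)
  then have "(LINT x:\<Omega>|lebesgue. ?q x * ?q x) = 0" by simp
  then show ?thesis by (intro integral_square_zero interp_Vh)
qed

lemma stationary_residual:
  assumes stat: "stationary_on K N (energy \<Omega> \<T> \<Gamma>2 a b f g) u n"
    and f: "set_integrable lebesgue \<Omega> f" and g: "boundary_integrable \<Omega> \<T> \<Gamma>2 g" and \<epsilon>: "0 < \<epsilon>" "\<epsilon> \<le> 1"
    and U: "quadratic_curve \<epsilon> I e u v U" "U 0 = u" "\<And>t. U t \<in> K"
    and V: "quadratic_curve \<epsilon> J e' n m V" "V 0 = n" "\<And>t. V t \<in> N"
  shows "momentum_residual \<Omega> \<T> \<Gamma>2 a f g u n v + director_residual \<Omega> a b u n m = 0"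
proof -
  have "(\<forall>t. U t \<in> K \<and> V t \<in> N) \<and> U 0 = u \<and> V 0 = n \<and>
      (\<forall>x. (\<lambda>t. U t x) differentiable (at 0) \<and> (\<lambda>t. V t x) differentiable (at 0))"
    using U V quadratic_curve_differentiable[OF U(1) \<epsilon>(1)] quadratic_curve_differentiable[OF V(1) \<epsilon>(1)]
    by blast
  with energy_derivative[OF \<epsilon> f g U(1) V(1), of a b] stat show ?thesis
    unfolding stationary_on_def by blast
qed

text \<open>
  Vary \<open>u\<close> along a curve in \<open>K\<^sub>h\<close> with velocity \<open>v\<close> and keep \<open>n\<close> fixed.
\<close>

lemma momentum_residual_kernel:
  assumes stat: "stationary_on (Kh \<Omega> \<T> \<Gamma>0 u0) N (energy \<Omega> \<T> \<Gamma>2 a b f g) u n"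
    and f: "set_integrable lebesgue \<Omega> f" and g: "boundary_integrable \<Omega> \<T> \<Gamma>2 g"
    and u0: "u0 \<in> Wvec" and u: "u \<in> Kh \<Omega> \<T> \<Gamma>0 u0" and n: "n \<in> N" "n \<in> Wvec"
    and nondeg: "\<And>q. q \<in> Vh \<T> \<Longrightarrow> q \<noteq> (\<lambda>_. 0) \<Longrightarrow> \<exists>v\<in>with_bc Wvec (\<lambda>_. 0) \<Gamma>0. b1 \<Omega> u q v \<noteq> 0"
    and v: "v \<in> with_bc Wvec (\<lambda>_. 0) \<Gamma>0" and ker: "\<forall>q\<in>Vh \<T>. b1 \<Omega> u q v = 0"
  shows "momentum_residual \<Omega> \<T> \<Gamma>2 a f g u n v = 0"
proof -
  obtain \<epsilon> e U where \<epsilon>: "0 < \<epsilon>" "\<epsilon> \<le> 1" and U: "quadratic_curve \<epsilon> (nodes \<T>) e u v U" "U 0 = u"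
    "\<And>t. U t \<in> Kh \<Omega> \<T> \<Gamma>0 u0"
    using Kh_curve[OF u0 u nondeg v] ker by blast
  have "momentum_residual \<Omega> \<T> \<Gamma>2 a f g u n v + director_residual \<Omega> a b u n (\<lambda>_. 0) = 0"
    by (rule stationary_residual[OF stat f g \<epsilon> U quadratic_curve_const[OF n(2), of \<epsilon> "\<lambda>_::real. n"]])
      (simp_all add: n)
  then show ?thesis
    using lin_map_zero[OF lin_space_Wvec lin_map_director[OF Kh_subset[OF u0 u] n(2), of a b]] by simp
qed

text \<open>
  Keep \<open>u\<close> fixed and rotate the nodal values of \<open>n\<close>.
\<close>

lemma director_residual_tangent:
  assumes stat: "stationary_on K (Nh \<Omega> \<T> \<Gamma>1 n0) (energy \<Omega> \<T> \<Gamma>2 a b f g) u n"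
    and f: "set_integrable lebesgue \<Omega> f" and g: "boundary_integrable \<Omega> \<T> \<Gamma>2 g"
    and G: "boundary_part \<Omega> \<T> \<Gamma>1" and n0: "n0 \<in> Vvec" and n: "n \<in> Nh \<Omega> \<T> \<Gamma>1 n0"
    and unit: "\<And>z. z \<in> nodes \<T> \<Longrightarrow> norm (n z) = 1" and u: "u \<in> K" "u \<in> Wvec"
    and m: "m \<in> with_bc Vvec (\<lambda>_. 0) \<Gamma>1" and orth: "\<And>z. z \<in> nodes \<T> \<Longrightarrow> n z \<bullet> m z = 0"
  shows "director_residual \<Omega> a b u n m = 0"
proof -
  obtain e V where V: "quadratic_curve 1 (nodes \<T> \<times> (UNIV::bool set)) e n m V" "V 0 = n"
    "\<And>t. V t \<in> Nh \<Omega> \<T> \<Gamma>1 n0"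
    using Nh_curve[OF G n0 n unit m orth] by blast
  have nW: "n \<in> Wvec" using V(1) by (simp add: quadratic_curve_def)
  have "momentum_residual \<Omega> \<T> \<Gamma>2 a f g u n (\<lambda>_. 0) + director_residual \<Omega> a b u n m = 0"
    by (rule stationary_residual[OF stat f g zero_less_one order_refl
          quadratic_curve_const[OF u(2), of 1 "\<lambda>_::real. u"] _ _ V]) (simp_all add: u)
  then show ?thesis
    using lin_map_zero[OF lin_space_Wvec lin_map_momentum[OF u(2) nW f g, of a]] by simp
qed

end

theorem theorem18:
  fixes \<Omega> \<Gamma>0 \<Gamma>1 \<Gamma>2 :: "(real^2) set" and \<T> :: "(real^2) set set"
    and a b :: real
    and f g u0 n0 u n :: "real^2 \<Rightarrow> real^2"
    and lam0 :: "real^2 \<Rightarrow> real"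
  assumes mesh: "triangular_mesh \<Omega> \<T>"
    and parts: "boundary_part \<Omega> \<T> \<Gamma>0" "boundary_part \<Omega> \<T> \<Gamma>1" "boundary_part \<Omega> \<T> \<Gamma>2"
    and a: "0 < a" "a < 1"
    and f: "set_integrable lebesgue \<Omega> f"
    and g: "boundary_integrable \<Omega> \<T> \<Gamma>2 g"
    and u0: "u0 \<in> vec_space (Wh \<T>)"
    and n0: "n0 \<in> vec_space (Vh \<T>)"
    and lam0: "with_bc (Vh \<T>) lam0 \<Gamma>1 \<noteq> {}"
    and u: "u \<in> Kh \<Omega> \<T> \<Gamma>0 u0"
    and n: "n \<in> Nh \<Omega> \<T> \<Gamma>1 n0"
    and n_trace: "interp \<T> (\<lambda>x. (norm (n x))\<^sup>2 - 1) \<in> with_bc (Vh \<T>) (\<lambda>_. 0) \<Gamma>1"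
    and stationary: "stationary_on (Kh \<Omega> \<T> \<Gamma>0 u0) (Nh \<Omega> \<T> \<Gamma>1 n0) (energy \<Omega> \<T> \<Gamma>2 a b f g) u n"
    and inf_sup: "inf_sup_b1 \<Omega> \<T> \<Gamma>0 u" "inf_sup_b2 \<Omega> \<T> \<Gamma>1 n"
  shows "\<exists>p l. p \<in> Vh \<T> \<and> l \<in> with_bc (Vh \<T>) lam0 \<Gamma>1 \<and>
           discrete_equilibrium \<Omega> \<T> \<Gamma>0 \<Gamma>1 \<Gamma>2 a b f g u n p l \<and>
           (\<forall>p' l'. p' \<in> Vh \<T> \<and> l' \<in> with_bc (Vh \<T>) lam0 \<Gamma>1 \<and>
              discrete_equilibrium \<Omega> \<T> \<Gamma>0 \<Gamma>1 \<Gamma>2 a b f g u n p' l' \<longrightarrow> p' = p \<and> l' = l)"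
proof -
  interpret fe_mesh \<Omega> \<T> by unfold_locales (rule mesh)
  let ?W = "with_bc Wvec (\<lambda>_. 0) \<Gamma>0" and ?V = "with_bc Vvec (\<lambda>_. 0) \<Gamma>1" and ?Q = "with_bc (Vh \<T>) (\<lambda>_. 0) \<Gamma>1"
  let ?L = "momentum_residual \<Omega> \<T> \<Gamma>2 a f g u n" and ?D = "director_residual \<Omega> a b u n"
  have uW: "u \<in> Wvec" using Kh_subset[OF u0 u] .
  have nV: "n \<in> Vvec" using Nh_subset[OF n0 n] .
  have nW: "n \<in> Wvec" using nV Vvec_subset_Wvec by blast
  have unit: "\<And>z. z \<in> nodes \<T> \<Longrightarrow> norm (n z) = 1" using Nh_unit[OF n n_trace] .
  have W: "lin_space ?W" "?W \<subseteq> Wvec"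
    by (intro lin_space_with_bc lin_space_Wvec) (auto simp: with_bc_def)
  have V: "lin_space ?V" "?V \<subseteq> Vvec"
    by (intro lin_space_with_bc lin_space_Vvec) (auto simp: with_bc_def)
  have VW: "?V \<subseteq> Wvec" using V(2) Vvec_subset_Wvec by blast
  note L = lin_map_momentum[OF uW nW f g, of a] and D = lin_map_director[OF uW nW, of a b]
  note part = parts(2)
  note nondeg1 = b1_nondegenerate[OF inf_sup(1)] and nondeg2 = b2_nondegenerate[OF inf_sup(2)]
  have L0: "?L v = 0" if "v \<in> ?W" "\<forall>q\<in>Vh \<T>. b1 \<Omega> u q v = 0" for v
    by (rule momentum_residual_kernel[OF stationary f g u0 u n nW nondeg1 that])
  have D0: "?D m = 0" if "m \<in> ?V" "\<And>z. z \<in> nodes \<T> \<Longrightarrow> n z \<bullet> m z = 0" for m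
    by (rule director_residual_tangent[OF stationary f g part n0 n unit u uW that])
  obtain p where p: "p \<in> Vh \<T>" "\<And>v. v \<in> ?W \<Longrightarrow> b1 \<Omega> u p v = - ?L v"
  proof -
    have "\<exists>p\<in>nodal_space (nodes \<T>). \<forall>v\<in>?W. b1 \<Omega> u p v = - ?L v"
    proof (rule nodal_multiplier[OF W(1) order_refl], unfold Vh_eq_nodal[symmetric])
      show "lin_map ?W (b1 \<Omega> u q)" if "q \<in> Vh \<T>" for q by (rule lin_map_subset[OF lin_map_b1[OF uW that] W(2)])
      show "lin_map (Vh \<T>) (\<lambda>q. b1 \<Omega> u q v)" if "v \<in> ?W" for v using lin_map_b1_multiplier[OF uW] W(2) that by blast
      show "lin_map ?W (\<lambda>v. - ?L v)" using lin_map_subset[OF lin_map_scaled[OF L, of "-1"] W(2)] by simp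
    qed (use nondeg1 L0 in auto)
    then show ?thesis using that by (auto simp: Vh_eq_nodal[symmetric])
  qed
  \<comment> \<open>The multiplier is sought as \<open>l0 + \<mu>\<close>, where \<open>l0\<close> carries the boundary values.\<close>
  obtain l0 where l0: "l0 \<in> with_bc (Vh \<T>) lam0 \<Gamma>1" using lam0 by blast
  then have l0V: "l0 \<in> Vh \<T>" by (simp add: with_bc_def)
  obtain \<mu> where \<mu>: "\<mu> \<in> ?Q" "\<And>m. m \<in> ?V \<Longrightarrow> b2 \<Omega> \<T> n \<mu> m = - ?D m - b2 \<Omega> \<T> n l0 m"
  proof -
    have "\<exists>\<mu>\<in>nodal_space (nodes \<T> - \<Gamma>1). \<forall>m\<in>?V. b2 \<Omega> \<T> n \<mu> m = (-1) * ?D m + (-1) * b2 \<Omega> \<T> n l0 m"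
    proof (rule nodal_multiplier[OF V(1) Diff_subset], unfold Vh_bc_eq_nodal[OF part, symmetric])
      show "lin_map ?V (b2 \<Omega> \<T> n q)" if "q \<in> ?Q" for q
        using that by (intro lin_map_subset[OF lin_map_b2 V(2)]) (simp add: with_bc_def)
      show "lin_map ?Q (\<lambda>q. b2 \<Omega> \<T> n q m)" for m
        by (rule lin_map_subset[OF lin_map_b2_multiplier]) (auto simp: with_bc_def)
      show "lin_map ?V (\<lambda>m. (-1) * ?D m + (-1) * b2 \<Omega> \<T> n l0 m)"
        by (intro lin_map_lincomb lin_map_subset[OF D VW] lin_map_subset[OF lin_map_b2[OF l0V] V(2)])
      fix m assume m: "m \<in> ?V" and ker: "\<forall>q\<in>?Q. b2 \<Omega> \<T> n q m = 0"
      have 0: "interp \<T> (\<lambda>y. n y \<bullet> m y) = (\<lambda>_. 0)" by (rule b2_kernel[OF part m ker])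
      then have "n z \<bullet> m z = 0" if "z \<in> nodes \<T>" for z using interp_node[OF that, of "\<lambda>y. n y \<bullet> m y"] by simp
      then have "?D m = 0" by (rule D0[OF m])
      moreover have "b2 \<Omega> \<T> n l0 m = 0" unfolding b2_def 0 by simp
      ultimately show "(-1) * ?D m + (-1) * b2 \<Omega> \<T> n l0 m = 0" by simp
    qed (rule nondeg2)
    then show ?thesis using that by (auto simp: Vh_bc_eq_nodal[OF part])
  qed
  define l where "l = (\<lambda>x. 1 *\<^sub>R l0 x + 1 *\<^sub>R \<mu> x)"
  have \<mu>V: "\<mu> \<in> Vh \<T>" using \<mu> by (simp add: with_bc_def)
  have lV: "l \<in> Vh \<T>" unfolding l_def by (intro lin_spaceD[OF lin_space_Vh] l0V \<mu>V)
  have l: "l \<in> with_bc (Vh \<T>) lam0 \<Gamma>1" using lV l0 \<mu>(1) by (simp add: with_bc_def l_def)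
  have bl: "b2 \<Omega> \<T> n l m = - ?D m" if "m \<in> ?V" for m
    unfolding l_def using lin_mapD[OF lin_map_b2_multiplier[of n m] l0V \<mu>V, of 1 1] \<mu>(2)[OF that] by simp
  have mom: "(\<forall>v\<in>?W. 0 = (LINT x:\<Omega>|lebesgue.
               2 * (def_grad u x \<bullet> grad v x
                    - (1 - a) * ((transpose (def_grad u x) *v n x) \<bullet> (transpose (grad v x) *v n x)))
               - p' x * (det_grad (def_grad u x) \<bullet> grad v x))
            - (LINT x:\<Omega>|lebesgue. f x \<bullet> v x)
            - boundary_integral \<Omega> \<T> \<Gamma>2 (\<lambda>x. g x \<bullet> v x)) \<longleftrightarrow> (\<forall>v\<in>?W. b1 \<Omega> u p' v = - ?L v)"
    if "p' \<in> Vh \<T>" for p'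
    using W(2) by (intro ball_cong refl) (subst momentum_equation[OF uW nW _ that]; auto)
  have dir: "(\<forall>m\<in>?V. 0 = (LINT x:\<Omega>|lebesgue.
               - 2 * (1 - a) * ((transpose (def_grad u x) *v n x) \<bullet> (transpose (def_grad u x) *v m x))
               + 2 * b * (grad m x \<bullet> grad n x)
               + 2 * l' x * interp \<T> (\<lambda>y. n y \<bullet> m y) x)) \<longleftrightarrow> (\<forall>m\<in>?V. b2 \<Omega> \<T> n l' m = - ?D m)"
    if "l' \<in> Vh \<T>" for l'
    using VW by (intro ball_cong refl) (subst director_equation[OF uW nW _ that]; auto)
  have "discrete_equilibrium \<Omega> \<T> \<Gamma>0 \<Gamma>1 \<Gamma>2 a b f g u n p l"
    unfolding discrete_equilibrium_def mom[OF p(1)] dir[OF lV]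
  proof (intro conjI ballI p(2) bl)
    fix q assume "q \<in> Vh \<T>"
    then have "(LINT x:\<Omega>|lebesgue. q x * (det (def_grad u x) - 1)) = 0" using u by (simp add: Kh_def)
    then have "(LINT x:\<Omega>|lebesgue. (-1) * (q x * (det (def_grad u x) - 1))) = 0"
      by (simp only: set_integral_mult_right mult_zero_right)
    then show "0 = (LINT x:\<Omega>|lebesgue. - q x * (det (def_grad u x) - 1))" by simp
  next
    fix q assume "q \<in> ?Q"
    then show "0 = (LINT x:\<Omega>|lebesgue. q x * interp \<T> (\<lambda>y. n y \<bullet> n y - 1) x)"
      using n by (simp add: Nh_def power2_norm_eq_inner)
  qed
  moreover have "p' = p \<and> l' = l" if p': "p' \<in> Vh \<T>" and l': "l' \<in> with_bc (Vh \<T>) lam0 \<Gamma>1"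
    and eq: "discrete_equilibrium \<Omega> \<T> \<Gamma>0 \<Gamma>1 \<Gamma>2 a b f g u n p' l'" for p' l'
  proof
    have l'V: "l' \<in> Vh \<T>" using l' by (simp add: with_bc_def)
    have bp': "\<And>v. v \<in> ?W \<Longrightarrow> b1 \<Omega> u p' v = - ?L v" and bl': "\<And>m. m \<in> ?V \<Longrightarrow> b2 \<Omega> \<T> n l' m = - ?D m"
      using eq unfolding discrete_equilibrium_def mom[OF p'] dir[OF l'V] by blast+
    let ?r = "\<lambda>x. 1 *\<^sub>R p' x + (-1) *\<^sub>R p x"
    have "b1 \<Omega> u ?r v = 0" if v: "v \<in> ?W" for v
      using lin_mapD[OF lin_map_b1_multiplier[OF uW subsetD[OF W(2) v]] p' p(1), of 1 "-1"] bp'[OF v] p(2)[OF v]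
      by simp
    moreover have "?r \<in> Vh \<T>" by (intro lin_spaceD[OF lin_space_Vh] p' p)
    ultimately have "?r = (\<lambda>_. 0)" using nondeg1 by blast
    then show "p' = p" by (auto simp: fun_eq_iff)
    let ?s = "\<lambda>x. 1 *\<^sub>R l' x + (-1) *\<^sub>R l x"
    have "b2 \<Omega> \<T> n ?s m = 0" if "m \<in> ?V" for m
      using lin_mapD[OF lin_map_b2_multiplier[of n m] l'V lV, of 1 "-1"] bl'[OF that] bl[OF that] by simp
    moreover have "?s \<in> Vh \<T>" by (intro lin_spaceD[OF lin_space_Vh] l'V lV)
    then have "?s \<in> ?Q" using l l' by (simp add: with_bc_def)
    ultimately have "?s = (\<lambda>_. 0)" using nondeg2 by blast
    then show "l' = l" by (auto simp: fun_eq_iff)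
  qed
  ultimately show ?thesis using p(1) l by blast
qed

end
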